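(* Let $((A,\phi),(A^*,W),\varphi)$ be a quasi-Jacobi bialgebroid over a differentiable manifold $M$. Then the bracket $\{\cdot,\cdot\}:C^\infty(M,\mathbb{R})\times C^\infty(M,\mathbb{R})\to C^\infty(M,\mathbb{R})$ given by $$\{f,g\}=\langle d^\phi f,d_*^Wg\rangle,\qquad f,g\in C^\infty(M,\mathbb{R}),$$ defines an $(A^*,W)$-quasi Jacobi structure on $M$.
   Context: Conventions. For a vector bundle $A$ with a bundle map $a:A\to TM$ and a skew-symmetric bracket $[\cdot,\cdot]$ on $\Gamma(A)$ satisfying $[X,fY]=f[X,Y]+(a(X)f)Y$, the (quasi-)differential $d$ on $\Gamma(\bigwedge A^* )$ is given by the usual Cartan formula ($\langle df,X\rangle=a(X)f$, $d\alpha(X,Y)=a(X)\langle\alpha,Y\rangle-a(Y)\langle\alpha,X\rangle-\langle\alpha,[X,Y]\rangle$, and so on); $d^2$ need not vanish. $d^\phi\alpha=d\alpha+\phi\wedge\alpha$ (so $d^\phi f=df+f\phi$). Likewise $d_*$ is the differential on $\Gamma(\bigwedge A)$ determined by $([\cdot,\cdot]_*,a_* )$ on $A^*$, and $d_*^WP=d_*P+W\wedge P$. $W\in\Gamma(A)$ is a $1$-cocycle of $A^*$ if $d_*W=0$. Brackets on sections are extended to multisections as Schouten-type brackets with $[X,f]=a(X)f$, $[P,Q]=-(-1)^{(p-1)(q-1)}[Q,P]$, $[P,Q\wedge R]=[P,Q]\wedge R+(-1)^{(p-1)q}Q\wedge[P,R]$; the bracket modified by $\phi\in\Gamma(A^*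 )$ is $[P,Q]^\phi=[P,Q]+(p-1)P\wedge i_\phi Q-(-1)^{p-1}(q-1)\,i_\phi P\wedge Q$ for $P\in\Gamma(\bigwedge^pA)$, $Q\in\Gamma(\bigwedge^qA)$. "c.p." denotes the terms obtained by cyclic permutation. Quasi-Jacobi bialgebroid. Let $A,A^*$ be dual vector bundles over $M$, $\phi\in\Gamma(A^* )$, $W\in\Gamma(A)$, $\varphi\in\Gamma(\bigwedge^3A^* )$. A quasi-Jacobi bialgebroid structure on $((A,\phi),(A^*,W),\varphi)$ consists of a Lie algebroid structure $([\cdot,\cdot]_*,a_* )$ with $1$-cocycle $W$ on $A^*$, a bundle map $a:A\to TM$ and a skew-symmetric operation $[\cdot,\cdot]$ on $\Gamma(A)$ such that for all $X,Y,Z\in\Gamma(A)$, $f\in C^\infty(M,\mathbb{R})$: 1) $[X,fY]=f[X,Y]+(a(X)f)Y$; 2) $a([X,Y])=[a(X),a(Y)]-a_*(\varphi(X,Y,\cdot))$; 3) $[[X,Y],Z]+c.p.=-d_*^W(\varphi(X,Y,Z))-\big((i_{\varphi(X,Y,\cdot)}d_*^WZ)+c.p.\big)$; 4) $d\phi-\varphi(W,\cdot,\cdot)=0$; 5) $d^\phi\varphi=0$; 6) $d_*^W[P,Q]^\phi=[d_*^WP,Q]^\phi+(-1)^{p+1}[P,d_*^WQ]^\phi$ for $P\in\Gamma(\bigwedge^pA)$, $Q\in\Gamma(\bigwedge A)$. $TM\times\mathbb{R}$. It is the Lie algebroid over $M$ with bracket $[(X,f),(Y,g)]=([X,Y],X(g)-Y(f))$,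 anchor the projection $\pi$ onto $TM$, and $1$-cocycle $(0,1)\in\Gamma(T^*M\times\mathbb{R})$. $[\cdot,\cdot]^{(0,1)}$ is its Schouten bracket modified by $(0,1)$. With $e=(0,1)\in\Gamma(TM\times\mathbb{R})$, a pair $(P,S)\in\Gamma(\bigwedge^kTM)\times\Gamma(\bigwedge^{k-1}TM)$ is identified with $P+e\wedge S\in\Gamma(\bigwedge^k(TM\times\mathbb{R}))$. $(A^*,W)$-quasi Jacobi structure. Let $a_*^W:\Gamma(A^* )\to\Gamma(TM\times\mathbb{R})$, $a_*^W(\alpha)=(a_*(\alpha),\langle\alpha,W\rangle)$, extended naturally (multiplicatively) to $\Gamma(\bigwedge^3A^* )\to\Gamma(\bigwedge^3(TM\times\mathbb{R}))$. The bracket $\{\cdot,\cdot\}$ on $C^\infty(M,\mathbb{R})$ defines an $(A^*,W)$-quasi Jacobi structure on $M$ if there is a pair $(\Lambda,E)\in\Gamma(\bigwedge^2(TM\times\mathbb{R}))$, with $\Lambda$ a bivector field and $E$ a vector field, such that $\{f,g\}=\Lambda(\delta f,\delta g)+fE(g)-gE(f)$ for all $f,g$ ($\delta$ the de Rham differential), and $$\tfrac12[(\Lambda,E),(\Lambda,E)]^{(0,1)}=a_*^W(\varphi).$$ The pair is necessarily given by $\Lambda(\delta f,\delta g)=\langle df,d_*g\rangle$ and $E=a_*(\phi)=-a(W)$. *)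

theory Defs
  imports
    "HOL-Analysis.Analysis"
    "HOL-Library.Function_Algebras"
    "HOL-Combinatorics.Permutations"
begin

section \<open>Pointwise real vector space structure on functions\<close>

instantiation "fun" :: (type, real_vector) real_vector
begin

definition "scaleR_fun (c :: real) f = (\<lambda>x. c *\<^sub>R f x)"

instance
  by standard (simp_all add: scaleR_fun_def fun_eq_iff scaleR_add_right scaleR_add_left)

end

lemma scaleR_fun_apply [simp]: "(c *\<^sub>R f) x = c *\<^sub>R f x"
  by (simp add: scaleR_fun_def)


section \<open>Smooth manifolds\<close>

text \<open>The predicates are meant for open \<^term>\<open>S\<close>.\<close>

primrec Ck_on :: "nat \<Rightarrow> 'e::euclidean_space set \<Rightarrow> ('e \<Rightarrow> real) \<Rightarrow> bool" where
  "Ck_on 0 S f \<longleftrightarrow> continuous_on S f"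
| "Ck_on (Suc k) S f \<longleftrightarrow>
     (\<forall>x\<in>S. f differentiable (at x)) \<and>
     (\<forall>b\<in>Basis. Ck_on k S (\<lambda>x. frechet_derivative f (at x) b))"

definition smooth_on :: "'e::euclidean_space set \<Rightarrow> ('e \<Rightarrow> real) \<Rightarrow> bool" where
  "smooth_on S f \<longleftrightarrow> (\<forall>k. Ck_on k S f)"

type_synonym ('m, 'e) atlas = "('m set \<times> ('m \<Rightarrow> 'e)) set"

text \<open>The manifold is the whole type \<^typ>\<open>'m\<close>; the Hausdorff and second countability axioms are
  the type class constraints.  The atlas need not be maximal.\<close>

definition smooth_manifold ::
    "('m::{t2_space, second_countable_topology}, 'e::euclidean_space) atlas \<Rightarrow> bool" where
  "smooth_manifold \<A> \<longleftrightarrow>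
     (\<Union>(U, \<psi>)\<in>\<A>. U) = UNIV \<and>
     (\<forall>(U, \<psi>)\<in>\<A>. open U \<and> open (\<psi> ` U) \<and> homeomorphism U (\<psi> ` U) \<psi> (inv_into U \<psi>)) \<and>
     (\<forall>(U, \<psi>)\<in>\<A>. \<forall>(V, \<eta>)\<in>\<A>. \<forall>b\<in>Basis.
        smooth_on (\<psi> ` (U \<inter> V)) (\<lambda>y. \<eta> (inv_into U \<psi> y) \<bullet> b))"

text \<open>Smoothness of a function on an open subset \<^term>\<open>U\<close> of the manifold.\<close>

definition smooth_fun_on :: "('m, 'e::euclidean_space) atlas \<Rightarrow> 'm set \<Rightarrow> ('m \<Rightarrow> real) \<Rightarrow> bool" where
  "smooth_fun_on \<A> U f \<longleftrightarrow> (\<forall>(V, \<psi>)\<in>\<A>. smooth_on (\<psi> ` (U \<inter> V)) (f \<circ> inv_into V \<psi>))"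

definition Cinf :: "('m, 'e::euclidean_space) atlas \<Rightarrow> ('m \<Rightarrow> real) set" where
  "Cinf \<A> = {f. smooth_fun_on \<A> UNIV f}"


section \<open>Vector bundles\<close>

text \<open>A vector bundle is represented by its fibres, each a linear subspace of one real vector space
  \<^typ>\<open>'v\<close> (distinct fibres are kept apart by the base point), together with the set of its smooth
  global sections.\<close>

record ('m, 'v) vbundle =
  fibre :: "'m \<Rightarrow> 'v set"
  sections :: "('m \<Rightarrow> 'v) set"

text \<open>A local frame is a triple \<^term>\<open>(U, n, e)\<close> with \<^term>\<open>e i\<close>, \<^term>\<open>i < n\<close>, the frame sections
  over \<^term>\<open>U\<close>; the next predicate says that \<^term>\<open>s\<close> has smooth coefficients over
  \<^term>\<open>U' \<subseteq> U\<close>.\<close>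

definition smooth_wrt_frame ::
    "('m, 'e::euclidean_space) atlas \<Rightarrow> 'm set \<Rightarrow> nat \<Rightarrow> (nat \<Rightarrow> 'm \<Rightarrow> 'v::real_vector)
      \<Rightarrow> ('m \<Rightarrow> 'v) \<Rightarrow> bool" where
  "smooth_wrt_frame \<A> U' n e s \<longleftrightarrow>
     (\<exists>c. (\<forall>i<n. smooth_fun_on \<A> U' (c i)) \<and> (\<forall>x\<in>U'. s x = (\<Sum>i<n. c i x *\<^sub>R e i x)))"

definition frame_atlas ::
    "('m::topological_space, 'e::euclidean_space) atlas \<Rightarrow> ('m \<Rightarrow> 'v::real_vector set)
      \<Rightarrow> ('m set \<times> nat \<times> (nat \<Rightarrow> 'm \<Rightarrow> 'v)) set \<Rightarrow> bool" where
  "frame_atlas \<A> F \<Phi> \<longleftrightarrow>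
     (\<Union>(U, n, e)\<in>\<Phi>. U) = UNIV \<and>
     (\<forall>(U, n, e)\<in>\<Phi>. open U \<and>
        (\<forall>x\<in>U. inj_on (\<lambda>i. e i x) {..<n} \<and> independent ((\<lambda>i. e i x) ` {..<n}) \<and>
                span ((\<lambda>i. e i x) ` {..<n}) = F x)) \<and>
     (\<forall>(U, n, e)\<in>\<Phi>. \<forall>(V, m, h)\<in>\<Phi>. \<forall>j<m. smooth_wrt_frame \<A> (U \<inter> V) n e (h j))"

definition vector_bundle ::
    "('m::topological_space, 'e::euclidean_space) atlas \<Rightarrow> ('m, 'v::real_vector) vbundle \<Rightarrow> bool" where
  "vector_bundle \<A> B \<longleftrightarrow>
     (\<exists>\<Phi>. frame_atlas \<A> (fibre B) \<Phi> \<and>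
        sections B = {s. (\<forall>x. s x \<in> fibre B x) \<and> (\<forall>(U, n, e)\<in>\<Phi>. smooth_wrt_frame \<A> U n e s)})"

text \<open>A bundle map over the identity is smooth iff it sends smooth sections to smooth sections.\<close>

definition bundle_map ::
    "('m, 'v::real_vector) vbundle \<Rightarrow> ('m, 'w::real_vector) vbundle \<Rightarrow> ('m \<Rightarrow> 'v \<Rightarrow> 'w) \<Rightarrow> bool" where
  "bundle_map B C L \<longleftrightarrow>
     (\<forall>x. (\<forall>v\<in>fibre B x. L x v \<in> fibre C x) \<and>
          (\<forall>u\<in>fibre B x. \<forall>v\<in>fibre B x. L x (u + v) = L x u + L x v) \<and>
          (\<forall>c. \<forall>v\<in>fibre B x. L x (c *\<^sub>R v) = c *\<^sub>R L x v)) \<and>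
     (\<forall>s\<in>sections B. (\<lambda>x. L x (s x)) \<in> sections C)"

text \<open>Functionals on a fibre, and below multilinear forms, are set to \<open>0\<close> outside the fibre, so that
  equality of functions is equality of functionals.\<close>

definition dual_space :: "'v::real_vector set \<Rightarrow> ('v \<Rightarrow> real) set" where
  "dual_space V = {l. (\<forall>v. v \<notin> V \<longrightarrow> l v = 0) \<and>
     (\<forall>u\<in>V. \<forall>v\<in>V. l (u + v) = l u + l v) \<and> (\<forall>c. \<forall>v\<in>V. l (c *\<^sub>R v) = c * l v)}"

definition dual ::
    "('m, 'e::euclidean_space) atlas \<Rightarrow> ('m, 'v::real_vector) vbundle \<Rightarrow> ('m, 'v \<Rightarrow> real) vbundle" where
  "dual \<A> B = \<lparr>fibre = (\<lambda>x. dual_space (fibre B x)),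
     sections = {\<alpha>. (\<forall>x. \<alpha> x \<in> dual_space (fibre B x)) \<and>
                    (\<forall>X\<in>sections B. (\<lambda>x. \<alpha> x (X x)) \<in> Cinf \<A>)}\<rparr>"


section \<open>Exterior powers\<close>

text \<open>An element of the \<^term>\<open>k\<close>-th exterior power of \<^term>\<open>V\<close>'s dual is an alternating
  \<^term>\<open>k\<close>-linear form on \<^term>\<open>V\<close>, its arguments being collected in a list.\<close>

definition alt_forms :: "'v::real_vector set \<Rightarrow> nat \<Rightarrow> ('v list \<Rightarrow> real) set" where
  "alt_forms V k = {w.
     (\<forall>vs. \<not> (length vs = k \<and> set vs \<subseteq> V) \<longrightarrow> w vs = 0) \<and>
     (\<forall>us vs. \<forall>u\<in>V. \<forall>v\<in>V. set us \<subseteq> V \<and> set vs \<subseteq> V \<longrightarrow>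
        w (us @ (u + v) # vs) = w (us @ u # vs) + w (us @ v # vs)) \<and>
     (\<forall>us vs c. \<forall>v\<in>V. set us \<subseteq> V \<and> set vs \<subseteq> V \<longrightarrow>
        w (us @ (c *\<^sub>R v) # vs) = c * w (us @ v # vs)) \<and>
     (\<forall>us vs ws v. w (us @ v # vs @ v # ws) = 0)}"

type_synonym ('m, 'v) form = "'m \<Rightarrow> 'v list \<Rightarrow> real"

definition eval_form :: "('m, 'v) form \<Rightarrow> ('m \<Rightarrow> 'v) list \<Rightarrow> 'm \<Rightarrow> real" where
  "eval_form w Xs = (\<lambda>x. w x (map (\<lambda>X. X x) Xs))"

text \<open>\<^term>\<open>forms \<A> B k\<close> are the smooth sections of the \<^term>\<open>k\<close>-th exterior power of the dual
  of \<^term>\<open>B\<close>.\<close>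

definition forms ::
    "('m, 'e::euclidean_space) atlas \<Rightarrow> ('m, 'v::real_vector) vbundle \<Rightarrow> nat \<Rightarrow> ('m, 'v) form set" where
  "forms \<A> B k = {w. (\<forall>x. w x \<in> alt_forms (fibre B x) k) \<and>
     (\<forall>Xs. length Xs = k \<and> set Xs \<subseteq> sections B \<longrightarrow> eval_form w Xs \<in> Cinf \<A>)}"

text \<open>Sections of the \<^term>\<open>k\<close>-th exterior power of \<^term>\<open>B\<close> itself, as forms on the dual bundle
  (the fibres are finite dimensional).\<close>

abbreviation multisections ::
    "('m, 'e::euclidean_space) atlas \<Rightarrow> ('m, 'v::real_vector) vbundle \<Rightarrow> nat
      \<Rightarrow> ('m, 'v \<Rightarrow> real) form set" where
  "multisections \<A> B k \<equiv> forms \<A> (dual \<A> B) k"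

definition form0 :: "('m \<Rightarrow> real) \<Rightarrow> ('m, 'v) form" where
  "form0 f = (\<lambda>x vs. case vs of [] \<Rightarrow> f x | _ \<Rightarrow> 0)"

text \<open>The degree one form given by a section of the dual bundle, and back.\<close>

definition form1 :: "('m \<Rightarrow> 'v \<Rightarrow> real) \<Rightarrow> ('m, 'v) form" where
  "form1 \<alpha> = (\<lambda>x vs. case vs of [v] \<Rightarrow> \<alpha> x v | _ \<Rightarrow> 0)"

definition covector :: "('m, 'v) form \<Rightarrow> 'm \<Rightarrow> 'v \<Rightarrow> real" where
  "covector w = (\<lambda>x v. w x [v])"

text \<open>The degree one multisection given by a section \<^term>\<open>X\<close> of \<^term>\<open>B\<close>.\<close>

definition vec1 :: "('m, 'v::real_vector) vbundle \<Rightarrow> ('m \<Rightarrow> 'v) \<Rightarrow> ('m, 'v \<Rightarrow> real) form" where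
  "vec1 B X = form1 (\<lambda>x \<alpha>. if \<alpha> \<in> dual_space (fibre B x) then \<alpha> (X x) else 0)"

text \<open>Normalised so that \<open>(\<alpha> \<and> \<beta>)(X, Y) = \<alpha>(X) \<beta>(Y) - \<alpha>(Y) \<beta>(X)\<close>, which is the
  normalisation for which the Cartan formula below is a derivation.\<close>

definition wedge :: "nat \<Rightarrow> nat \<Rightarrow> ('m, 'v) form \<Rightarrow> ('m, 'v) form \<Rightarrow> ('m, 'v) form" where
  "wedge p q P Q = (\<lambda>x vs.
     if length vs = p + q
     then (\<Sum>\<sigma> | \<sigma> permutes {..<p + q}. of_int (sign \<sigma>) *
             P x (map (\<lambda>i. vs ! \<sigma> i) [0..<p]) * Q x (map (\<lambda>i. vs ! \<sigma> i) [p..<p + q]))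
          / (fact p * fact q)
     else 0)"

text \<open>Interior product with a section.\<close>

definition contr :: "('m \<Rightarrow> 'v) \<Rightarrow> ('m, 'v) form \<Rightarrow> ('m, 'v) form" where
  "contr X w = (\<lambda>x vs. w x (X x # vs))"


section \<open>The tangent bundle\<close>

text \<open>Tangent vectors at \<^term>\<open>x\<close> are the directional derivatives at \<^term>\<open>x\<close> in charts, acting on
  smooth functions (and sending every other function to \<open>0\<close>).\<close>

definition tangent_space :: "('m, 'e::euclidean_space) atlas \<Rightarrow> 'm \<Rightarrow> (('m \<Rightarrow> real) \<Rightarrow> real) set" where
  "tangent_space \<A> x = {D. \<exists>(U, \<psi>)\<in>\<A>. x \<in> U \<and> (\<exists>v. D = (\<lambda>f.
     if f \<in> Cinf \<A> then frechet_derivative (f \<circ> inv_into U \<psi>) (at (\<psi> x)) v else 0))}"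

definition TM :: "('m, 'e::euclidean_space) atlas \<Rightarrow> ('m, ('m \<Rightarrow> real) \<Rightarrow> real) vbundle" where
  "TM \<A> = \<lparr>fibre = tangent_space \<A>,
     sections = {X. (\<forall>x. X x \<in> tangent_space \<A> x) \<and> (\<forall>f\<in>Cinf \<A>. (\<lambda>x. X x f) \<in> Cinf \<A>)}\<rparr>"

definition deRham :: "('m, 'e::euclidean_space) atlas \<Rightarrow> ('m \<Rightarrow> real) \<Rightarrow> 'm \<Rightarrow> (('m \<Rightarrow> real) \<Rightarrow> real) \<Rightarrow> real" where
  "deRham \<A> f = (\<lambda>x v. if v \<in> tangent_space \<A> x then v f else 0)"

definition lie_bracket ::
    "('m \<Rightarrow> ('m \<Rightarrow> real) \<Rightarrow> real) \<Rightarrow> ('m \<Rightarrow> ('m \<Rightarrow> real) \<Rightarrow> real) \<Rightarrow> 'm \<Rightarrow> ('m \<Rightarrow> real) \<Rightarrow> real" where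
  "lie_bracket X Y = (\<lambda>x f. X x (\<lambda>y. Y y f) - Y x (\<lambda>y. X y f))"


section \<open>Anchored brackets and their differential\<close>

type_synonym ('m, 'v) anchor = "'m \<Rightarrow> 'v \<Rightarrow> ('m \<Rightarrow> real) \<Rightarrow> real"
type_synonym ('m, 'v) bracket = "('m \<Rightarrow> 'v) \<Rightarrow> ('m \<Rightarrow> 'v) \<Rightarrow> 'm \<Rightarrow> 'v"

definition act :: "('m, 'v) anchor \<Rightarrow> ('m \<Rightarrow> 'v) \<Rightarrow> ('m \<Rightarrow> real) \<Rightarrow> 'm \<Rightarrow> real" where
  "act a X f = (\<lambda>x. a x (X x) f)"

text \<open>A bundle map to the tangent bundle and a skew-symmetric (bilinear) operation on sections with
  the Leibniz rule; homogeneity over the reals is the Leibniz rule for constant functions.\<close>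

definition anchored_bracket ::
    "('m, 'e::euclidean_space) atlas \<Rightarrow> ('m, 'v::real_vector) vbundle \<Rightarrow> ('m, 'v) anchor
      \<Rightarrow> ('m, 'v) bracket \<Rightarrow> bool" where
  "anchored_bracket \<A> B a br \<longleftrightarrow>
     bundle_map B (TM \<A>) a \<and>
     (\<forall>X\<in>sections B. \<forall>Y\<in>sections B. br X Y \<in> sections B \<and> br Y X = - br X Y) \<and>
     (\<forall>X\<in>sections B. \<forall>Y\<in>sections B. \<forall>Z\<in>sections B. br X (Y + Z) = br X Y + br X Z) \<and>
     (\<forall>X\<in>sections B. \<forall>Y\<in>sections B. \<forall>f\<in>Cinf \<A>.
        br X (\<lambda>x. f x *\<^sub>R Y x) = (\<lambda>x. f x *\<^sub>R br X Y x + act a X f x *\<^sub>R Y x))"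

definition lie_algebroid ::
    "('m, 'e::euclidean_space) atlas \<Rightarrow> ('m, 'v::real_vector) vbundle \<Rightarrow> ('m, 'v) anchor
      \<Rightarrow> ('m, 'v) bracket \<Rightarrow> bool" where
  "lie_algebroid \<A> B a br \<longleftrightarrow>
     anchored_bracket \<A> B a br \<and>
     (\<forall>X\<in>sections B. \<forall>Y\<in>sections B. \<forall>Z\<in>sections B.
        br (br X Y) Z + br (br Y Z) X + br (br Z X) Y = 0) \<and>
     (\<forall>X\<in>sections B. \<forall>Y\<in>sections B.
        (\<lambda>x. a x (br X Y x)) = lie_bracket (\<lambda>x. a x (X x)) (\<lambda>x. a x (Y x)))"

definition del :: "nat \<Rightarrow> 'a list \<Rightarrow> 'a list" where
  "del i xs = take i xs @ drop (Suc i) xs"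

definition cartan ::
    "('m, 'v) anchor \<Rightarrow> ('m, 'v) bracket \<Rightarrow> nat \<Rightarrow> ('m, 'v) form \<Rightarrow> ('m \<Rightarrow> 'v) list \<Rightarrow> 'm \<Rightarrow> real" where
  "cartan a br k w Xs = (\<lambda>x.
     (\<Sum>i\<le>k. (-1) ^ i * act a (Xs ! i) (eval_form w (del i Xs)) x) +
     (\<Sum>j\<le>k. \<Sum>i<j. (-1) ^ (i + j) * eval_form w (br (Xs ! i) (Xs ! j) # del i (del j Xs)) x))"

text \<open>The (quasi-)differential of a \<^term>\<open>k\<close>-form.\<close>

definition differential ::
    "('m, 'e::euclidean_space) atlas \<Rightarrow> ('m, 'v::real_vector) vbundle \<Rightarrow> ('m, 'v) anchor
      \<Rightarrow> ('m, 'v) bracket \<Rightarrow> nat \<Rightarrow> ('m, 'v) form \<Rightarrow> ('m, 'v) form" where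
  "differential \<A> B a br k w = (THE w'. w' \<in> forms \<A> B (k + 1) \<and>
     (\<forall>Xs. length Xs = k + 1 \<and> set Xs \<subseteq> sections B \<longrightarrow> eval_form w' Xs = cartan a br k w Xs))"

text \<open>The differential twisted by a one-form \<^term>\<open>\<theta>\<close>, \<open>w \<mapsto> d w + \<theta> \<and> w\<close>.\<close>

definition twisted_differential ::
    "('m, 'e::euclidean_space) atlas \<Rightarrow> ('m, 'v::real_vector) vbundle \<Rightarrow> ('m, 'v) anchor
      \<Rightarrow> ('m, 'v) bracket \<Rightarrow> ('m, 'v) form \<Rightarrow> nat \<Rightarrow> ('m, 'v) form \<Rightarrow> ('m, 'v) form" where
  "twisted_differential \<A> B a br \<theta> k w = differential \<A> B a br k w + wedge 1 k \<theta> w"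


section \<open>Schouten brackets\<close>

text \<open>\<^term>\<open>S p P q Q\<close> is the bracket of \<^term>\<open>P\<close> of degree \<^term>\<open>p\<close> and \<^term>\<open>Q\<close> of degree
  \<^term>\<open>q\<close>, of degree \<open>p + q - 1\<close>.  The bracket of two functions has degree \<open>-1\<close> and hence vanishes.
  In the signs \<open>p + 1\<close> replaces \<open>p - 1\<close>, which is truncated for \<open>p = 0\<close>.  For an anchored bracket
  these rules determine \<^term>\<open>S\<close> on multisections, and there is such an \<^term>\<open>S\<close>.\<close>

definition schouten_bracket ::
    "('m, 'e::euclidean_space) atlas \<Rightarrow> ('m, 'v::real_vector) vbundle \<Rightarrow> ('m, 'v) anchor
      \<Rightarrow> ('m, 'v) bracket
      \<Rightarrow> (nat \<Rightarrow> ('m, 'v \<Rightarrow> real) form \<Rightarrow> nat \<Rightarrow> ('m, 'v \<Rightarrow> real) form \<Rightarrow> ('m, 'v \<Rightarrow> real) form)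
      \<Rightarrow> bool" where
  "schouten_bracket \<A> B a br S \<longleftrightarrow>
     (\<forall>p q. \<forall>P\<in>multisections \<A> B p. \<forall>Q\<in>multisections \<A> B q.
        S p P q Q \<in> multisections \<A> B (p + q - 1) \<and>
        S p P q Q = - ((-1) ^ ((p + 1) * (q + 1)) *\<^sub>R S q Q p P) \<and>
        (\<forall>Q'\<in>multisections \<A> B q. S p P q (Q + Q') = S p P q Q + S p P q Q') \<and>
        (\<forall>c. S p P q (c *\<^sub>R Q) = c *\<^sub>R S p P q Q) \<and>
        (\<forall>r. \<forall>R\<in>multisections \<A> B r.
           S p P (q + r) (wedge q r Q R) =
             wedge (p + q - 1) r (S p P q Q) R +
             (-1) ^ ((p + 1) * q) *\<^sub>R wedge q (p + r - 1) Q (S p P r R))) \<and>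
     (\<forall>f\<in>Cinf \<A>. \<forall>g\<in>Cinf \<A>. S 0 (form0 f) 0 (form0 g) = 0) \<and>
     (\<forall>X\<in>sections B. \<forall>f\<in>Cinf \<A>. S 1 (vec1 B X) 0 (form0 f) = form0 (act a X f)) \<and>
     (\<forall>X\<in>sections B. \<forall>Y\<in>sections B. S 1 (vec1 B X) 1 (vec1 B Y) = vec1 B (br X Y))"

text \<open>The bracket modified by a section \<^term>\<open>\<phi>\<close> of the dual bundle.  For \<^term>\<open>p = 0\<close> or
  \<^term>\<open>q = 0\<close> the corresponding contraction is \<open>0\<close>.\<close>

definition modified_bracket ::
    "(nat \<Rightarrow> ('m, 'w) form \<Rightarrow> nat \<Rightarrow> ('m, 'w) form \<Rightarrow> ('m, 'w) form) \<Rightarrow> ('m \<Rightarrow> 'w)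
      \<Rightarrow> nat \<Rightarrow> ('m, 'w) form \<Rightarrow> nat \<Rightarrow> ('m, 'w) form \<Rightarrow> ('m, 'w) form" where
  "modified_bracket S \<phi> p P q Q =
     S p P q Q + (real p - 1) *\<^sub>R wedge p (q - 1) P (contr \<phi> Q)
       - ((-1) ^ (p + 1) * (real q - 1)) *\<^sub>R wedge (p - 1) q (contr \<phi> P) Q"


section \<open>Quasi-Jacobi bialgebroids\<close>

text \<open>\<^term>\<open>a\<close> and \<^term>\<open>br\<close> belong to \<^term>\<open>A\<close>, \<^term>\<open>as\<close> and \<^term>\<open>brs\<close> to the dual bundle, and
  \<^term>\<open>S\<close> is the Schouten bracket extending \<^term>\<open>br\<close>.\<close>

definition quasi_Jacobi_bialgebroid ::
    "('m::{t2_space, second_countable_topology}, 'e::euclidean_space) atlas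
      \<Rightarrow> ('m, 'v::real_vector) vbundle
      \<Rightarrow> ('m, 'v) anchor \<Rightarrow> ('m, 'v) bracket
      \<Rightarrow> (nat \<Rightarrow> ('m, 'v \<Rightarrow> real) form \<Rightarrow> nat \<Rightarrow> ('m, 'v \<Rightarrow> real) form \<Rightarrow> ('m, 'v \<Rightarrow> real) form)
      \<Rightarrow> ('m, 'v \<Rightarrow> real) anchor \<Rightarrow> ('m, 'v \<Rightarrow> real) bracket
      \<Rightarrow> ('m \<Rightarrow> 'v \<Rightarrow> real) \<Rightarrow> ('m \<Rightarrow> 'v) \<Rightarrow> ('m, 'v) form \<Rightarrow> bool" where
  "quasi_Jacobi_bialgebroid \<A> A a br S as brs \<phi> W \<Psi> \<longleftrightarrow>
     (let As = dual \<A> A;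
          d = differential \<A> A a br;
          dphi = twisted_differential \<A> A a br (form1 \<phi>);
          dW = twisted_differential \<A> As as brs (vec1 A W);
          Sphi = modified_bracket S \<phi>;
          \<Psi>2 = (\<lambda>X Y x v. \<Psi> x [X x, Y x, v])
      in
        vector_bundle \<A> A \<and>
        \<phi> \<in> sections As \<and> W \<in> sections A \<and> \<Psi> \<in> forms \<A> A 3 \<and>
        lie_algebroid \<A> As as brs \<and>
        differential \<A> As as brs 1 (vec1 A W) = 0 \<and>
        anchored_bracket \<A> A a br \<and>
        schouten_bracket \<A> A a br S \<and>
        (\<forall>X\<in>sections A. \<forall>Y\<in>sections A.
           (\<lambda>x. a x (br X Y x)) =
             lie_bracket (\<lambda>x. a x (X x)) (\<lambda>x. a x (Y x)) - (\<lambda>x. as x (\<Psi>2 X Y x))) \<and>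
        (\<forall>X\<in>sections A. \<forall>Y\<in>sections A. \<forall>Z\<in>sections A.
           vec1 A (br (br X Y) Z + br (br Y Z) X + br (br Z X) Y) =
             - dW 0 (form0 (eval_form \<Psi> [X, Y, Z]))
             - (contr (\<Psi>2 X Y) (dW 1 (vec1 A Z)) + contr (\<Psi>2 Y Z) (dW 1 (vec1 A X))
                + contr (\<Psi>2 Z X) (dW 1 (vec1 A Y)))) \<and>
        d 1 (form1 \<phi>) - contr W \<Psi> = 0 \<and>
        dphi 3 \<Psi> = 0 \<and>
        (\<forall>p q. \<forall>P\<in>multisections \<A> A p. \<forall>Q\<in>multisections \<A> A q.
           dW (p + q - 1) (Sphi p P q Q) =
             Sphi (p + 1) (dW p P) q Q + (-1) ^ (p + 1) *\<^sub>R Sphi p P (q + 1) (dW q Q)))"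


section \<open>The Lie algebroid $TM \times \mathbb{R}$\<close>

definition TMR :: "('m, 'e::euclidean_space) atlas \<Rightarrow> ('m, (('m \<Rightarrow> real) \<Rightarrow> real) \<times> real) vbundle" where
  "TMR \<A> = \<lparr>fibre = (\<lambda>x. tangent_space \<A> x \<times> UNIV),
     sections = {s. (\<lambda>x. fst (s x)) \<in> sections (TM \<A>) \<and> (\<lambda>x. snd (s x)) \<in> Cinf \<A>}\<rparr>"

definition TMR_anchor :: "('m, (('m \<Rightarrow> real) \<Rightarrow> real) \<times> real) anchor" where
  "TMR_anchor = (\<lambda>x. fst)"

definition TMR_bracket :: "('m, (('m \<Rightarrow> real) \<Rightarrow> real) \<times> real) bracket" where
  "TMR_bracket s t = (\<lambda>x.
     (lie_bracket (\<lambda>y. fst (s y)) (\<lambda>y. fst (t y)) x,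
      fst (s x) (\<lambda>y. snd (t y)) - fst (t x) (\<lambda>y. snd (s y))))"

text \<open>The \<open>1\<close>-cocycle \<open>(0, 1)\<close>, and the section \<open>e = (0, 1)\<close>.\<close>

definition TMR_cocycle ::
    "('m, 'e::euclidean_space) atlas \<Rightarrow> 'm \<Rightarrow> (('m \<Rightarrow> real) \<Rightarrow> real) \<times> real \<Rightarrow> real" where
  "TMR_cocycle \<A> = (\<lambda>x v. if v \<in> fibre (TMR \<A>) x then snd v else 0)"

definition TMR_unit :: "'m \<Rightarrow> (('m \<Rightarrow> real) \<Rightarrow> real) \<times> real" where
  "TMR_unit = (\<lambda>x. (0, 1))"

text \<open>A multivector field regarded as a multisection of $TM \times \mathbb{R}$ via the inclusion
  \<open>v \<mapsto> (v, 0)\<close>.\<close>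

definition TMR_incl ::
    "('m, 'e::euclidean_space) atlas \<Rightarrow> ('m, (('m \<Rightarrow> real) \<Rightarrow> real) \<Rightarrow> real) form
      \<Rightarrow> ('m, (('m \<Rightarrow> real) \<Rightarrow> real) \<times> real \<Rightarrow> real) form" where
  "TMR_incl \<A> P = (\<lambda>x \<gamma>s. if set \<gamma>s \<subseteq> dual_space (fibre (TMR \<A>) x)
     then P x (map (\<lambda>\<gamma> v. \<gamma> (v, 0)) \<gamma>s) else 0)"

text \<open>The identification of a pair \<open>(P, Q)\<close> of degrees \<open>k\<close> and \<open>k - 1\<close> with \<open>P + e \<and> Q\<close>.\<close>

definition TMR_pair ::
    "('m, 'e::euclidean_space) atlas \<Rightarrow> nat \<Rightarrow> ('m, (('m \<Rightarrow> real) \<Rightarrow> real) \<Rightarrow> real) form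
      \<Rightarrow> ('m, (('m \<Rightarrow> real) \<Rightarrow> real) \<Rightarrow> real) form
      \<Rightarrow> ('m, (('m \<Rightarrow> real) \<Rightarrow> real) \<times> real \<Rightarrow> real) form" where
  "TMR_pair \<A> k P Q =
     TMR_incl \<A> P + wedge 1 (k - 1) (vec1 (TMR \<A>) TMR_unit) (TMR_incl \<A> Q)"


section \<open>Quasi-Jacobi structures\<close>

text \<open>The transpose at \<^term>\<open>x\<close> of a bundle map \<^term>\<open>L\<close> from the dual of \<^term>\<open>A\<close> to another bundle,
  under the identification of \<^term>\<open>A\<close> with its bidual.\<close>

definition transpose_map ::
    "('m, 'v::real_vector) vbundle \<Rightarrow> ('m \<Rightarrow> ('v \<Rightarrow> real) \<Rightarrow> 'w) \<Rightarrow> 'm \<Rightarrow> ('w \<Rightarrow> real) \<Rightarrow> 'v" where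
  "transpose_map A L x \<gamma> =
     (THE v. v \<in> fibre A x \<and> (\<forall>\<alpha>\<in>dual_space (fibre A x). \<alpha> v = \<gamma> (L x \<alpha>)))"

text \<open>The multiplicative extension of \<^term>\<open>L\<close> to exterior powers,
  \<open>\<alpha>\<^sub>1 \<and> \<dots> \<and> \<alpha>\<^sub>k \<mapsto> L \<alpha>\<^sub>1 \<and> \<dots> \<and> L \<alpha>\<^sub>k\<close>: evaluated on covectors of the target it
  transposes \<^term>\<open>L\<close>.\<close>

definition exterior_map ::
    "('m, 'v::real_vector) vbundle \<Rightarrow> ('m, 'w::real_vector) vbundle \<Rightarrow> ('m \<Rightarrow> ('v \<Rightarrow> real) \<Rightarrow> 'w)
      \<Rightarrow> ('m, 'v) form \<Rightarrow> ('m, 'w \<Rightarrow> real) form" where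
  "exterior_map A C L w = (\<lambda>x \<gamma>s. if set \<gamma>s \<subseteq> dual_space (fibre C x)
     then w x (map (transpose_map A L x) \<gamma>s) else 0)"

definition anchor_W ::
    "('m, 'v \<Rightarrow> real) anchor \<Rightarrow> ('m \<Rightarrow> 'v) \<Rightarrow> 'm \<Rightarrow> ('v \<Rightarrow> real) \<Rightarrow> (('m \<Rightarrow> real) \<Rightarrow> real) \<times> real" where
  "anchor_W as W = (\<lambda>x \<alpha>. (as x \<alpha>, \<alpha> (W x)))"

text \<open>\<^term>\<open>T\<close> is the Schouten bracket of $TM \times \mathbb{R}$.\<close>

definition quasi_Jacobi_structure ::
    "('m::{t2_space, second_countable_topology}, 'e::euclidean_space) atlas
      \<Rightarrow> (nat \<Rightarrow> ('m, (('m \<Rightarrow> real) \<Rightarrow> real) \<times> real \<Rightarrow> real) form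
          \<Rightarrow> nat \<Rightarrow> ('m, (('m \<Rightarrow> real) \<Rightarrow> real) \<times> real \<Rightarrow> real) form
          \<Rightarrow> ('m, (('m \<Rightarrow> real) \<Rightarrow> real) \<times> real \<Rightarrow> real) form)
      \<Rightarrow> ('m, 'v::real_vector) vbundle \<Rightarrow> ('m, 'v \<Rightarrow> real) anchor \<Rightarrow> ('m \<Rightarrow> 'v) \<Rightarrow> ('m, 'v) form
      \<Rightarrow> (('m \<Rightarrow> real) \<Rightarrow> ('m \<Rightarrow> real) \<Rightarrow> 'm \<Rightarrow> real) \<Rightarrow> bool" where
  "quasi_Jacobi_structure \<A> T A as W \<Psi> brk \<longleftrightarrow>
     (\<exists>\<Lambda>\<in>multisections \<A> (TM \<A>) 2. \<exists>E\<in>sections (TM \<A>).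
        (\<forall>f\<in>Cinf \<A>. \<forall>g\<in>Cinf \<A>.
           brk f g = (\<lambda>x. \<Lambda> x [deRham \<A> f x, deRham \<A> g x] + f x * E x g - g x * E x f)) \<and>
        (let J = TMR_pair \<A> 2 \<Lambda> (vec1 (TM \<A>) E) in
           (1 / 2) *\<^sub>R modified_bracket T (TMR_cocycle \<A>) 2 J 2 J =
             exterior_map A (TMR \<A>) (anchor_W as W) \<Psi>))"

text \<open>The pairing of a section of the dual bundle with a section of the bundle, both regarded as
  forms of degree one.\<close>

definition pairing :: "('m, 'v) form \<Rightarrow> ('m, 'v \<Rightarrow> real) form \<Rightarrow> 'm \<Rightarrow> real" where
  "pairing \<alpha> P = (\<lambda>x. P x [covector \<alpha> x])"

end

theory Submission
  imports Defs
begin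

text \<open>Write \<open>X\<^sub>f\<close> for the section of \<open>A\<close> given by \<open>d\<^sub>*\<^sup>W f\<close> (\<open>ham f\<close> below) and \<open>D\<^sub>X f = a(X) f + \<phi>(X) f\<close>,
  so that \<open>{f, g} = D\<^bsub>X\<^sub>g\<^esub> f\<close>.  Axiom 6 on a pair of functions is the skew symmetry of the bracket;
  on \<open>(X\<^sub>f, g)\<close>, together with \<open>d\<^sub>*\<^sup>W d\<^sub>*\<^sup>W f = 0\<close>, it gives \<open>[X\<^sub>f, X\<^sub>g] = X\<^bsub>{g, f}\<^esub>\<close>.
  Axioms 2 and 4 say that \<open>D\<^bsub>[X, Y]\<^esub> = [D\<^sub>X, D\<^sub>Y] - \<Psi>(X, Y, d\<^sub>*\<^sup>W \<cdot>)\<close>, hence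
  \<open>{{f, g}, h} + c.p. = - \<Psi>(X\<^sub>f, X\<^sub>g, X\<^sub>h)\<close>.

  On the other side, every covector of \<open>TM \<times> \<real>\<close> at a point is the one-jet of a function, the
  element \<open>J = (\<Lambda>, E)\<close> sends the jets of \<open>f\<close> and \<open>g\<close> to \<open>{f, g}\<close>, and half of
  \<open>[J, J]\<close> modified by \<open>(0, 1)\<close> sends three jets to \<open>- ({{f, g}, h} + c.p.)\<close>.  The last identity is
  checked on decomposable bivectors: a pair of dual local frames of \<open>A\<close> and its dual exhibits \<open>J\<close>
  near a point as half the sum of the \<open>x\<^sub>i \<and> y\<^sub>i\<close> with \<open>x\<^sub>i = (a(e\<^sub>i), \<phi>(e\<^sub>i))\<close> and
  \<open>y\<^sub>i = (a\<^sub>*(\<epsilon>\<^sub>i), \<epsilon>\<^sub>i(W))\<close>.\<close>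

section \<open>Smooth functions on Euclidean space\<close>

text \<open>The link between the two sides is that the transpose of \<open>anchor_W as W\<close>
  takes the one-jet of \<open>f\<close> to \<open>ham f\<close>, so that the right-hand side on
  three jets is \<Psi> on three sections \<open>ham\<close>.

  The first order operator given by a section of TM x R is not a derivation; its defect is governed
  by its value on 1. Hence the unmodified bracket of \<open>J\<close> with itself contains, besides
  the Jacobiator, products of the form {f, g} {1, h}. Since (0, 1) is the jet of 1, the modification
  cancels exactly these.

  The obstacle is that \<open>T\<close> is given only by algebraic rules on global multisections:
  nothing says outright that its value at \<open>x\<close> depends on germs at \<open>x\<close>,
  while \<open>J\<close> decomposes only near \<open>x\<close>. Therefore the frames are cut off,
  and half the sum of bivectors equals (1 - \<rho>^2) J on all of the manifold. As \<rho> vanishes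
  at \<open>x\<close>, the Leibniz rule applied to \<rho>^2 shows that this factor does not change
  the bracket at \<open>x\<close>. The half is due to skew symmetry: the sum of the products x_i(f)
  y_i(g) is already {f, g}, and the bivectors antisymmetrise it.\<close>

lemma differentiable_cong_open:
  assumes "open S" "y \<in> S" "\<And>z. z \<in> S \<Longrightarrow> f z = g z" "f differentiable (at y)"
  shows "g differentiable (at y)" "frechet_derivative g (at y) = frechet_derivative f (at y)"
proof -
  have "(f has_derivative frechet_derivative f (at y)) (at y)"
    using assms(4) by (simp add: frechet_derivative_works)
  then have *: "(g has_derivative frechet_derivative f (at y)) (at y)"
    using has_derivative_transform_within_open assms(1-3) by blast
  then show "g differentiable (at y)" by (auto simp: differentiable_def)
  show "frechet_derivative g (at y) = frechet_derivative f (at y)"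
    using frechet_derivative_at[OF *] by simp
qed

lemma Ck_on_cong:
  assumes "open S" "\<And>y. y \<in> S \<Longrightarrow> f y = g y" "Ck_on k S f"
  shows "Ck_on k S g"
  using assms(2,3)
proof (induction k arbitrary: f g)
  case 0
  then show ?case by (auto intro: continuous_on_eq)
next
  case (Suc k)
  have d: "f differentiable (at y)" if "y \<in> S" for y using Suc.prems that by simp
  note D = differentiable_cong_open[OF assms(1) _ Suc.prems(1) d]
  have "Ck_on k S (\<lambda>x. frechet_derivative g (at x) b)" if "b \<in> Basis" for b
    by (rule Suc.IH[of "\<lambda>x. frechet_derivative f (at x) b"]) (use D Suc.prems that in auto)
  then show ?case using D by auto
qed

lemma Ck_on_subset: "Ck_on k S f \<Longrightarrow> R \<subseteq> S \<Longrightarrow> Ck_on k R f"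
  by (induction k arbitrary: f) (auto intro: continuous_on_subset)

lemma Ck_on_local:
  assumes "\<And>y. y \<in> S \<Longrightarrow> \<exists>N. open N \<and> y \<in> N \<and> Ck_on k N f"
  shows "Ck_on k S f"
  using assms
proof (induction k arbitrary: f)
  case 0
  have "isCont f y" if "y \<in> S" for y
    using 0[OF that] by (auto simp: continuous_on_eq_continuous_at)
  then show ?case by (simp add: continuous_at_imp_continuous_on)
next
  case (Suc k)
  have "Ck_on k S (\<lambda>x. frechet_derivative f (at x) b)" if "b \<in> Basis" for b
  proof (rule Suc.IH)
    fix y assume "y \<in> S"
    from Suc.prems[OF this] obtain N where "open N" "y \<in> N" "Ck_on (Suc k) N f" by blast
    with that show "\<exists>N. open N \<and> y \<in> N \<and> Ck_on k N (\<lambda>x. frechet_derivative f (at x) b)"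
      by (intro exI[of _ N]) simp
  qed
  moreover have "f differentiable (at y)" if "y \<in> S" for y
    using Suc.prems[OF that] by auto
  ultimately show ?case by simp
qed

lemma Ck_on_SucD: "Ck_on (Suc k) S f \<Longrightarrow> Ck_on k S f"
proof (induction k arbitrary: f)
  case 0
  then show ?case
    by (auto intro!: continuous_at_imp_continuous_on differentiable_imp_continuous_within)
next
  case (Suc k)
  have "Ck_on k S (\<lambda>x. frechet_derivative f (at x) b)" if "b \<in> Basis" for b
    by (rule Suc.IH) (use Suc.prems that in \<open>subst (asm) Ck_on.simps(2), blast\<close>)
  with Suc.prems show ?case unfolding Ck_on.simps(2)[of k] by simp
qed

lemma Ck_on_const [simp]: "Ck_on k S (\<lambda>x. c)"
  by (induction k arbitrary: c) simp_all

lemma Ck_on_linear: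
  assumes "bounded_linear f"
  shows "Ck_on k S f"
proof -
  have "(f has_derivative f) (at x)" for x
    by (rule bounded_linear_imp_has_derivative[OF assms])
  then have D: "frechet_derivative f (at x) = f" "f differentiable (at x)" for x
    using frechet_derivative_at[of f f x] by (auto simp: differentiable_def)
  show ?thesis
    by (cases k) (simp_all add: D linear_continuous_on assms)
qed

lemma Ck_on_add:
  assumes "open S" "Ck_on k S f" "Ck_on k S g"
  shows "Ck_on k S (\<lambda>x. f x + g x)"
  using assms(2,3)
proof (induction k arbitrary: f g)
  case 0
  then show ?case by (auto intro: continuous_on_add)
next
  case (Suc k)
  have D: "((\<lambda>x. f x + g x) has_derivative
      (\<lambda>v. frechet_derivative f (at y) v + frechet_derivative g (at y) v)) (at y)" if "y \<in> S" for y
    by (rule has_derivative_add) (use Suc.prems that in \<open>auto simp: frechet_derivative_works\<close>)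
  have *: "Ck_on k S (\<lambda>x. frechet_derivative f (at x) b + frechet_derivative g (at x) b)"
    if "b \<in> Basis" for b
    using that Suc.prems by (intro Suc.IH) auto
  have "Ck_on k S (\<lambda>x. frechet_derivative (\<lambda>x. f x + g x) (at x) b)" if "b \<in> Basis" for b
    by (rule Ck_on_cong[OF assms(1) _ *[OF that]]) (simp add: frechet_derivative_at[OF D, symmetric])
  then show ?case using D by (auto simp: differentiable_def)
qed

lemma Ck_on_sum:
  assumes "open S" "\<And>i. i \<in> I \<Longrightarrow> Ck_on k S (f i)"
  shows "Ck_on k S (\<lambda>x. \<Sum>i\<in>I. f i x)"
  using assms(2) by (induction I rule: infinite_finite_induct) (auto intro: Ck_on_add[OF assms(1)])

lemma Ck_on_mult:
  assumes "open S" "Ck_on k S f" "Ck_on k S g"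
  shows "Ck_on k S (\<lambda>x. f x * g x)"
  using assms(2,3)
proof (induction k arbitrary: f g)
  case 0
  then show ?case by (auto intro: continuous_on_mult)
next
  case (Suc k)
  have D: "((\<lambda>x. f x * g x) has_derivative (\<lambda>v. f y * frechet_derivative g (at y) v
      + frechet_derivative f (at y) v * g y)) (at y)" if "y \<in> S" for y
    by (rule has_derivative_mult) (use Suc.prems that in \<open>auto simp: frechet_derivative_works\<close>)
  have lower: "Ck_on k S f" "Ck_on k S g" using Suc.prems Ck_on_SucD by blast+
  have *: "Ck_on k S (\<lambda>x. f x * frechet_derivative g (at x) b + frechet_derivative f (at x) b * g x)"
    if "b \<in> Basis" for b
    using that Suc.prems by (intro Ck_on_add Suc.IH lower assms(1)) auto
  have "Ck_on k S (\<lambda>x. frechet_derivative (\<lambda>x. f x * g x) (at x) b)" if "b \<in> Basis" for b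
    by (rule Ck_on_cong[OF assms(1) _ *[OF that]]) (simp add: frechet_derivative_at[OF D, symmetric])
  then show ?case using D by (auto simp: differentiable_def)
qed

text \<open>The derivative of 1/f is, up to sign, the product of 1/f, f' and 1/f, so the induction
  needs the claim only for the same \<open>f\<close>, one degree lower.\<close>

lemma Ck_on_inverse:
  assumes "open S" "\<And>y. y \<in> S \<Longrightarrow> f y \<noteq> 0" "Ck_on k S f"
  shows "Ck_on k S (\<lambda>x. inverse (f x))"
  using assms(3)
proof (induction k)
  case 0
  then show ?case using assms(2) by (auto intro: continuous_on_inverse)
next
  case (Suc k)
  have D: "((\<lambda>x. inverse (f x)) has_derivative
      (\<lambda>v. - (inverse (f y) * frechet_derivative f (at y) v * inverse (f y)))) (at y)"
    if "y \<in> S" for y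
    using assms(2)[OF that] Suc.prems that
    by (intro Deriv.has_derivative_inverse) (auto simp: frechet_derivative_works)
  have I: "Ck_on k S (\<lambda>x. inverse (f x))" using Suc Ck_on_SucD by blast
  have *: "Ck_on k S (\<lambda>x. (- 1) * (inverse (f x) * frechet_derivative f (at x) b * inverse (f x)))"
    if "b \<in> Basis" for b
    by (intro Ck_on_mult I Ck_on_const assms) (use Suc.prems that in auto)
  have "Ck_on k S (\<lambda>x. frechet_derivative (\<lambda>x. inverse (f x)) (at x) b)"
    if "b \<in> Basis" for b
    by (rule Ck_on_cong[OF assms(1) _ *[OF that]]) (simp add: frechet_derivative_at[OF D, symmetric])
  then show ?case using D by (auto simp: differentiable_def)
qed

text \<open>The chain rule writes a partial derivative of the composite as a sum of products of
  partial derivatives of \<open>f\<close>, composed with \<open>g\<close>, and of components of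
  \<open>g\<close>. Hence the induction keeps \<open>g\<close> and varies \<open>f\<close>.\<close>

lemma Ck_on_compose:
  fixes g :: "'a::euclidean_space \<Rightarrow> 'b::euclidean_space"
  assumes "open S" "g ` S \<subseteq> R" "Ck_on k R f" "\<And>c. c \<in> Basis \<Longrightarrow> Ck_on k S (\<lambda>x. g x \<bullet> c)"
  shows "Ck_on k S (\<lambda>x. f (g x))"
  using assms(3,4)
proof (induction k arbitrary: f)
  case 0
  then have "continuous_on S g" by (subst continuous_on_componentwise) auto
  then show ?case using 0 assms(2) by (auto intro: continuous_on_compose2)
next
  case (Suc k)
  have D: "((\<lambda>x. f (g x)) has_derivative (\<lambda>v. \<Sum>c\<in>Basis.
      frechet_derivative f (at (g y)) c * frechet_derivative (\<lambda>x. g x \<bullet> c) (at y) v)) (at y)"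
    if y: "y \<in> S" for y
  proof -
    let ?g' = "\<lambda>v. \<Sum>c\<in>Basis. frechet_derivative (\<lambda>x. g x \<bullet> c) (at y) v *\<^sub>R c"
    let ?f' = "frechet_derivative f (at (g y))"
    have "((\<lambda>x. g x \<bullet> c) has_derivative frechet_derivative (\<lambda>x. g x \<bullet> c) (at y)) (at y)"
      if "c \<in> Basis" for c
      using Suc.prems(2)[OF that] y by (auto simp: frechet_derivative_works)
    then have g: "(g has_derivative ?g') (at y)"
      by (subst has_derivative_componentwise_within)
         (simp add: inner_sum_left inner_Basis if_distrib cong: if_cong)
    have f: "(f has_derivative ?f') (at (g y))"
      using Suc.prems(1) y assms(2) by (auto simp: frechet_derivative_works)
    have "((\<lambda>x. f (g x)) has_derivative (\<lambda>v. ?f' (?g' v))) (at y)"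
      using has_derivative_compose[OF g f] .
    moreover have "?f' (?g' v) =
        (\<Sum>c\<in>Basis. ?f' c * frechet_derivative (\<lambda>x. g x \<bullet> c) (at y) v)" for v
      using has_derivative_linear[OF f] by (simp add: linear_sum linear_cmul mult.commute)
    ultimately show ?thesis by simp
  qed
  have lower: "Ck_on k S (\<lambda>x. g x \<bullet> c)" if "c \<in> Basis" for c
    using Suc.prems(2)[OF that] Ck_on_SucD by blast
  have deriv: "Ck_on k S (\<lambda>x. frechet_derivative (\<lambda>x. g x \<bullet> c) (at x) b)"
    if "c \<in> Basis" "b \<in> Basis" for b c
    using Suc.prems(2)[OF that(1)] that(2) by simp
  have outer: "Ck_on k S (\<lambda>x. frechet_derivative f (at (g x)) c)" if "c \<in> Basis" for c
    by (rule Suc.IH[of "\<lambda>y. frechet_derivative f (at y) c"]) (use Suc.prems(1) that lower in auto)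
  have *: "Ck_on k S (\<lambda>x. \<Sum>c\<in>Basis. frechet_derivative f (at (g x)) c *
      frechet_derivative (\<lambda>x. g x \<bullet> c) (at x) b)" if "b \<in> Basis" for b
    using that by (intro Ck_on_sum Ck_on_mult outer deriv assms(1))
  have "Ck_on k S (\<lambda>x. frechet_derivative (\<lambda>x. f (g x)) (at x) b)" if "b \<in> Basis" for b
    by (rule Ck_on_cong[OF assms(1) _ *[OF that]]) (simp add: frechet_derivative_at[OF D, symmetric])
  then show ?case using D by (auto simp: differentiable_def)
qed

section \<open>Bump functions on Euclidean space\<close>

definition flat_exp :: "nat \<Rightarrow> real \<Rightarrow> real" where
  "flat_exp n t = (if t > 0 then (1 / t) ^ n * exp (- (1 / t)) else 0)"

lemma flat_exp_tendsto_0: "(flat_exp n \<longlongrightarrow> 0) (at 0)"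
proof -
  have "((\<lambda>t. (1 / t) ^ n * exp (- (1 / t))) \<longlongrightarrow> (0::real)) (at_right 0)"
    using filterlim_compose[OF tendsto_power_div_exp_0 filterlim_inverse_at_top_right, of n]
    by (simp add: exp_minus field_simps)
  then have "(flat_exp n \<longlongrightarrow> 0) (at_right 0)"
    by (rule Lim_transform_eventually)
       (auto simp: eventually_at_filter flat_exp_def)
  moreover have "(flat_exp n \<longlongrightarrow> 0) (at_left 0)"
    by (rule Lim_transform_eventually[OF tendsto_const])
       (auto simp: eventually_at_filter flat_exp_def)
  ultimately show ?thesis by (simp add: filterlim_at_split)
qed

lemma flat_exp_has_derivative:
  "(flat_exp n has_field_derivative (flat_exp (n + 2) t - of_nat n * flat_exp (n + 1) t)) (at t)"
proof -
  consider "t > 0" | "t < 0" | "t = 0" by linarith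
  then show ?thesis
  proof cases
    case 1
    have "((\<lambda>t. (1 / t) ^ n * exp (- (1 / t))) has_field_derivative
        (flat_exp (n + 2) t - of_nat n * flat_exp (n + 1) t)) (at t)"
    proof -
      have "((\<lambda>t. (1 / t) ^ n) has_field_derivative
          of_nat n * (1 / t) ^ (n - 1) * (- (1 / t\<^sup>2))) (at t)"
        using 1 by (auto intro!: derivative_eq_intros simp: power2_eq_square)
      \<comment> \<open>For \<open>n = 0\<close> the truncated exponent is harmless because of the
        factor \<open>n\<close>.\<close>
      moreover have "of_nat n * (1 / t) ^ (n - 1) * (- (1 / t\<^sup>2)) = - (of_nat n * (1 / t) ^ (n + 1))"
        using 1 by (cases n) (auto simp: power2_eq_square)
      moreover have "((\<lambda>t. exp (- (1 / t))) has_field_derivative exp (- (1 / t)) * (1 / t)\<^sup>2) (at t)"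
        using 1 by (auto intro!: derivative_eq_intros simp: power2_eq_square)
      ultimately have "((\<lambda>t. (1 / t) ^ n * exp (- (1 / t))) has_field_derivative
          (- (of_nat n * (1 / t) ^ (n + 1))) * exp (- (1 / t)) +
          (exp (- (1 / t)) * (1 / t)\<^sup>2) * (1 / t) ^ n) (at t)"
        using DERIV_mult by fastforce
      then show ?thesis using 1 by (simp add: flat_exp_def power2_eq_square algebra_simps)
    qed
    then show ?thesis
      by (rule has_field_derivative_transform_within_open[of _ _ _ "{0<..}"])
         (use 1 in \<open>auto simp: flat_exp_def\<close>)
  next
    case 2
    have "((\<lambda>t. 0) has_field_derivative
        (flat_exp (n + 2) t - of_nat n * flat_exp (n + 1) t)) (at t)"
      using 2 by (simp add: flat_exp_def)
    then show ?thesis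
      by (rule has_field_derivative_transform_within_open[of _ _ _ "{..<0}"])
         (use 2 in \<open>auto simp: flat_exp_def\<close>)
  next
    case 3
    \<comment> \<open>The difference quotient at 0 is again a member of the family, so its limit is
      known.\<close>
    have "(flat_exp n (0 + h) - flat_exp n 0) / h = flat_exp (n + 1) h" for h
      by (auto simp: flat_exp_def)
    then show ?thesis
      using flat_exp_tendsto_0[of "n + 1"] 3 unfolding DERIV_def by (simp add: flat_exp_def[of _ 0])
  qed
qed

text \<open>The powers of 1/t are there for this induction: the derivative of a member of the family
  is a linear combination of two other members.\<close>

lemma Ck_on_flat_exp: "Ck_on k UNIV (flat_exp n)"
proof (induction k arbitrary: n)
  case 0
  show ?case
    using flat_exp_has_derivative by (auto intro!: continuous_at_imp_continuous_on DERIV_isCont)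
next
  case (Suc k)
  have D: "(flat_exp n has_derivative (*) (flat_exp (n + 2) t - of_nat n * flat_exp (n + 1) t)) (at t)" for t
    using flat_exp_has_derivative by (simp add: has_field_derivative_def)
  have "Ck_on k UNIV (\<lambda>t. flat_exp (n + 2) t + (- of_nat n) * flat_exp (n + 1) t)"
    by (intro Ck_on_add Ck_on_mult Suc.IH) auto
  then have "Ck_on k UNIV (\<lambda>t. frechet_derivative (flat_exp n) (at t) 1)"
    by (simp add: frechet_derivative_at[OF D, symmetric])
  moreover have "flat_exp n differentiable (at t)" for t
    using D by (auto simp: differentiable_def)
  ultimately show ?case by simp
qed

lemma Ck_on_bump:
  fixes p :: "'e::euclidean_space"
  assumes "r > 0"
  obtains \<beta> where "\<And>k. Ck_on k UNIV \<beta>" "\<beta> p = 1" "\<And>y. y \<notin> cball p r \<Longrightarrow> \<beta> y = 0"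
proof
  \<comment> \<open>\<open>?q y\<close> is r^2 - |y - p|^2, positive exactly inside the ball; it is
    written with sums and products, under which \<open>Ck_on\<close> is stable.\<close>
  let ?q = "\<lambda>y. r\<^sup>2 + (- 1) * (\<Sum>b\<in>Basis. ((y - p) \<bullet> b) * ((y - p) \<bullet> b))"
  let ?\<beta> = "\<lambda>y. inverse (flat_exp 0 (r\<^sup>2)) * flat_exp 0 (?q y)"
  have q: "?q y = r\<^sup>2 - (norm (y - p))\<^sup>2" for y
    unfolding power2_norm_eq_inner euclidean_inner[of "y - p" "y - p"] by simp
  have "Ck_on k UNIV (\<lambda>y. y \<bullet> b + (- p) \<bullet> b)" for k b
    by (intro Ck_on_add Ck_on_linear bounded_linear_inner_left Ck_on_const open_UNIV)
  then have "Ck_on k UNIV (\<lambda>y. (y - p) \<bullet> b)" for k b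
    by (simp add: inner_diff_left)
  then have Q: "Ck_on k UNIV ?q" for k
    by (intro Ck_on_add Ck_on_mult Ck_on_sum Ck_on_const open_UNIV)
  show "Ck_on k UNIV ?\<beta>" for k
  proof (rule Ck_on_mult[OF open_UNIV Ck_on_const], rule Ck_on_compose[where g = ?q and R = UNIV])
    fix c :: real assume "c \<in> Basis"
    then have "c = 1" by simp
    with Q[of k] show "Ck_on k UNIV (\<lambda>y. ?q y \<bullet> c)" by simp
  qed (simp_all add: Ck_on_flat_exp)
  show "?\<beta> p = 1" using assms by (simp add: flat_exp_def)
  fix y assume "y \<notin> cball p r"
  then have "r < norm (y - p)" by (simp add: dist_norm norm_minus_commute)
  then have "r\<^sup>2 \<le> (norm (y - p))\<^sup>2" using assms by (intro power_mono) auto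
  then have "\<not> ?q y > 0" unfolding q by linarith
  then show "?\<beta> y = 0" unfolding flat_exp_def by simp
qed

section \<open>Smooth functions and tangent vectors on a manifold\<close>

lemma smooth_on_const [simp]: "smooth_on S (\<lambda>x. c)"
  by (simp add: smooth_on_def)

lemma smooth_on_add: "open S \<Longrightarrow> smooth_on S f \<Longrightarrow> smooth_on S g \<Longrightarrow> smooth_on S (\<lambda>x. f x + g x)"
  by (simp add: smooth_on_def Ck_on_add)

lemma smooth_on_mult: "open S \<Longrightarrow> smooth_on S f \<Longrightarrow> smooth_on S g \<Longrightarrow> smooth_on S (\<lambda>x. f x * g x)"
  by (simp add: smooth_on_def Ck_on_mult)

lemma smooth_on_inverse:
  "open S \<Longrightarrow> smooth_on S f \<Longrightarrow> (\<And>y. y \<in> S \<Longrightarrow> f y \<noteq> 0) \<Longrightarrow> smooth_on S (\<lambda>x. inverse (f x))"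
  by (simp add: smooth_on_def Ck_on_inverse)

lemma smooth_on_cong: "open S \<Longrightarrow> smooth_on S f \<Longrightarrow> (\<And>y. y \<in> S \<Longrightarrow> f y = g y) \<Longrightarrow> smooth_on S g"
  unfolding smooth_on_def using Ck_on_cong[of S f g] by blast

lemma smooth_on_subset: "smooth_on S f \<Longrightarrow> R \<subseteq> S \<Longrightarrow> smooth_on R f"
  unfolding smooth_on_def using Ck_on_subset by blast

lemma smooth_on_local:
  assumes "\<And>y. y \<in> S \<Longrightarrow> \<exists>N. open N \<and> y \<in> N \<and> smooth_on N f"
  shows "smooth_on S f"
  unfolding smooth_on_def
proof
  fix k show "Ck_on k S f"
    by (rule Ck_on_local) (use assms in \<open>auto simp: smooth_on_def\<close>)
qed

lemma smooth_on_compose: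
  assumes "open S" "g ` S \<subseteq> R" "smooth_on R f" "\<And>c. c \<in> Basis \<Longrightarrow> smooth_on S (\<lambda>x. g x \<bullet> c)"
  shows "smooth_on S (\<lambda>x. f (g x))"
  unfolding smooth_on_def
proof
  fix k show "Ck_on k S (\<lambda>x. f (g x))"
    by (rule Ck_on_compose[OF assms(1,2)]) (use assms(3,4) in \<open>auto simp: smooth_on_def\<close>)
qed

lemma smooth_on_differentiable: "smooth_on S f \<Longrightarrow> x \<in> S \<Longrightarrow> f differentiable (at x)"
  unfolding smooth_on_def by (metis Ck_on.simps(2))

lemma smooth_on_frechet_derivative:
  assumes "smooth_on S f" "open S"
  shows "smooth_on S (\<lambda>x. frechet_derivative f (at x) v)"
proof -
  have "smooth_on S (\<lambda>x. frechet_derivative f (at x) b)" if "b \<in> Basis" for b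
    using assms that Ck_on.simps(2)[of _ S f] by (auto simp: smooth_on_def)
  then have "Ck_on k S (\<lambda>x. \<Sum>b\<in>Basis. (v \<bullet> b) * frechet_derivative f (at x) b)" for k
    by (intro Ck_on_sum Ck_on_mult Ck_on_const assms(2)) (auto simp: smooth_on_def)
  then have S: "smooth_on S (\<lambda>x. \<Sum>b\<in>Basis. (v \<bullet> b) * frechet_derivative f (at x) b)"
    by (simp add: smooth_on_def)
  have "(\<Sum>b\<in>Basis. (v \<bullet> b) * frechet_derivative f (at x) b) = frechet_derivative f (at x) v"
    if "x \<in> S" for x
  proof -
    have "linear (frechet_derivative f (at x))"
      by (rule linear_frechet_derivative[OF smooth_on_differentiable[OF assms(1) that]])
    then show ?thesis
      by (subst (2) euclidean_representation[of v, symmetric]) (simp add: linear_sum linear_cmul)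
  qed
  then show ?thesis by (rule smooth_on_cong[OF assms(2) S])
qed

lemma in_Cinf_iff: "f \<in> Cinf \<A> \<longleftrightarrow> smooth_fun_on \<A> UNIV f"
  by (simp add: Cinf_def)

locale manifold =
  fixes \<A> :: "('m::{t2_space, second_countable_topology}, 'e::euclidean_space) atlas"
  assumes manifold: "smooth_manifold \<A>"
begin

lemma chart_at:
  obtains V \<psi> where "(V, \<psi>) \<in> \<A>" "x \<in> V"
proof -
  have "x \<in> (\<Union>(U, \<psi>)\<in>\<A>. U)" using manifold by (simp add: smooth_manifold_def)
  then show ?thesis using that by blast
qed

lemma chart:
  assumes "(V, \<psi>) \<in> \<A>"
  shows "open V" "open (\<psi> ` V)" "homeomorphism V (\<psi> ` V) \<psi> (inv_into V \<psi>)"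
  using assms manifold unfolding smooth_manifold_def by blast+

lemma chart_inv:
  assumes "(V, \<psi>) \<in> \<A>"
  shows "y \<in> V \<Longrightarrow> inv_into V \<psi> (\<psi> y) = y" "inj_on \<psi> V"
proof -
  show *: "inv_into V \<psi> (\<psi> y) = y" if "y \<in> V" for y
    using homeomorphism_apply1[OF chart(3)[OF assms] that] .
  then show "inj_on \<psi> V" by (rule inj_on_inverseI)
qed

lemma chart_image_open:
  assumes "(V, \<psi>) \<in> \<A>" "open N"
  shows "open (\<psi> ` (N \<inter> V))"
proof -
  have "openin (top_of_set (\<psi> ` V)) (\<psi> ` (N \<inter> V))"
    by (rule homeomorphism_imp_open_map[OF chart(3)[OF assms(1)]])
       (metis Int_commute assms(2) openin_open_Int)
  then show ?thesis using chart(2)[OF assms(1)] openin_open_trans by blast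
qed

lemma transition_smooth:
  assumes "(U, \<psi>) \<in> \<A>" "(V, \<eta>) \<in> \<A>" "b \<in> Basis"
  shows "smooth_on (\<psi> ` (U \<inter> V)) (\<lambda>y. \<eta> (inv_into U \<psi> y) \<bullet> b)"
  using manifold assms unfolding smooth_manifold_def by blast

lemma smooth_fun_on_subset:
  "smooth_fun_on \<A> U f \<Longrightarrow> U' \<subseteq> U \<Longrightarrow> smooth_fun_on \<A> U' f"
  unfolding smooth_fun_on_def by (blast intro: smooth_on_subset)

lemma Cinf_smooth_fun_on: "f \<in> Cinf \<A> \<Longrightarrow> smooth_fun_on \<A> U f"
  unfolding in_Cinf_iff using smooth_fun_on_subset by blast

lemma smooth_fun_on_cong:
  assumes "smooth_fun_on \<A> U f" "open U" "\<And>y. y \<in> U \<Longrightarrow> f y = g y"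
  shows "smooth_fun_on \<A> U g"
  unfolding smooth_fun_on_def
proof clarify
  fix V \<psi> assume c: "(V, \<psi>) \<in> \<A>"
  show "smooth_on (\<psi> ` (U \<inter> V)) (g \<circ> inv_into V \<psi>)"
    by (rule smooth_on_cong[OF chart_image_open[OF c assms(2)], of "f \<circ> inv_into V \<psi>"])
       (use assms c chart_inv[OF c] in \<open>auto simp: smooth_fun_on_def\<close>)
qed

lemma smooth_fun_on_local:
  assumes "\<And>y. y \<in> U \<Longrightarrow> \<exists>N. open N \<and> y \<in> N \<and> smooth_fun_on \<A> N f"
  shows "smooth_fun_on \<A> U f"
  unfolding smooth_fun_on_def
proof clarify
  fix V \<psi> assume c: "(V, \<psi>) \<in> \<A>"
  show "smooth_on (\<psi> ` (U \<inter> V)) (f \<circ> inv_into V \<psi>)"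
  proof (rule smooth_on_local)
    fix z assume "z \<in> \<psi> ` (U \<inter> V)"
    then obtain y where y: "y \<in> U" "y \<in> V" "z = \<psi> y" by blast
    with assms obtain N where "open N" "y \<in> N" "smooth_fun_on \<A> N f" by blast
    with y c chart_image_open[OF c, of N]
    show "\<exists>N. open N \<and> z \<in> N \<and> smooth_on N (f \<circ> inv_into V \<psi>)"
      by (intro exI[of _ "\<psi> ` (N \<inter> V)"]) (auto simp: smooth_fun_on_def)
  qed
qed

text \<open>One chart suffices: in any other chart the function is its expression in this one
  composed with a transition map.\<close>

lemma smooth_fun_on_chartI:
  assumes c: "(V, \<psi>) \<in> \<A>" and "open N" "N \<subseteq> V" "smooth_on (\<psi> ` N) (f \<circ> inv_into V \<psi>)"
  shows "smooth_fun_on \<A> N f"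
  unfolding smooth_fun_on_def
proof clarify
  fix U \<eta> assume d: "(U, \<eta>) \<in> \<A>"
  let ?S = "\<eta> ` (N \<inter> U)"
  have o: "open ?S" by (rule chart_image_open[OF d \<open>open N\<close>])
  have "smooth_on ?S (\<lambda>z. (f \<circ> inv_into V \<psi>) ((\<psi> \<circ> inv_into U \<eta>) z))"
  proof (rule smooth_on_compose[OF o _ assms(4)])
    show "(\<psi> \<circ> inv_into U \<eta>) ` ?S \<subseteq> \<psi> ` N" using chart_inv[OF d] by auto
    show "smooth_on ?S (\<lambda>x. (\<psi> \<circ> inv_into U \<eta>) x \<bullet> b)" if "b \<in> Basis" for b
      using smooth_on_subset[OF transition_smooth[OF d c that], of ?S] \<open>N \<subseteq> V\<close> by fastforce
  qed
  then show "smooth_on ?S (f \<circ> inv_into U \<eta>)"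
    by (rule smooth_on_cong[OF o]) (use chart_inv[OF d] chart_inv[OF c] \<open>N \<subseteq> V\<close> in auto)
qed

lemma smooth_fun_on_const [simp]: "smooth_fun_on \<A> U (\<lambda>x. c)"
  by (auto simp: smooth_fun_on_def comp_def)

lemma smooth_fun_on_add:
  "open U \<Longrightarrow> smooth_fun_on \<A> U f \<Longrightarrow> smooth_fun_on \<A> U g \<Longrightarrow> smooth_fun_on \<A> U (\<lambda>x. f x + g x)"
  unfolding smooth_fun_on_def comp_def
  by (fast intro: smooth_on_add[OF chart_image_open])

lemma smooth_fun_on_mult:
  "open U \<Longrightarrow> smooth_fun_on \<A> U f \<Longrightarrow> smooth_fun_on \<A> U g \<Longrightarrow> smooth_fun_on \<A> U (\<lambda>x. f x * g x)"
  unfolding smooth_fun_on_def comp_def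
  by (fast intro: smooth_on_mult[OF chart_image_open])

lemma smooth_fun_on_inverse:
  assumes "open U" "smooth_fun_on \<A> U f" "\<And>y. y \<in> U \<Longrightarrow> f y \<noteq> 0"
  shows "smooth_fun_on \<A> U (\<lambda>x. inverse (f x))"
  unfolding smooth_fun_on_def comp_def
proof clarify
  fix V \<psi> assume c: "(V, \<psi>) \<in> \<A>"
  show "smooth_on (\<psi> ` (U \<inter> V)) (\<lambda>x. inverse (f (inv_into V \<psi> x)))"
    by (rule smooth_on_inverse[OF chart_image_open[OF c assms(1)]])
       (use assms c chart_inv[OF c] in \<open>auto simp: smooth_fun_on_def comp_def\<close>)
qed

lemma smooth_fun_on_sum:
  "open U \<Longrightarrow> (\<And>i. i \<in> I \<Longrightarrow> smooth_fun_on \<A> U (f i)) \<Longrightarrow> smooth_fun_on \<A> U (\<lambda>x. \<Sum>i\<in>I. f i x)"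
  by (induction I rule: infinite_finite_induct) (auto intro: smooth_fun_on_add)

lemma Cinf_const [simp]: "(\<lambda>x. c) \<in> Cinf \<A>"
  by (simp add: in_Cinf_iff)

lemma Cinf_add: "f \<in> Cinf \<A> \<Longrightarrow> g \<in> Cinf \<A> \<Longrightarrow> (\<lambda>x. f x + g x) \<in> Cinf \<A>"
  by (simp add: in_Cinf_iff smooth_fun_on_add)

lemma Cinf_mult: "f \<in> Cinf \<A> \<Longrightarrow> g \<in> Cinf \<A> \<Longrightarrow> (\<lambda>x. f x * g x) \<in> Cinf \<A>"
  by (simp add: in_Cinf_iff smooth_fun_on_mult)

lemma Cinf_sum: "(\<And>i. i \<in> I \<Longrightarrow> f i \<in> Cinf \<A>) \<Longrightarrow> (\<lambda>x. \<Sum>i\<in>I. f i x) \<in> Cinf \<A>"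
  by (simp add: in_Cinf_iff smooth_fun_on_sum)

lemma Cinf_minus: "f \<in> Cinf \<A> \<Longrightarrow> (\<lambda>x. - f x) \<in> Cinf \<A>"
  using Cinf_mult[of "\<lambda>x. - 1" f] by simp

lemma Cinf_diff: "f \<in> Cinf \<A> \<Longrightarrow> g \<in> Cinf \<A> \<Longrightarrow> (\<lambda>x. f x - g x) \<in> Cinf \<A>"
  using Cinf_add[OF _ Cinf_minus] by fastforce

lemmas Cinf_intros = Cinf_const Cinf_add Cinf_mult Cinf_sum Cinf_minus Cinf_diff

text \<open>\<open>U\<close> and the complement of \<open>C\<close> are open and cover everything;
  over the first the product has smooth factors, over the second it is 0. This is how a function
  known only over \<open>U\<close> becomes usable outside.\<close>

lemma smooth_fun_on_cutoff:
  assumes "\<beta> \<in> Cinf \<A>" "closed C" "C \<subseteq> U" "\<And>y. y \<notin> C \<Longrightarrow> \<beta> y = 0"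
    and "open U" "open U'" "smooth_fun_on \<A> (U \<inter> U') g"
  shows "smooth_fun_on \<A> U' (\<lambda>y. \<beta> y * g y)"
proof (rule smooth_fun_on_local)
  fix y assume y: "y \<in> U'"
  show "\<exists>N. open N \<and> y \<in> N \<and> smooth_fun_on \<A> N (\<lambda>y. \<beta> y * g y)"
  proof (cases "y \<in> U")
    case True
    with y assms show ?thesis
      by (intro exI[of _ "U \<inter> U'"]) (auto intro!: smooth_fun_on_mult Cinf_smooth_fun_on[OF assms(1)])
  next
    case False
    have "smooth_fun_on \<A> (- C) (\<lambda>y. \<beta> y * g y)"
      by (rule smooth_fun_on_cong[OF smooth_fun_on_const[of _ 0]]) (use assms in auto)
    with False assms show ?thesis by (intro exI[of _ "- C"]) auto
  qed
qed

text \<open>The support is recorded by a closed set \<open>C\<close> inside \<open>U\<close>, the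
  form in which \<open>smooth_fun_on_cutoff\<close> takes it.\<close>

lemma bump:
  assumes "open U" "x \<in> U"
  obtains \<beta> C where "\<beta> \<in> Cinf \<A>" "\<beta> x = 1" "closed C" "C \<subseteq> U" "\<And>y. y \<notin> C \<Longrightarrow> \<beta> y = 0"
proof -
  obtain V \<psi> where c: "(V, \<psi>) \<in> \<A>" and "x \<in> V" by (rule chart_at)
  have "open (\<psi> ` (U \<inter> V))" "\<psi> x \<in> \<psi> ` (U \<inter> V)"
    using chart_image_open[OF c] assms \<open>x \<in> V\<close> by auto
  then obtain r where r: "r > 0" "cball (\<psi> x) r \<subseteq> \<psi> ` (U \<inter> V)"
    by (meson open_contains_cball)
  obtain b where b: "\<And>k. Ck_on k UNIV b" "b (\<psi> x) = 1" "\<And>y. y \<notin> cball (\<psi> x) r \<Longrightarrow> b y = 0"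
    using Ck_on_bump[OF r(1)] by metis
  let ?g = "inv_into V \<psi>"
  let ?C = "?g ` cball (\<psi> x) r" and ?\<beta> = "\<lambda>y. if y \<in> V then b (\<psi> y) else 0"
  have "continuous_on (cball (\<psi> x) r) ?g"
    using continuous_on_subset[OF homeomorphism_cont2[OF chart(3)[OF c]]] r by blast
  \<comment> \<open>The Hausdorff axiom enters here: compact sets are closed, so
    \<open>?\<beta>\<close>, which vanishes off \<open>?C\<close>, is smooth also at the boundary of
    the chart domain.\<close>
  then have C: "closed ?C" by (intro compact_imp_closed compact_continuous_image) auto
  have CU: "?C \<subseteq> U \<inter> V" using r chart_inv[OF c] by auto
  have out: "?\<beta> y = 0" if "y \<notin> ?C" for y
    using that b(3)[of "\<psi> y"] chart_inv(1)[OF c, of y] by (metis imageI)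
  have "smooth_fun_on \<A> UNIV ?\<beta>"
  proof (rule smooth_fun_on_local)
    fix y
    show "\<exists>N. open N \<and> y \<in> N \<and> smooth_fun_on \<A> N ?\<beta>"
    proof (cases "y \<in> V")
      case True
      have "smooth_on (\<psi> ` V) b"
        using Ck_on_subset[OF b(1) subset_UNIV] by (simp add: smooth_on_def)
      then have "smooth_on (\<psi> ` V) (?\<beta> \<circ> ?g)"
        by (rule smooth_on_cong[OF chart(2)[OF c]]) (use chart_inv[OF c] in auto)
      then have "smooth_fun_on \<A> V ?\<beta>"
        by (rule smooth_fun_on_chartI[OF c chart(1)[OF c] order_refl])
      then show ?thesis using True chart(1)[OF c] by blast
    next
      case False
      have "smooth_fun_on \<A> (- ?C) ?\<beta>"
        by (rule smooth_fun_on_cong[OF smooth_fun_on_const[of _ 0]]) (use C out in auto)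
      then show ?thesis using False CU C by (intro exI[of _ "- ?C"]) auto
    qed
  qed
  then show ?thesis
    using that[of ?\<beta> ?C] C CU out b(2) \<open>x \<in> V\<close> by (auto simp: in_Cinf_iff)
qed

lemma Cinf_differentiable:
  assumes c: "(V, \<psi>) \<in> \<A>" and "x \<in> V" "f \<in> Cinf \<A>"
  shows "(f \<circ> inv_into V \<psi>) differentiable (at (\<psi> x))"
proof -
  have "smooth_on (\<psi> ` V) (f \<circ> inv_into V \<psi>)"
    using assms by (auto simp: in_Cinf_iff smooth_fun_on_def)
  then show ?thesis using smooth_on_differentiable \<open>x \<in> V\<close> by blast
qed

lemma Cinf_has_derivative:
  assumes "(V, \<psi>) \<in> \<A>" "x \<in> V" "f \<in> Cinf \<A>"
  shows "((f \<circ> inv_into V \<psi>) has_derivative frechet_derivative (f \<circ> inv_into V \<psi>) (at (\<psi> x)))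
    (at (\<psi> x))"
  using Cinf_differentiable[OF assms] by (simp add: frechet_derivative_works)

lemma Cinf_nonzero_open:
  assumes "f \<in> Cinf \<A>"
  shows "open {y. f y \<noteq> 0}"
proof (subst open_subopen, clarify)
  fix x assume x: "f x \<noteq> 0"
  obtain V \<psi> where c: "(V, \<psi>) \<in> \<A>" "x \<in> V" by (rule chart_at)
  have "continuous_on (\<psi> ` V) (f \<circ> inv_into V \<psi>)"
    using differentiable_imp_continuous_within[OF Cinf_differentiable[OF c(1) _ assms]]
    by (intro continuous_at_imp_continuous_on) blast
  then have "continuous_on V (\<lambda>y. (f \<circ> inv_into V \<psi>) (\<psi> y))"
    by (rule continuous_on_compose2[OF _ homeomorphism_cont1[OF chart(3)[OF c(1)]]]) simp
  then have "continuous_on V f"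
    by (rule continuous_on_eq) (use chart_inv[OF c(1)] in auto)
  then have "open (V \<inter> f -` (- {0}))"
    by (rule continuous_open_preimage) (auto simp: chart[OF c(1)])
  then show "\<exists>T. open T \<and> x \<in> T \<and> T \<subseteq> {y. f y \<noteq> 0}"
    using x c(2) by (intro exI[of _ "V \<inter> f -` (- {0})"]) auto
qed

section \<open>Tangent vectors as derivations at a point\<close>

lemma tangent_spaceE:
  assumes "v \<in> tangent_space \<A> x"
  obtains V \<psi> w where "(V, \<psi>) \<in> \<A>" "x \<in> V"
    "\<And>f. f \<in> Cinf \<A> \<Longrightarrow> v f = frechet_derivative (f \<circ> inv_into V \<psi>) (at (\<psi> x)) w"
proof -
  obtain V \<psi> w where "(V, \<psi>) \<in> \<A>" "x \<in> V" and "v = (\<lambda>f. if f \<in> Cinf \<A> then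
      frechet_derivative (f \<circ> inv_into V \<psi>) (at (\<psi> x)) w else 0)"
    using assms by (auto simp: tangent_space_def)
  then show ?thesis by (intro that[of V \<psi> w]) simp_all
qed

lemma tangent_add:
  assumes "v \<in> tangent_space \<A> x" "f \<in> Cinf \<A>" "g \<in> Cinf \<A>"
  shows "v (\<lambda>y. f y + g y) = v f + v g"
proof -
  obtain V \<psi> w where c: "(V, \<psi>) \<in> \<A>" "x \<in> V"
    and v: "\<And>f. f \<in> Cinf \<A> \<Longrightarrow> v f = frechet_derivative (f \<circ> inv_into V \<psi>) (at (\<psi> x)) w"
    using tangent_spaceE[OF assms(1)] by metis
  note d = Cinf_has_derivative[OF c assms(2)] Cinf_has_derivative[OF c assms(3)]
  have "(\<lambda>y. f y + g y) \<circ> inv_into V \<psi> =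
      (\<lambda>z. (f \<circ> inv_into V \<psi>) z + (g \<circ> inv_into V \<psi>) z)"
    by (simp add: fun_eq_iff)
  then show ?thesis
    using fun_cong[OF frechet_derivative_at[OF has_derivative_add[OF d]], of w]
    by (simp only: v assms(2,3) Cinf_add)
qed

lemma tangent_mult:
  assumes "v \<in> tangent_space \<A> x" "f \<in> Cinf \<A>" "g \<in> Cinf \<A>"
  shows "v (\<lambda>y. f y * g y) = f x * v g + v f * g x"
proof -
  obtain V \<psi> w where c: "(V, \<psi>) \<in> \<A>" "x \<in> V"
    and v: "\<And>f. f \<in> Cinf \<A> \<Longrightarrow> v f = frechet_derivative (f \<circ> inv_into V \<psi>) (at (\<psi> x)) w"
    using tangent_spaceE[OF assms(1)] by metis
  note d = Cinf_has_derivative[OF c assms(2)] Cinf_has_derivative[OF c assms(3)]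
  have "(\<lambda>y. f y * g y) \<circ> inv_into V \<psi> =
      (\<lambda>z. (f \<circ> inv_into V \<psi>) z * (g \<circ> inv_into V \<psi>) z)"
    by (simp add: fun_eq_iff)
  then show ?thesis
    using fun_cong[OF frechet_derivative_at[OF has_derivative_mult[OF d]], of w]
    by (simp only: v assms(2,3) Cinf_mult comp_apply chart_inv(1)[OF c])
qed

lemma tangent_const:
  assumes "v \<in> tangent_space \<A> x"
  shows "v (\<lambda>y. c) = 0"
proof -
  obtain V \<psi> w where "(V, \<psi>) \<in> \<A>" "x \<in> V" and v:
    "\<And>f. f \<in> Cinf \<A> \<Longrightarrow> v f = frechet_derivative (f \<circ> inv_into V \<psi>) (at (\<psi> x)) w"
    using tangent_spaceE[OF assms(1)] by metis
  from v[of "\<lambda>y. c"] show ?thesis by (simp add: comp_def)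
qed

lemma tangent_cmult:
  assumes "v \<in> tangent_space \<A> x" "f \<in> Cinf \<A>"
  shows "v (\<lambda>y. c * f y) = c * v f"
  using tangent_mult[OF assms(1) Cinf_const[of c] assms(2)] tangent_const[OF assms(1), of c] by simp

lemma tangent_minus:
  assumes "v \<in> tangent_space \<A> x" "f \<in> Cinf \<A>"
  shows "v (\<lambda>y. - f y) = - v f"
  using tangent_cmult[OF assms, of "- 1"] by simp

lemma tangent_diff:
  assumes "v \<in> tangent_space \<A> x" "f \<in> Cinf \<A>" "g \<in> Cinf \<A>"
  shows "v (\<lambda>y. f y - g y) = v f - v g"
  using tangent_add[OF assms(1,2) Cinf_minus[OF assms(3)]] tangent_minus[OF assms(1,3)] by simp

lemma tangent_sum:
  assumes "v \<in> tangent_space \<A> x" "\<And>i. i \<in> I \<Longrightarrow> f i \<in> Cinf \<A>"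
  shows "v (\<lambda>y. \<Sum>i\<in>I. f i y) = (\<Sum>i\<in>I. v (f i))"
  using assms(2)
proof (induction I rule: infinite_finite_induct)
  case (insert i I)
  then show ?case
    using tangent_add[OF assms(1), of "f i" "\<lambda>y. \<Sum>i\<in>I. f i y"] by (simp add: Cinf_sum)
qed (simp_all add: tangent_const[OF assms(1)])

end

section \<open>Forms and dual frames\<close>

lemma sum_fun_apply: "(\<Sum>i\<in>I. f i) x = (\<Sum>i\<in>I. f i x)"
  by (induction I rule: infinite_finite_induct) auto

lemma dual_spaceD:
  assumes "l \<in> dual_space V"
  shows "u \<in> V \<Longrightarrow> v \<in> V \<Longrightarrow> l (u + v) = l u + l v" "v \<in> V \<Longrightarrow> l (c *\<^sub>R v) = c * l v"
    "v \<notin> V \<Longrightarrow> l v = 0"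
  using assms by (auto simp: dual_space_def)

lemma dual_space_sum:
  assumes "l \<in> dual_space V" "subspace V" "\<And>i. i \<in> I \<Longrightarrow> e i \<in> V"
  shows "l (\<Sum>i\<in>I. c i *\<^sub>R e i) = (\<Sum>i\<in>I. c i * l (e i))"
proof -
  have "l 0 = 0"
    using dual_spaceD(2)[OF assms(1) subspace_0[OF assms(2)], of 0] by simp
  then show ?thesis
    using assms(3)
    by (induction I rule: infinite_finite_induct)
       (auto simp: dual_spaceD[OF assms(1)] assms(2) subspace_scale subspace_sum)
qed

lemma subspace_dual_space: "subspace (dual_space V)"
  by (auto simp: subspace_def dual_space_def algebra_simps)

lemma alt_formsD:
  assumes "w \<in> alt_forms V k"
  shows "\<not> (length vs = k \<and> set vs \<subseteq> V) \<Longrightarrow> w vs = 0"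
    "u \<in> V \<Longrightarrow> v \<in> V \<Longrightarrow> set us \<subseteq> V \<Longrightarrow> set vs \<subseteq> V \<Longrightarrow>
       w (us @ (u + v) # vs) = w (us @ u # vs) + w (us @ v # vs)"
    "v \<in> V \<Longrightarrow> set us \<subseteq> V \<Longrightarrow> set vs \<subseteq> V \<Longrightarrow> w (us @ (c *\<^sub>R v) # vs) = c * w (us @ v # vs)"
    "w (us @ v # vs @ v # ws) = 0"
  using assms unfolding alt_forms_def by blast+

lemma alt_forms_swap:
  assumes w: "w \<in> alt_forms V k" and "subspace V" "u \<in> V" "v \<in> V" "set us \<subseteq> V" "set vs \<subseteq> V"
  shows "w (us @ u # v # vs) = - w (us @ v # u # vs)"
proof -
  have uv: "u + v \<in> V" using assms by (simp add: subspace_add)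
  have "0 = w (us @ (u + v) # (u + v) # vs)"
    using alt_formsD(4)[OF w, of us "u + v" "[]" vs] by simp
  also have "\<dots> = w (us @ u # (u + v) # vs) + w (us @ v # (u + v) # vs)"
    using assms uv by (intro alt_formsD(2)[OF w]) auto
  also have "w (us @ u # (u + v) # vs) = w (us @ u # u # vs) + w (us @ u # v # vs)"
    using alt_formsD(2)[OF w, of u v "us @ [u]" vs] assms by simp
  also have "w (us @ v # (u + v) # vs) = w (us @ v # u # vs) + w (us @ v # v # vs)"
    using alt_formsD(2)[OF w, of u v "us @ [v]" vs] assms by simp
  finally show ?thesis
    using alt_formsD(4)[OF w, of us u "[]" vs] alt_formsD(4)[OF w, of us v "[]" vs] by simp
qed

lemma form1_alt_forms:
  assumes "l \<in> dual_space V"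
  shows "(\<lambda>vs. case vs of [v] \<Rightarrow> l v | _ \<Rightarrow> 0) \<in> alt_forms V 1"
proof -
  have "(\<lambda>vs. case vs of [v] \<Rightarrow> l v | _ \<Rightarrow> 0) = (\<lambda>vs. if length vs = 1 then l (hd vs) else 0)"
    by (auto simp: fun_eq_iff length_Suc_conv split: list.split)
  moreover have "(\<lambda>vs. if length vs = 1 then l (hd vs) else 0) \<in> alt_forms V 1"
    unfolding alt_forms_def
  proof (intro CollectI conjI allI impI ballI)
    fix vs assume "\<not> (length vs = 1 \<and> set vs \<subseteq> V)"
    then show "(if length vs = 1 then l (hd vs) else 0) = 0"
      by (cases vs) (auto intro: dual_spaceD(3)[OF assms])
  qed (use dual_spaceD[OF assms] in auto)
  ultimately show ?thesis by simp
qed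

lemma bilinear_alt_forms:
  assumes "\<And>u v z. u \<in> V \<Longrightarrow> v \<in> V \<Longrightarrow> z \<in> V \<Longrightarrow> b (u + v) z = b u z + b v z"
    and "\<And>u v z. u \<in> V \<Longrightarrow> v \<in> V \<Longrightarrow> z \<in> V \<Longrightarrow> b z (u + v) = b z u + b z v"
    and "\<And>c v z. v \<in> V \<Longrightarrow> z \<in> V \<Longrightarrow> b (c *\<^sub>R v) z = c * b v z"
    and "\<And>c v z. v \<in> V \<Longrightarrow> z \<in> V \<Longrightarrow> b z (c *\<^sub>R v) = c * b z v"
    and "\<And>v. v \<in> V \<Longrightarrow> b v v = 0" and "subspace V"
  shows "(\<lambda>vs. if length vs = 2 \<and> set vs \<subseteq> V then b (vs ! 0) (vs ! 1) else 0) \<in> alt_forms V 2"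
    (is "?w \<in> _")
proof -
  have add: "?w (us @ (u + v) # vs) = ?w (us @ u # vs) + ?w (us @ v # vs)"
    if "u \<in> V" "v \<in> V" "set us \<subseteq> V" "set vs \<subseteq> V" for u v us vs
  \<comment> \<open>Only lists of total length 2 count, so the distinguished argument sits in one of
    two slots.\<close>
  proof (cases "length us + length vs = 1")
    case True
    then consider z where "us = []" "vs = [z]" | z where "us = [z]" "vs = []"
      by (cases us) (auto simp: length_Suc_conv)
    then show ?thesis
      by cases (use that assms in \<open>simp_all add: subspace_add\<close>)
  qed simp
  have scale: "?w (us @ (c *\<^sub>R v) # vs) = c * ?w (us @ v # vs)"
    if "v \<in> V" "set us \<subseteq> V" "set vs \<subseteq> V" for c v us vs
  proof (cases "length us + length vs = 1")
    case True
    then consider z where "us = []" "vs = [z]" | z where "us = [z]" "vs = []"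
      by (cases us) (auto simp: length_Suc_conv)
    then show ?thesis
      by cases (use that assms in \<open>simp_all add: subspace_scale\<close>)
  qed simp
  have alt: "?w (us @ v # vs @ v # ws) = 0" for us v vs ws
    by (cases us; cases vs) (simp_all add: assms)
  have "?w vs = 0" if "\<not> (length vs = 2 \<and> set vs \<subseteq> V)" for vs
    using that by auto
  with add scale alt show ?thesis unfolding alt_forms_def by blast
qed

lemma form1_in_forms: "\<alpha> \<in> sections (dual \<A> B) \<Longrightarrow> form1 \<alpha> \<in> forms \<A> B 1"
  using form1_alt_forms[of "\<alpha> _"]
  by (auto simp: forms_def form1_def dual_def eval_form_def length_Suc_conv)

lemma form0_in_forms: "f \<in> Cinf \<A> \<Longrightarrow> form0 f \<in> forms \<A> B 0"
proof -
  have form0: "form0 f = (\<lambda>x vs. if vs = [] then f x else 0)"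
    by (auto simp: form0_def fun_eq_iff split: list.split)
  assume "f \<in> Cinf \<A>"
  then show "form0 f \<in> forms \<A> B 0"
    unfolding form0 by (auto simp: forms_def alt_forms_def eval_form_def)
qed

lemma vec1_apply: "\<alpha> \<in> dual_space (fibre B x) \<Longrightarrow> vec1 B X x [\<alpha>] = \<alpha> (X x)"
  by (simp add: vec1_def form1_def)

lemma form1_apply: "form1 \<alpha> x [v] = \<alpha> x v"
  by (simp add: form1_def)

lemma fibre_dual [simp]: "fibre (dual \<A> B) = (\<lambda>x. dual_space (fibre B x))"
  by (simp add: dual_def)

lemma sections_dualD:
  assumes "\<alpha> \<in> sections (dual \<A> B)"
  shows "\<alpha> x \<in> dual_space (fibre B x)" "X \<in> sections B \<Longrightarrow> (\<lambda>x. \<alpha> x (X x)) \<in> Cinf \<A>"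
  using assms by (auto simp: dual_def)

lemma sections_dualI:
  assumes "\<And>x. \<alpha> x \<in> dual_space (fibre B x)"
    "\<And>X. X \<in> sections B \<Longrightarrow> (\<lambda>x. \<alpha> x (X x)) \<in> Cinf \<A>"
  shows "\<alpha> \<in> sections (dual \<A> B)"
  using assms by (auto simp: dual_def)

lemma evaluation_in_bidual:
  assumes "X \<in> sections B"
  shows "(\<lambda>x \<alpha>. if \<alpha> \<in> dual_space (fibre B x) then \<alpha> (X x) else 0) \<in> sections (dual \<A> (dual \<A> B))"
proof (rule sections_dualI)
  fix x
  show "(\<lambda>\<alpha>. if \<alpha> \<in> dual_space (fibre B x) then \<alpha> (X x) else 0) \<in> dual_space (fibre (dual \<A> B) x)"
    using subspace_dual_space[of "fibre B x"]
    by (auto simp: dual_space_def[of "dual_space _"] subspace_add subspace_scale)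
qed (use assms in \<open>simp add: sections_dualD\<close>)

lemma vec1_in_multisections: "X \<in> sections B \<Longrightarrow> vec1 B X \<in> multisections \<A> B 1"
  unfolding vec1_def by (intro form1_in_forms evaluation_in_bidual)

lemma forms_alt: "w \<in> forms \<A> B k \<Longrightarrow> w x \<in> alt_forms (fibre B x) k"
  by (simp add: forms_def)

lemma forms_eval:
  "w \<in> forms \<A> B k \<Longrightarrow> length Xs = k \<Longrightarrow> set Xs \<subseteq> sections B \<Longrightarrow> eval_form w Xs \<in> Cinf \<A>"
  by (simp add: forms_def)

text \<open>Smooth dual frames over a neighbourhood of \<^term>\<open>x\<close>, cut off to global sections; this is
  all that is used of local triviality below.  The cut-off has the shape \<open>1 - \<rho>\<^sup>2\<close> with \<open>\<rho> x = 0\<close>, so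
  that at \<^term>\<open>x\<close> no derivation sees the difference between a function and its cut-off.\<close>

definition cutoff_dual_frames ::
    "('m, 'e::euclidean_space) atlas \<Rightarrow> ('m, 'v::real_vector) vbundle \<Rightarrow> 'm \<Rightarrow> nat
      \<Rightarrow> (nat \<Rightarrow> 'm \<Rightarrow> 'v) \<Rightarrow> (nat \<Rightarrow> 'm \<Rightarrow> 'v \<Rightarrow> real) \<Rightarrow> ('m \<Rightarrow> real) \<Rightarrow> bool" where
  "cutoff_dual_frames \<A> B x n e \<epsilon> \<rho> \<longleftrightarrow>
     (\<forall>i<n. e i \<in> sections B \<and> \<epsilon> i \<in> sections (dual \<A> B)) \<and> \<rho> \<in> Cinf \<A> \<and> \<rho> x = 0 \<and>
     (\<forall>y. \<forall>v\<in>fibre B y. (\<Sum>i<n. \<epsilon> i y v *\<^sub>R e i y) = (1 - (\<rho> y)\<^sup>2) *\<^sub>R v)"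

lemma cutoff_dual_framesD:
  assumes "cutoff_dual_frames \<A> B x n e \<epsilon> \<rho>"
  shows "i < n \<Longrightarrow> e i \<in> sections B" "i < n \<Longrightarrow> \<epsilon> i \<in> sections (dual \<A> B)" "\<rho> \<in> Cinf \<A>" "\<rho> x = 0"
    "v \<in> fibre B y \<Longrightarrow> (\<Sum>i<n. \<epsilon> i y v *\<^sub>R e i y) = (1 - (\<rho> y)\<^sup>2) *\<^sub>R v"
    "v \<in> fibre B x \<Longrightarrow> (\<Sum>i<n. \<epsilon> i x v *\<^sub>R e i x) = v"
  using assms by (simp_all add: cutoff_dual_frames_def)

text \<open>This interface passes to the dual bundle by exchanging \<open>e\<close> and
  \<open>\<epsilon>\<close>, so \<open>A\<close> and its dual share all the lemmas below without a
  frame atlas for the dual.\<close>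

locale dual_bases = manifold \<A> for \<A> :: "('m::{t2_space, second_countable_topology}, 'e::euclidean_space) atlas" +
  fixes B :: "('m, 'v::real_vector) vbundle"
  assumes fibre_subspace: "subspace (fibre B x)"
    and section_fibre: "s \<in> sections B \<Longrightarrow> s x \<in> fibre B x"
    and section_zero: "0 \<in> sections B"
    and section_add: "s \<in> sections B \<Longrightarrow> t \<in> sections B \<Longrightarrow> s + t \<in> sections B"
    and section_smult: "f \<in> Cinf \<A> \<Longrightarrow> s \<in> sections B \<Longrightarrow> (\<lambda>x. f x *\<^sub>R s x) \<in> sections B"
    and dual_frames: "\<exists>n e \<epsilon> \<rho>. cutoff_dual_frames \<A> B x n e \<epsilon> \<rho>"
begin

lemma section_sum: "(\<And>i. i \<in> I \<Longrightarrow> s i \<in> sections B) \<Longrightarrow> (\<lambda>x. \<Sum>i\<in>I. s i x) \<in> sections B"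
proof (induction I rule: infinite_finite_induct)
  case (insert i I)
  then show ?case using section_add[of "s i" "\<lambda>x. \<Sum>i\<in>I. s i x"] by (simp add: plus_fun_def)
qed (use section_zero in \<open>auto simp: zero_fun_def\<close>)

lemma extend_to_section:
  assumes "v \<in> fibre B x"
  obtains s where "s \<in> sections B" "s x = v"
proof -
  obtain n e \<epsilon> \<rho> where "cutoff_dual_frames \<A> B x n e \<epsilon> \<rho>" using dual_frames by blast
  note * = cutoff_dual_framesD[OF this]
  have "(\<lambda>y. \<Sum>i<n. \<epsilon> i x v *\<^sub>R e i y) \<in> sections B"
    using *(1) by (intro section_sum section_smult) auto
  from that[OF this *(6)[OF assms]] show ?thesis .
qed

lemma dual_space_separates:
  assumes "u \<in> fibre B x" "v \<in> fibre B x" "\<And>l. l \<in> dual_space (fibre B x) \<Longrightarrow> l u = l v"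
  shows "u = v"
proof -
  obtain n e \<epsilon> \<rho> where "cutoff_dual_frames \<A> B x n e \<epsilon> \<rho>" using dual_frames by blast
  note * = cutoff_dual_framesD[OF this]
  have "(\<Sum>i<n. \<epsilon> i x u *\<^sub>R e i x) = (\<Sum>i<n. \<epsilon> i x v *\<^sub>R e i x)"
    using assms(3) sections_dualD(1)[OF *(2)] by (intro sum.cong refl) auto
  then show ?thesis using *(6)[OF assms(1)] *(6)[OF assms(2)] by simp
qed

lemma dual_frames_covector:
  assumes "cutoff_dual_frames \<A> B x n e \<epsilon> \<rho>" "l \<in> dual_space (fibre B y)"
  shows "(\<Sum>i<n. l (e i y) *\<^sub>R \<epsilon> i y) = (1 - (\<rho> y)\<^sup>2) *\<^sub>R l"
proof
  note * = cutoff_dual_framesD[OF assms(1)]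
  fix u
  show "(\<Sum>i<n. l (e i y) *\<^sub>R \<epsilon> i y) u = ((1 - (\<rho> y)\<^sup>2) *\<^sub>R l) u"
  proof (cases "u \<in> fibre B y")
    case True
    have "(\<Sum>i<n. \<epsilon> i y u * l (e i y)) = l (\<Sum>i<n. \<epsilon> i y u *\<^sub>R e i y)"
      using *(1) by (intro dual_space_sum[OF assms(2) fibre_subspace, symmetric] section_fibre) auto
    also have "\<dots> = (1 - (\<rho> y)\<^sup>2) * l u"
      using dual_spaceD(2)[OF assms(2) True] *(5)[OF True] by simp
    finally show ?thesis by (simp add: sum_fun_apply mult.commute)
  next
    case False
    then have "\<epsilon> i y u = 0" if "i < n" for i
      using dual_spaceD(3)[OF sections_dualD(1)[OF *(2)[OF that]]] by blast
    then show ?thesis using dual_spaceD(3)[OF assms(2) False] by (simp add: sum_fun_apply)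
  qed
qed

text \<open>Fibres are reflexive: the frame supplies the candidate, namely the vector whose
  coordinates are the values of \<open>P\<close> on the dual frame.\<close>

lemma bidual_representative:
  assumes "P \<in> dual_space (dual_space (fibre B x))"
  shows "\<exists>!v. v \<in> fibre B x \<and> (\<forall>l\<in>dual_space (fibre B x). l v = P l)"
proof -
  obtain n e \<epsilon> \<rho> where fr: "cutoff_dual_frames \<A> B x n e \<epsilon> \<rho>" using dual_frames by blast
  note * = cutoff_dual_framesD[OF this]
  let ?v = "\<Sum>i<n. P (\<epsilon> i x) *\<^sub>R e i x"
  have v: "?v \<in> fibre B x"
    using *(1) by (intro subspace_sum subspace_scale fibre_subspace section_fibre) auto
  have "l ?v = P l" if l: "l \<in> dual_space (fibre B x)" for l
  proof -
    have "l ?v = (\<Sum>i<n. P (\<epsilon> i x) * l (e i x))"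
      using *(1) by (intro dual_space_sum[OF l fibre_subspace] section_fibre) auto
    also have "\<dots> = (\<Sum>i<n. l (e i x) * P (\<epsilon> i x))" by (simp add: mult.commute)
    also have "\<dots> = P (\<Sum>i<n. l (e i x) *\<^sub>R \<epsilon> i x)"
      using *(2) by (intro dual_space_sum[OF assms subspace_dual_space, symmetric] sections_dualD(1)) auto
    also have "\<dots> = P l" using dual_frames_covector[OF fr l] *(4) by simp
    finally show ?thesis .
  qed
  note v_eq = this
  show ?thesis
  proof (rule ex1I[of _ ?v])
    show "?v \<in> fibre B x \<and> (\<forall>l\<in>dual_space (fibre B x). l ?v = P l)"
      using v v_eq by blast
    show "u = ?v" if "u \<in> fibre B x \<and> (\<forall>l\<in>dual_space (fibre B x). l u = P l)" for u
      by (rule dual_space_separates[of _ x]) (use that v v_eq in auto)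
  qed
qed

text \<open>Every vector of a fibre is the value of a global section, so values on sections
  determine a form. This is the uniqueness required by the \<open>THE\<close> in
  \<open>differential\<close>.\<close>

lemma forms_eqI:
  assumes "w \<in> forms \<A> B k" "w' \<in> forms \<A> B k"
    "\<And>Xs. length Xs = k \<Longrightarrow> set Xs \<subseteq> sections B \<Longrightarrow> eval_form w Xs = eval_form w' Xs"
  shows "w = w'"
proof (intro ext)
  fix x vs
  show "w x vs = w' x vs"
  proof (cases "length vs = k \<and> set vs \<subseteq> fibre B x")
    case True
    define ext where "ext v = (SOME s. s \<in> sections B \<and> s x = v)" for v
    have ext: "ext v \<in> sections B \<and> ext v x = v" if v: "v \<in> fibre B x" for v
    proof -
      obtain s where "s \<in> sections B \<and> s x = v" by (rule extend_to_section[OF v]) simp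
      then show ?thesis unfolding ext_def by (rule someI[of "\<lambda>s. s \<in> sections B \<and> s x = v"])
    qed
    then have "map (\<lambda>X. X x) (map ext vs) = vs"
      unfolding map_map using True by (intro map_idI) auto
    moreover have "eval_form w (map ext vs) = eval_form w' (map ext vs)"
      using ext True by (intro assms(3)) auto
    then have "eval_form w (map ext vs) x = eval_form w' (map ext vs) x" by simp
    ultimately show ?thesis by (simp only: eval_form_def)
  next
    case False
    then show ?thesis
      using alt_formsD(1)[OF forms_alt[OF assms(1)]] alt_formsD(1)[OF forms_alt[OF assms(2)]] by simp
  qed
qed

text \<open>The two frames exchange their roles, the old frame acting by evaluation; the cut-off
  stays the same.\<close>

lemma dual_bases_dual: "dual_bases \<A> (dual \<A> B)"
proof
  fix x
  obtain n e \<epsilon> \<rho> where fr: "cutoff_dual_frames \<A> B x n e \<epsilon> \<rho>" using dual_frames by blast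
  let ?e = "\<lambda>i y \<alpha>. if \<alpha> \<in> dual_space (fibre B y) then \<alpha> (e i y) else 0"
  have "cutoff_dual_frames \<A> (dual \<A> B) x n \<epsilon> ?e \<rho>"
    unfolding cutoff_dual_frames_def
    using cutoff_dual_framesD[OF fr] dual_frames_covector[OF fr]
    by (simp add: evaluation_in_bidual)
  then show "\<exists>n e \<epsilon> \<rho>. cutoff_dual_frames \<A> (dual \<A> B) x n e \<epsilon> \<rho>" by blast
next
  show "0 \<in> sections (dual \<A> B)"
    by (rule sections_dualI) (auto simp: subspace_0[OF subspace_dual_space])
next
  fix s t assume "s \<in> sections (dual \<A> B)" "t \<in> sections (dual \<A> B)"
  then show "s + t \<in> sections (dual \<A> B)"
    by (intro sections_dualI)
       (auto simp: subspace_add[OF subspace_dual_space] sections_dualD intro!: Cinf_add)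
next
  fix f s assume "f \<in> Cinf \<A>" "s \<in> sections (dual \<A> B)"
  then show "(\<lambda>x. f x *\<^sub>R s x) \<in> sections (dual \<A> B)"
    by (intro sections_dualI)
       (auto simp: subspace_scale[OF subspace_dual_space] sections_dualD intro!: Cinf_mult)
qed (simp_all add: subspace_dual_space sections_dualD)

end

section \<open>Local frames of a vector bundle and their coordinates\<close>

definition frame_coord :: "'m set \<times> nat \<times> (nat \<Rightarrow> 'm \<Rightarrow> 'v::real_vector) \<Rightarrow> nat \<Rightarrow> 'm \<Rightarrow> 'v \<Rightarrow> real" where
  "frame_coord = (\<lambda>(U, n, e) i y v. representation ((\<lambda>i. e i y) ` {..<n}) v (e i y))"

lemma frame_coord:
  fixes U :: "'m set" and e :: "nat \<Rightarrow> 'm \<Rightarrow> 'v::real_vector"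
  assumes "inj_on (\<lambda>i. e i y) {..<n}" "independent ((\<lambda>i. e i y) ` {..<n})"
  defines "F \<equiv> span ((\<lambda>i. e i y) ` {..<n})" and "c \<equiv> \<lambda>i. frame_coord (U, n, e) i y"
  shows "v \<in> F \<Longrightarrow> (\<Sum>i<n. c i v *\<^sub>R e i y) = v"
    "i < n \<Longrightarrow> c i (\<Sum>j<n. k j *\<^sub>R e j y) = k i"
    "u \<in> F \<Longrightarrow> v \<in> F \<Longrightarrow> c i (u + v) = c i u + c i v"
    "v \<in> F \<Longrightarrow> c i (r *\<^sub>R v) = r * c i v"
proof -
  let ?b = "\<lambda>i. e i y"
  show "(\<Sum>i<n. c i v *\<^sub>R e i y) = v" if "v \<in> F" for v
    using that sum_representation_eq[OF assms(2), of v "?b ` {..<n}"]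
    by (simp add: sum.reindex[OF assms(1)] F_def c_def frame_coord_def)
  show add: "c i (u + v) = c i u + c i v" if "u \<in> F" "v \<in> F" for i u v
    using that by (simp add: F_def c_def frame_coord_def representation_add[OF assms(2)])
  show scale: "c i (r *\<^sub>R v) = r * c i v" if "v \<in> F" for i r v
    using that by (simp add: F_def c_def frame_coord_def representation_scale[OF assms(2)])
  have b: "?b j \<in> F" if "j < n" for j using that by (auto simp: F_def intro: span_base)
  have "c i (\<Sum>j\<in>J. k j *\<^sub>R e j y) = (\<Sum>j\<in>J. k j * c i (e j y))"
    if "J \<subseteq> {..<n}" for i and J :: "nat set"
    using finite_subset[OF that finite_lessThan] that
  proof (induction J rule: finite_induct)
    case empty
    show ?case by (simp add: c_def frame_coord_def representation_zero)
  next
    case (insert j J)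
    have "(\<Sum>j\<in>J. k j *\<^sub>R e j y) \<in> F"
      using insert.prems b unfolding F_def by (intro span_sum span_scale) auto
    then show ?case
      using insert b by (auto simp: add scale F_def span_scale)
  qed
  from this[of "{..<n}" i] have "c i (\<Sum>j<n. k j *\<^sub>R e j y) = (\<Sum>j<n. k j * c i (e j y))" by simp
  also have "\<dots> = (\<Sum>j<n. if j = i then k i else 0)" if "i < n"
  proof (rule sum.cong[OF refl])
    fix j assume j: "j \<in> {..<n}"
    have "e i y = e j y \<longleftrightarrow> i = j" using inj_onD[OF assms(1), of i j] j that by blast
    then have "c i (e j y) = (if j = i then 1 else 0)"
      using representation_basis[OF assms(2), of "e j y"] j
      unfolding c_def frame_coord_def by simp
    then show "k j * c i (e j y) = (if j = i then k i else 0)" by auto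
  qed
  finally show "c i (\<Sum>j<n. k j *\<^sub>R e j y) = k i" if "i < n" using that by simp
qed

locale framed_bundle = manifold \<A>
  for \<A> :: "('m::{t2_space, second_countable_topology}, 'e::euclidean_space) atlas" +
  fixes B :: "('m, 'v::real_vector) vbundle"
    and \<Phi> :: "('m set \<times> nat \<times> (nat \<Rightarrow> 'm \<Rightarrow> 'v)) set"
  assumes frames: "frame_atlas \<A> (fibre B) \<Phi>"
    and sections: "sections B =
      {s. (\<forall>x. s x \<in> fibre B x) \<and> (\<forall>(U, n, e)\<in>\<Phi>. smooth_wrt_frame \<A> U n e s)}"
begin

lemma frame_at:
  obtains U n e where "(U, n, e) \<in> \<Phi>" "x \<in> U"
proof -
  have "x \<in> (\<Union>(U, n, e)\<in>\<Phi>. U)"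
    by (subst conjunct1[OF frames[unfolded frame_atlas_def]]) (rule UNIV_I)
  then show ?thesis using that by blast
qed

lemma frame:
  assumes "(U, n, e) \<in> \<Phi>"
  shows "open U"
    "x \<in> U \<Longrightarrow> inj_on (\<lambda>i. e i x) {..<n}" "x \<in> U \<Longrightarrow> independent ((\<lambda>i. e i x) ` {..<n})"
    "x \<in> U \<Longrightarrow> span ((\<lambda>i. e i x) ` {..<n}) = fibre B x"
    "(V, m, h) \<in> \<Phi> \<Longrightarrow> j < m \<Longrightarrow> smooth_wrt_frame \<A> (U \<inter> V) n e (h j)"
proof -
  have 1: "open U \<and> (\<forall>x\<in>U. inj_on (\<lambda>i. e i x) {..<n} \<and> independent ((\<lambda>i. e i x) ` {..<n}) \<and>
      span ((\<lambda>i. e i x) ` {..<n}) = fibre B x)"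
    using frames assms unfolding frame_atlas_def by blast
  then show "open U" "x \<in> U \<Longrightarrow> inj_on (\<lambda>i. e i x) {..<n}"
    "x \<in> U \<Longrightarrow> independent ((\<lambda>i. e i x) ` {..<n})"
    "x \<in> U \<Longrightarrow> span ((\<lambda>i. e i x) ` {..<n}) = fibre B x"
    by blast+
  have "\<forall>(U, n, e)\<in>\<Phi>. \<forall>(V, m, h)\<in>\<Phi>. \<forall>j<m. smooth_wrt_frame \<A> (U \<inter> V) n e (h j)"
    by (rule conjunct2[OF conjunct2[OF frames[unfolded frame_atlas_def]]])
  then show "(V, m, h) \<in> \<Phi> \<Longrightarrow> j < m \<Longrightarrow> smooth_wrt_frame \<A> (U \<inter> V) n e (h j)"
    using assms by blast
qed

lemma subspace_fibre: "subspace (fibre B x)"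
proof -
  obtain U n e where "(U, n, e) \<in> \<Phi>" "x \<in> U" by (rule frame_at)
  then have "span ((\<lambda>i. e i x) ` {..<n}) = fibre B x" by (rule frame(4))
  then show ?thesis using subspace_span[of "(\<lambda>i. e i x) ` {..<n}"] by simp
qed

lemma frame_in_fibre: "(U, n, e) \<in> \<Phi> \<Longrightarrow> x \<in> U \<Longrightarrow> i < n \<Longrightarrow> e i x \<in> fibre B x"
  using frame(4)[of U n e x] span_base[of "e i x" "(\<lambda>i. e i x) ` {..<n}"] by simp

lemma frame_coords:
  assumes "(U, n, e) \<in> \<Phi>" "y \<in> U"
  shows "v \<in> fibre B y \<Longrightarrow> (\<Sum>i<n. frame_coord (U, n, e) i y v *\<^sub>R e i y) = v"
    "i < n \<Longrightarrow> frame_coord (U, n, e) i y (\<Sum>j<n. k j *\<^sub>R e j y) = k i"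
    "u \<in> fibre B y \<Longrightarrow> v \<in> fibre B y \<Longrightarrow>
       frame_coord (U, n, e) i y (u + v) = frame_coord (U, n, e) i y u + frame_coord (U, n, e) i y v"
    "v \<in> fibre B y \<Longrightarrow> frame_coord (U, n, e) i y (r *\<^sub>R v) = r * frame_coord (U, n, e) i y v"
proof -
  note * = frame_coord[where U = U and e = e and y = y, OF frame(2,3)[OF assms], unfolded frame(4)[OF assms]]
  show "v \<in> fibre B y \<Longrightarrow> (\<Sum>i<n. frame_coord (U, n, e) i y v *\<^sub>R e i y) = v" by (rule *(1))
  show "i < n \<Longrightarrow> frame_coord (U, n, e) i y (\<Sum>j<n. k j *\<^sub>R e j y) = k i" by (rule *(2))
  show "u \<in> fibre B y \<Longrightarrow> v \<in> fibre B y \<Longrightarrow>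
    frame_coord (U, n, e) i y (u + v) = frame_coord (U, n, e) i y u + frame_coord (U, n, e) i y v"
    by (rule *(3))
  show "v \<in> fibre B y \<Longrightarrow> frame_coord (U, n, e) i y (r *\<^sub>R v) = r * frame_coord (U, n, e) i y v"
    by (rule *(4))
qed

text \<open>Coefficients in a frame are unique, so the existential can be traded for the canonical
  coordinates, which are linear in the vector.\<close>

lemma smooth_wrt_frame_iff:
  assumes f: "(U, n, e) \<in> \<Phi>" and "\<And>x. x \<in> U \<Longrightarrow> s x \<in> fibre B x"
  shows "smooth_wrt_frame \<A> U n e s \<longleftrightarrow>
    (\<forall>i<n. smooth_fun_on \<A> U (\<lambda>y. frame_coord (U, n, e) i y (s y)))" (is "?l \<longleftrightarrow> ?r")
proof
  assume ?l
  then obtain c where c: "\<And>i. i < n \<Longrightarrow> smooth_fun_on \<A> U (c i)"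
    "\<And>x. x \<in> U \<Longrightarrow> s x = (\<Sum>i<n. c i x *\<^sub>R e i x)"
    unfolding smooth_wrt_frame_def by blast
  show ?r
  proof (intro allI impI)
    fix i assume i: "i < n"
    show "smooth_fun_on \<A> U (\<lambda>y. frame_coord (U, n, e) i y (s y))"
      by (rule smooth_fun_on_cong[OF c(1)[OF i] frame(1)[OF f]])
         (use c(2) frame_coords(2)[OF f _ i] in auto)
  qed
next
  assume ?r
  then show ?l
    unfolding smooth_wrt_frame_def
    by (intro exI[of _ "\<lambda>i y. frame_coord (U, n, e) i y (s y)"])
       (use assms frame_coords(1)[OF f] in auto)
qed

lemma in_sections_iff:
  "s \<in> sections B \<longleftrightarrow> (\<forall>x. s x \<in> fibre B x) \<and>
     (\<forall>(U, n, e)\<in>\<Phi>. \<forall>i<n. smooth_fun_on \<A> U (\<lambda>y. frame_coord (U, n, e) i y (s y)))"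
proof -
  have "(\<forall>(U, n, e)\<in>\<Phi>. smooth_wrt_frame \<A> U n e s) \<longleftrightarrow>
      (\<forall>(U, n, e)\<in>\<Phi>. \<forall>i<n. smooth_fun_on \<A> U (\<lambda>y. frame_coord (U, n, e) i y (s y)))"
    if "\<forall>x. s x \<in> fibre B x"
    by (rule ball_cong[OF refl]) (clarsimp simp: smooth_wrt_frame_iff that)
  then show ?thesis unfolding sections by blast
qed

lemma cutoff_frame_section:
  assumes f: "(U, n, e) \<in> \<Phi>" and "i < n"
    and b: "\<beta> \<in> Cinf \<A>" "closed C" "C \<subseteq> U" "\<And>y. y \<notin> C \<Longrightarrow> \<beta> y = 0"
  shows "(\<lambda>y. \<beta> y *\<^sub>R e i y) \<in> sections B"
  unfolding sections
proof (intro CollectI conjI allI ballI)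
  fix y
  show "\<beta> y *\<^sub>R e i y \<in> fibre B y"
    using frame_in_fibre[OF f _ \<open>i < n\<close>, of y] b subspace_fibre[of y]
    by (cases "y \<in> C") (auto intro: subspace_scale subspace_0)
next
  fix t assume "t \<in> \<Phi>"
  obtain V m h where t: "t = (V, m, h)" by (cases t)
  have g: "(V, m, h) \<in> \<Phi>" using \<open>t \<in> \<Phi>\<close> t by simp
  \<comment> \<open>Another frame sees \<open>e i\<close> through transition coefficients that are
    smooth on the overlap only; multiplied by \<open>\<beta>\<close> they extend by zero over
    \<open>V\<close>.\<close>
  obtain c where c: "\<And>j. j < m \<Longrightarrow> smooth_fun_on \<A> (V \<inter> U) (c j)"
    "\<And>y. y \<in> V \<inter> U \<Longrightarrow> e i y = (\<Sum>j<m. c j y *\<^sub>R h j y)"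
    using frame(5)[OF g f \<open>i < n\<close>] unfolding smooth_wrt_frame_def by blast
  have "\<beta> y *\<^sub>R e i y = (\<Sum>j<m. (\<beta> y * c j y) *\<^sub>R h j y)" if "y \<in> V" for y
  proof (cases "y \<in> U")
    case True
    with c(2)[of y] that show ?thesis by (simp add: scaleR_sum_right)
  next
    case False
    then have "\<beta> y = 0" using b(3,4) by blast
    then show ?thesis by simp
  qed
  moreover have "smooth_fun_on \<A> V (\<lambda>y. \<beta> y * c j y)" if "j < m" for j
    using c(1)[OF that] by (intro smooth_fun_on_cutoff[OF b] frame(1)[OF f] frame(1)[OF g])
      (simp_all add: Int_commute)
  ultimately have "smooth_wrt_frame \<A> V m h (\<lambda>y. \<beta> y *\<^sub>R e i y)"
    unfolding smooth_wrt_frame_def by (intro exI[of _ "\<lambda>j y. \<beta> y * c j y"]) simp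
  then show "case t of (V, m, h) \<Rightarrow> smooth_wrt_frame \<A> V m h (\<lambda>y. \<beta> y *\<^sub>R e i y)"
    by (simp add: t)
qed

lemma cutoff_coord_section:
  assumes f: "(U, n, e) \<in> \<Phi>" and "i < n"
    and b: "\<beta> \<in> Cinf \<A>" "closed C" "C \<subseteq> U" "\<And>y. y \<notin> C \<Longrightarrow> \<beta> y = 0"
  shows "(\<lambda>y v. if v \<in> fibre B y then \<beta> y * frame_coord (U, n, e) i y v else 0) \<in> sections (dual \<A> B)"
proof (rule sections_dualI)
  fix y
  show "(\<lambda>v. if v \<in> fibre B y then \<beta> y * frame_coord (U, n, e) i y v else 0) \<in> dual_space (fibre B y)"
  proof (cases "y \<in> C")
    case True
    then have "y \<in> U" using b by blast
    then show ?thesis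
      using subspace_fibre[of y] frame_coords(3,4)[OF f]
      by (auto simp: dual_space_def subspace_add subspace_scale algebra_simps)
  qed (simp add: b dual_space_def)
next
  fix X assume X: "X \<in> sections B"
  then have "smooth_fun_on \<A> U (\<lambda>y. frame_coord (U, n, e) i y (X y))"
    using f \<open>i < n\<close> unfolding in_sections_iff by fast
  then have "smooth_fun_on \<A> UNIV (\<lambda>y. \<beta> y * frame_coord (U, n, e) i y (X y))"
    by (intro smooth_fun_on_cutoff[OF b] frame(1)[OF f]) simp_all
  moreover have "X y \<in> fibre B y" for y using X by (simp add: in_sections_iff)
  ultimately show "(\<lambda>y. if X y \<in> fibre B y then \<beta> y * frame_coord (U, n, e) i y (X y) else 0) \<in> Cinf \<A>"
    by (simp add: in_Cinf_iff)
qed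

lemma ex_cutoff_dual_frames: "\<exists>n e \<epsilon> \<rho>. cutoff_dual_frames \<A> B x n e \<epsilon> \<rho>"
proof -
  obtain U n e where f: "(U, n, e) \<in> \<Phi>" and "x \<in> U" by (rule frame_at)
  obtain \<beta> C where b: "\<beta> \<in> Cinf \<A>" "\<beta> x = 1" "closed C" "C \<subseteq> U" "\<And>y. y \<notin> C \<Longrightarrow> \<beta> y = 0"
    using bump[OF frame(1)[OF f] \<open>x \<in> U\<close>] by metis
  \<comment> \<open>Chosen so that \<beta> \<gamma> = 1 - (1 - \<beta>^2)^2: the frame is cut off by
    \<beta>, the dual frame by \<gamma>, and the total factor has the required shape with \<rho> = 1
    - \<beta>^2.\<close>
  define \<gamma> where "\<gamma> = (\<lambda>y. \<beta> y * (2 - \<beta> y * \<beta> y))"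
  have g: "\<gamma> \<in> Cinf \<A>" "\<And>y. y \<notin> C \<Longrightarrow> \<gamma> y = 0"
    unfolding \<gamma>_def using b by (auto intro!: Cinf_intros)
  let ?\<epsilon> = "\<lambda>i y v. if v \<in> fibre B y then \<gamma> y * frame_coord (U, n, e) i y v else 0"
  let ?\<rho> = "\<lambda>y. 1 - \<beta> y * \<beta> y"
  have "(\<Sum>i<n. ?\<epsilon> i y v *\<^sub>R \<beta> y *\<^sub>R e i y) = (1 - (?\<rho> y)\<^sup>2) *\<^sub>R v" if v: "v \<in> fibre B y" for y v
  proof (cases "y \<in> U")
    case True
    have "(\<Sum>i<n. ?\<epsilon> i y v *\<^sub>R \<beta> y *\<^sub>R e i y) =
        (\<gamma> y * \<beta> y) *\<^sub>R (\<Sum>i<n. frame_coord (U, n, e) i y v *\<^sub>R e i y)"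
      unfolding scaleR_sum_right using v by (intro sum.cong) (simp_all add: mult_ac)
    then show ?thesis
      using frame_coords(1)[OF f True v]
      by (simp add: \<gamma>_def power2_eq_square algebra_simps)
  next
    case False
    then have "\<beta> y = 0" using b by blast
    then show ?thesis by simp
  qed
  then have "cutoff_dual_frames \<A> B x n (\<lambda>i y. \<beta> y *\<^sub>R e i y) ?\<epsilon> ?\<rho>"
    unfolding cutoff_dual_frames_def
    using cutoff_frame_section[OF f _ b(1,3,4,5)] cutoff_coord_section[OF f _ g(1) b(3,4) g(2)] b
    by (auto intro!: Cinf_intros)
  then show ?thesis by blast
qed

sublocale dual_bases \<A> B
proof
  show "0 \<in> sections B"
    using frame_coords(2)[where k = "\<lambda>_. 0"] frame(1) subspace_0[OF subspace_fibre]
    by (auto simp: in_sections_iff intro!: smooth_fun_on_cong[OF smooth_fun_on_const[of _ 0]])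
  fix s t assume st: "s \<in> sections B" "t \<in> sections B"
  show "s + t \<in> sections B"
    unfolding in_sections_iff
  proof (intro conjI allI ballI, goal_cases)
    case (1 x)
    then show ?case using st by (simp add: in_sections_iff subspace_add[OF subspace_fibre])
  next
    case (2 u)
    obtain U n e where u: "u = (U, n, e)" by (cases u)
    with 2 have f: "(U, n, e) \<in> \<Phi>" by simp
    have "smooth_fun_on \<A> U (\<lambda>y. frame_coord (U, n, e) i y ((s + t) y))" if "i < n" for i
      by (rule smooth_fun_on_cong[OF smooth_fun_on_add[OF frame(1)[OF f],
              of "\<lambda>y. frame_coord (U, n, e) i y (s y)" "\<lambda>y. frame_coord (U, n, e) i y (t y)"] frame(1)[OF f]])
         (use st f that frame_coords(3)[OF f] in \<open>fastforce simp: in_sections_iff\<close>)+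
    then show ?case by (simp add: u)
  qed
next
  fix g s assume g: "g \<in> Cinf \<A>" and s: "s \<in> sections B"
  show "(\<lambda>x. g x *\<^sub>R s x) \<in> sections B"
    unfolding in_sections_iff
  proof (intro conjI allI ballI, goal_cases)
    case (1 x)
    then show ?case using s by (simp add: in_sections_iff subspace_scale[OF subspace_fibre])
  next
    case (2 u)
    obtain U n e where u: "u = (U, n, e)" by (cases u)
    with 2 have f: "(U, n, e) \<in> \<Phi>" by simp
    have "smooth_fun_on \<A> U (\<lambda>y. frame_coord (U, n, e) i y (g y *\<^sub>R s y))" if "i < n" for i
      by (rule smooth_fun_on_cong[OF smooth_fun_on_mult[OF frame(1)[OF f] Cinf_smooth_fun_on[OF g],
              of "\<lambda>y. frame_coord (U, n, e) i y (s y)"] frame(1)[OF f]])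
         (use s f that frame_coords(4)[OF f] in \<open>fastforce simp: in_sections_iff\<close>)+
    then show ?case by (simp add: u)
  qed
qed (use subspace_fibre ex_cutoff_dual_frames in \<open>auto simp: in_sections_iff\<close>)

text \<open>Pairing with a cut-off coordinate form gives \<beta> times a coordinate of
  \<open>s\<close>; dividing by \<beta> where it is nonzero shows that the coordinate is smooth
  there. Sections that are constructed fibre by fibre are recognised in this way.\<close>

lemma section_if_pairings_smooth:
  assumes "\<And>x. s x \<in> fibre B x" "\<And>\<alpha>. \<alpha> \<in> sections (dual \<A> B) \<Longrightarrow> (\<lambda>x. \<alpha> x (s x)) \<in> Cinf \<A>"
  shows "s \<in> sections B"
proof -
  have "smooth_fun_on \<A> U (\<lambda>y. frame_coord (U, n, e) i y (s y))"
    if f: "(U, n, e) \<in> \<Phi>" and "i < n" for U n e i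
  proof (rule smooth_fun_on_local)
    fix x assume "x \<in> U"
    obtain \<beta> C where b: "\<beta> \<in> Cinf \<A>" "\<beta> x = 1" "closed C" "C \<subseteq> U" "\<And>y. y \<notin> C \<Longrightarrow> \<beta> y = 0"
      using bump[OF frame(1)[OF f] \<open>x \<in> U\<close>] by metis
    let ?N = "{y. \<beta> y \<noteq> 0}"
    have N: "open ?N" by (rule Cinf_nonzero_open[OF b(1)])
    have "(\<lambda>y. \<beta> y * frame_coord (U, n, e) i y (s y)) \<in> Cinf \<A>"
      using assms(2)[OF cutoff_coord_section[OF f \<open>i < n\<close> b(1,3,4,5)]] assms(1) by simp
    then have "smooth_fun_on \<A> ?N (\<lambda>y. inverse (\<beta> y) * (\<beta> y * frame_coord (U, n, e) i y (s y)))"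
      by (intro smooth_fun_on_mult smooth_fun_on_inverse N Cinf_smooth_fun_on b(1)) simp
    then have "smooth_fun_on \<A> ?N (\<lambda>y. frame_coord (U, n, e) i y (s y))"
      by (rule smooth_fun_on_cong[OF _ N]) (simp add: field_simps)
    then show "\<exists>N. open N \<and> x \<in> N \<and> smooth_fun_on \<A> N (\<lambda>y. frame_coord (U, n, e) i y (s y))"
      using N b(2) by (intro exI[of _ ?N]) simp
  qed
  then show ?thesis using assms(1) by (auto simp: in_sections_iff)
qed

text \<open>Reflexivity at each point yields the vectors, and the preceding lemma their smoothness.
  It is needed because \<open>dW 0 (form0 f)\<close> is a form on the dual bundle, whereas the
  bracket on \<open>A\<close> takes sections.\<close>

lemma multisection1_is_vec1:
  assumes P: "P \<in> multisections \<A> B 1"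
  obtains X where "X \<in> sections B" "vec1 B X = P"
proof -
  have P': "(\<lambda>l. P x [l]) \<in> dual_space (dual_space (fibre B x))" for x
  proof -
    note D = alt_formsD[OF forms_alt[OF P, where x = x]]
    have "P x [l] = 0" if "l \<notin> dual_space (fibre B x)" for l
      using D(1)[of "[l]"] that by simp
    moreover have "P x [k + l] = P x [k] + P x [l]"
      if "k \<in> dual_space (fibre B x)" "l \<in> dual_space (fibre B x)" for k l
      using D(2)[of k l "[]" "[]"] that by simp
    moreover have "P x [c *\<^sub>R l] = c * P x [l]" if "l \<in> dual_space (fibre B x)" for c l
      using D(3)[of l "[]" "[]"] that by simp
    ultimately show ?thesis by (simp add: dual_space_def[of "dual_space _"])
  qed
  from ex1_implies_ex[OF bidual_representative[OF this]] obtain X where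
    X: "\<And>x. X x \<in> fibre B x" "\<And>x l. l \<in> dual_space (fibre B x) \<Longrightarrow> l (X x) = P x [l]"
    by metis
  have "(\<lambda>x. \<alpha> x (X x)) \<in> Cinf \<A>" if "\<alpha> \<in> sections (dual \<A> B)" for \<alpha>
    using forms_eval[OF P, of "[\<alpha>]"] that X(2)[OF sections_dualD(1)[OF that]]
    by (simp add: eval_form_def)
  then have "X \<in> sections B" by (intro section_if_pairings_smooth X)
  moreover have "vec1 B X x vs = P x vs" for x vs
  proof (cases "\<exists>l. vs = [l] \<and> l \<in> dual_space (fibre B x)")
    case True
    then show ?thesis using X(2) by (auto simp: vec1_apply)
  next
    case False
    then have "\<not> (length vs = 1 \<and> set vs \<subseteq> dual_space (fibre B x))"
      by (auto simp: length_Suc_conv)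
    then show ?thesis
      using alt_formsD(1)[OF forms_alt[OF P]]
        alt_formsD(1)[OF forms_alt[OF vec1_in_multisections[OF \<open>X \<in> sections B\<close>]]] by simp
  qed
  then have "vec1 B X = P" by blast
  ultimately show ?thesis using that by blast
qed

end

lemma vector_bundle_framed:
  assumes "smooth_manifold \<A>" "vector_bundle \<A> B"
  obtains \<Phi> where "framed_bundle \<A> B \<Phi>"
proof -
  obtain \<Phi> where "frame_atlas \<A> (fibre B) \<Phi>" "sections B =
      {s. (\<forall>x. s x \<in> fibre B x) \<and> (\<forall>(U, n, e)\<in>\<Phi>. smooth_wrt_frame \<A> U n e s)}"
    using assms(2) unfolding vector_bundle_def by blast
  then show ?thesis using assms(1) by (intro that) (unfold_locales, auto)
qed

section \<open>The differential of functions and one-forms\<close>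

lemma fibre_TM [simp]: "fibre (TM \<A>) = tangent_space \<A>"
  by (simp add: TM_def)

locale anchored_bundle = dual_bases \<A> B
  for \<A> :: "('m::{t2_space, second_countable_topology}, 'e::euclidean_space) atlas"
    and B :: "('m, 'v::real_vector) vbundle" +
  fixes a :: "('m, 'v) anchor" and br :: "('m, 'v) bracket"
  assumes anchored: "anchored_bracket \<A> B a br"
begin

lemma anchor:
  shows "v \<in> fibre B x \<Longrightarrow> a x v \<in> tangent_space \<A> x"
    "u \<in> fibre B x \<Longrightarrow> v \<in> fibre B x \<Longrightarrow> a x (u + v) = a x u + a x v"
    "v \<in> fibre B x \<Longrightarrow> a x (c *\<^sub>R v) = c *\<^sub>R a x v"
    "X \<in> sections B \<Longrightarrow> (\<lambda>x. a x (X x)) \<in> sections (TM \<A>)"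
proof -
  have bm: "bundle_map B (TM \<A>) a"
    using anchored unfolding anchored_bracket_def by (rule conjunct1)
  note 1 = spec[OF conjunct1[OF bm[unfolded bundle_map_def]], of x]
  show "v \<in> fibre B x \<Longrightarrow> a x v \<in> tangent_space \<A> x"
    using conjunct1[OF 1] by simp
  show "u \<in> fibre B x \<Longrightarrow> v \<in> fibre B x \<Longrightarrow> a x (u + v) = a x u + a x v"
    using conjunct1[OF conjunct2[OF 1]] by simp
  show "v \<in> fibre B x \<Longrightarrow> a x (c *\<^sub>R v) = c *\<^sub>R a x v"
    using conjunct2[OF conjunct2[OF 1]] by simp
  show "X \<in> sections B \<Longrightarrow> (\<lambda>x. a x (X x)) \<in> sections (TM \<A>)"
    by (rule bspec[OF conjunct2[OF bm[unfolded bundle_map_def]]])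
qed

lemma bracket:
  assumes "X \<in> sections B" "Y \<in> sections B"
  shows "br X Y \<in> sections B" "br Y X = - br X Y"
    "Z \<in> sections B \<Longrightarrow> br X (Y + Z) = br X Y + br X Z"
    "f \<in> Cinf \<A> \<Longrightarrow> br X (\<lambda>x. f x *\<^sub>R Y x) = (\<lambda>x. f x *\<^sub>R br X Y x + act a X f x *\<^sub>R Y x)"
proof -
  note * = anchored[unfolded anchored_bracket_def]
  note 1 = conjunct1[OF conjunct2[OF *]] conjunct1[OF conjunct2[OF conjunct2[OF *]]]
    conjunct2[OF conjunct2[OF conjunct2[OF *]]]
  show "br X Y \<in> sections B" "br Y X = - br X Y" using 1(1) assms by blast+
  show "Z \<in> sections B \<Longrightarrow> br X (Y + Z) = br X Y + br X Z" using 1(2) assms by blast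
  show "f \<in> Cinf \<A> \<Longrightarrow>
    br X (\<lambda>x. f x *\<^sub>R Y x) = (\<lambda>x. f x *\<^sub>R br X Y x + act a X f x *\<^sub>R Y x)"
    using 1(3) assms by blast
qed

lemma act_Cinf: "X \<in> sections B \<Longrightarrow> f \<in> Cinf \<A> \<Longrightarrow> act a X f \<in> Cinf \<A>"
  using anchor(4)[of X] by (simp add: TM_def act_def)

lemma act_tangent: "X \<in> sections B \<Longrightarrow> a x (X x) \<in> tangent_space \<A> x"
  by (simp add: anchor section_fibre)

lemma differential_eqI:
  assumes "w' \<in> forms \<A> B (k + 1)"
    "\<And>Xs. length Xs = k + 1 \<Longrightarrow> set Xs \<subseteq> sections B \<Longrightarrow> eval_form w' Xs = cartan a br k w Xs"
  shows "differential \<A> B a br k w = w'"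
  unfolding differential_def
proof (rule the_equality)
  fix w'' assume "w'' \<in> forms \<A> B (k + 1) \<and>
    (\<forall>Xs. length Xs = k + 1 \<and> set Xs \<subseteq> sections B \<longrightarrow> eval_form w'' Xs = cartan a br k w Xs)"
  with assms show "w'' = w'" by (intro forms_eqI[of _ "k + 1"]) simp_all
qed (use assms in blast)

lemma cartan_0: "cartan a br 0 w [X] = act a X (eval_form w [])"
  by (simp add: cartan_def del_def)

lemma cartan_1:
  "cartan a br 1 w [X, Y] = (\<lambda>x. act a X (eval_form w [Y]) x - act a Y (eval_form w [X]) x -
     eval_form w [br X Y] x)"
  by (simp add: cartan_def del_def atMost_Suc lessThan_Suc fun_eq_iff)

lemma anchor_covector:
  assumes "f \<in> Cinf \<A>"
  shows "(\<lambda>x v. if v \<in> fibre B x then a x v f else 0) \<in> sections (dual \<A> B)"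
proof (rule sections_dualI)
  fix x
  show "(\<lambda>v. if v \<in> fibre B x then a x v f else 0) \<in> dual_space (fibre B x)"
    by (auto simp: dual_space_def anchor subspace_add subspace_scale fibre_subspace)
next
  fix X assume "X \<in> sections B"
  with act_Cinf[OF this assms]
  show "(\<lambda>x. if X x \<in> fibre B x then a x (X x) f else 0) \<in> Cinf \<A>"
    by (simp add: section_fibre act_def)
qed

lemma differential_0:
  assumes "f \<in> Cinf \<A>"
  shows "differential \<A> B a br 0 (form0 f) = form1 (\<lambda>x v. if v \<in> fibre B x then a x v f else 0)"
proof (rule differential_eqI)
  show "form1 (\<lambda>x v. if v \<in> fibre B x then a x v f else 0) \<in> forms \<A> B (0 + 1)"
    using form1_in_forms[OF anchor_covector[OF assms]] by simp
  fix Xs assume "length Xs = 0 + 1" and Xs: "set Xs \<subseteq> sections B"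
  then obtain X where X: "Xs = [X]" by (auto simp: length_Suc_conv)
  then show "eval_form (form1 (\<lambda>x v. if v \<in> fibre B x then a x v f else 0)) Xs =
      cartan a br 0 (form0 f) Xs"
    using Xs section_fibre[of X] by (simp add: cartan_0 eval_form_def form1_apply form0_def act_def)
qed

context
  fixes \<alpha> assumes \<alpha>: "\<alpha> \<in> sections (dual \<A> B)"
begin

text \<open>Cartan's expression for the differential of \<alpha>, still a function of sections. To
  define a two-form it must depend on their values at the point alone, which is the goal of the
  lemmas up to \<open>C_cong\<close>.\<close>

private definition C where
  "C X Y x = act a X (\<lambda>x. \<alpha> x (Y x)) x - act a Y (\<lambda>x. \<alpha> x (X x)) x - \<alpha> x (br X Y x)"

private lemma \<alpha>_linear:
  "u \<in> fibre B x \<Longrightarrow> v \<in> fibre B x \<Longrightarrow> \<alpha> x (u + v) = \<alpha> x u + \<alpha> x v"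
  "v \<in> fibre B x \<Longrightarrow> \<alpha> x (c *\<^sub>R v) = c * \<alpha> x v"
  by (rule dual_spaceD[OF sections_dualD(1)[OF \<alpha>]]; assumption)+

private lemma C_skew:
  assumes "X \<in> sections B" "Y \<in> sections B"
  shows "C X Y x = - C Y X x"
  using \<alpha>_linear(2)[OF section_fibre[OF bracket(1)[OF assms]], of x "- 1"]
  by (simp add: C_def bracket(2)[OF assms])

private lemma C_add:
  assumes "X \<in> sections B" "Y \<in> sections B" "Z \<in> sections B"
  shows "C X (Y + Z) x = C X Y x + C X Z x"
proof -
  have "(\<lambda>x. \<alpha> x ((Y + Z) x)) = (\<lambda>x. \<alpha> x (Y x) + \<alpha> x (Z x))"
    using assms by (simp add: \<alpha>_linear section_fibre)
  moreover have "a x (X x) (\<lambda>x. \<alpha> x (Y x) + \<alpha> x (Z x)) =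
      a x (X x) (\<lambda>x. \<alpha> x (Y x)) + a x (X x) (\<lambda>x. \<alpha> x (Z x))"
    using assms by (intro tangent_add[OF act_tangent] sections_dualD(2)[OF \<alpha>])
  ultimately show ?thesis
    using assms by (simp add: C_def act_def bracket(1,3) \<alpha>_linear section_fibre anchor(1-3))
qed

private lemma C_scale:
  assumes "X \<in> sections B" "Y \<in> sections B" "f \<in> Cinf \<A>"
  shows "C X (\<lambda>x. f x *\<^sub>R Y x) x = f x * C X Y x"
proof -
  have "(\<lambda>x. \<alpha> x (f x *\<^sub>R Y x)) = (\<lambda>x. f x * \<alpha> x (Y x))"
    using assms by (simp add: \<alpha>_linear section_fibre)
  moreover have "a x (X x) (\<lambda>x. f x * \<alpha> x (Y x)) =
      f x * a x (X x) (\<lambda>x. \<alpha> x (Y x)) + a x (X x) f * \<alpha> x (Y x)"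
    using assms by (intro tangent_mult[OF act_tangent] sections_dualD(2)[OF \<alpha>])
  ultimately show ?thesis
    using assms
    by (simp add: C_def act_def bracket(1,4) \<alpha>_linear section_fibre anchor(1-3)
        subspace_scale[OF fibre_subspace] algebra_simps)
qed

private lemma C_sum:
  assumes "X \<in> sections B" "\<And>i. i \<in> I \<Longrightarrow> Y i \<in> sections B"
  shows "C X (\<lambda>x. \<Sum>i\<in>I. Y i x) x = (\<Sum>i\<in>I. C X (Y i) x)"
  using assms(2)
proof (induction I rule: infinite_finite_induct)
  case (insert i I)
  then show ?case
    using C_add[OF assms(1), of "Y i" "\<lambda>x. \<Sum>i\<in>I. Y i x"] section_sum[of I Y]
    by (simp add: plus_fun_def)
qed (use C_scale[OF assms(1) section_zero, of "\<lambda>x. 0" x] in simp_all)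

text \<open>Linearity over smooth functions makes \<open>C\<close> pointwise: near \<open>x\<close>,
  \<open>Y\<close> is a combination of frame sections whose coefficients vanish at
  \<open>x\<close>.\<close>

private lemma C_zero:
  assumes "X \<in> sections B" "Y \<in> sections B" "Y x = 0"
  shows "C X Y x = 0"
proof -
  obtain n e \<epsilon> \<rho> where "cutoff_dual_frames \<A> B x n e \<epsilon> \<rho>" using dual_frames by blast
  note * = cutoff_dual_framesD[OF this]
  have \<epsilon>: "(\<lambda>y. \<epsilon> i y (Y y)) \<in> Cinf \<A>" if "i < n" for i
    using sections_dualD(2)[OF *(2)[OF that] assms(2)] .
  \<comment> \<open>The cut-off factor is 1 at \<open>x\<close>, so by linearity over functions it
    changes nothing there; it turns \<open>Y\<close> into a combination of global sections.\<close>
  have "C X Y x = C X (\<lambda>y. (1 - (\<rho> y)\<^sup>2) *\<^sub>R Y y) x"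
    using C_scale[OF assms(1,2), of "\<lambda>y. 1 - \<rho> y * \<rho> y" x] *(3,4)
    by (simp add: power2_eq_square Cinf_intros)
  also have "(\<lambda>y. (1 - (\<rho> y)\<^sup>2) *\<^sub>R Y y) = (\<lambda>y. \<Sum>i<n. \<epsilon> i y (Y y) *\<^sub>R e i y)"
    using *(5)[OF section_fibre[OF assms(2)]] by simp
  also have "C X \<dots> x = (\<Sum>i<n. C X (\<lambda>y. \<epsilon> i y (Y y) *\<^sub>R e i y) x)"
    using *(1) \<epsilon> by (intro C_sum assms section_smult) auto
  also have "\<dots> = (\<Sum>i<n. \<epsilon> i x (Y x) * C X (e i) x)"
    using *(1) \<epsilon> by (intro sum.cong refl C_scale assms) auto
  also have "\<epsilon> i x (Y x) = 0" if "i < n" for i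
    using dual_spaceD(2)[OF sections_dualD(1)[OF *(2)[OF that]] subspace_0[OF fibre_subspace], of x 0]
      assms(3) by simp
  then have "(\<Sum>i<n. \<epsilon> i x (Y x) * C X (e i) x) = 0" by simp
  finally show ?thesis .
qed

private lemma C_cong_right:
  assumes "X \<in> sections B" "Y \<in> sections B" "Y' \<in> sections B" "Y x = Y' x"
  shows "C X Y x = C X Y' x"
proof -
  have m: "(\<lambda>x. - 1 *\<^sub>R Y' x) \<in> sections B"
    using section_smult[OF Cinf_const assms(3), of "- 1"] by simp
  have "C X (Y + (\<lambda>x. - 1 *\<^sub>R Y' x)) x = 0"
    using assms m by (intro C_zero section_add) auto
  then show ?thesis
    using C_add[OF assms(1,2) m, of x] C_scale[OF assms(1,3) Cinf_const, of "- 1" x] by simp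
qed

private lemma C_cong:
  assumes "X \<in> sections B" "X' \<in> sections B" "Y \<in> sections B" "Y' \<in> sections B"
    "X x = X' x" "Y x = Y' x"
  shows "C X Y x = C X' Y' x"
  using C_cong_right[of X Y Y' x] C_cong_right[of Y' X X' x] C_skew[of X Y' x] C_skew[of X' Y' x]
    assms by simp

private lemma C_Cinf:
  assumes "X \<in> sections B" "Y \<in> sections B"
  shows "C X Y \<in> Cinf \<A>"
proof -
  have "C X Y = (\<lambda>x. act a X (\<lambda>x. \<alpha> x (Y x)) x - act a Y (\<lambda>x. \<alpha> x (X x)) x - \<alpha> x (br X Y x))"
    by (simp add: C_def fun_eq_iff)
  then show ?thesis
    using assms by (auto intro!: Cinf_diff act_Cinf sections_dualD(2)[OF \<alpha>] bracket(1))
qed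

private definition ext where "ext x v = (SOME s. s \<in> sections B \<and> s x = v)"

private lemma ext: "v \<in> fibre B x \<Longrightarrow> ext x v \<in> sections B" "v \<in> fibre B x \<Longrightarrow> ext x v x = v"
proof -
  assume v: "v \<in> fibre B x"
  obtain s where "s \<in> sections B \<and> s x = v" by (rule extend_to_section[OF v]) simp
  then have "ext x v \<in> sections B \<and> ext x v x = v"
    unfolding ext_def by (rule someI[of "\<lambda>s. s \<in> sections B \<and> s x = v"])
  then show "ext x v \<in> sections B" "ext x v x = v" by auto
qed

text \<open>This is the existence behind the \<open>THE\<close> in \<open>differential\<close>: as
  \<open>C\<close> is pointwise, it may be evaluated on arbitrary extensions of two vectors.\<close>

lemma differential_1:
  shows "differential \<A> B a br 1 (form1 \<alpha>) \<in> forms \<A> B 2"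
    "X \<in> sections B \<Longrightarrow> Y \<in> sections B \<Longrightarrow> differential \<A> B a br 1 (form1 \<alpha>) x [X x, Y x] =
       act a X (\<lambda>x. \<alpha> x (Y x)) x - act a Y (\<lambda>x. \<alpha> x (X x)) x - \<alpha> x (br X Y x)"
proof -
  define b where "b x u v = C (ext x u) (ext x v) x" for x u v
  define w where "w x vs = (if length vs = 2 \<and> set vs \<subseteq> fibre B x then b x (vs ! 0) (vs ! 1) else 0)"
    for x vs
  have b: "b x (X x) (Y x) = C X Y x" if "X \<in> sections B" "Y \<in> sections B" for X Y x
    unfolding b_def using that by (intro C_cong ext) (auto simp: ext section_fibre)
  have bs: "b x u v = - b x v u" if "u \<in> fibre B x" "v \<in> fibre B x" for x u v
    unfolding b_def using that by (intro C_skew ext)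
  have b_add: "b x z (u + v) = b x z u + b x z v"
    if "u \<in> fibre B x" "v \<in> fibre B x" "z \<in> fibre B x" for x u v z
    using b[of "ext x z" "ext x u + ext x v" x] C_add[of "ext x z" "ext x u" "ext x v" x] that
    by (simp add: ext section_add b_def)
  have b_scale: "b x z (c *\<^sub>R v) = c * b x z v"
    if "v \<in> fibre B x" "z \<in> fibre B x" for x c v z
    using b[of "ext x z" "\<lambda>y. c *\<^sub>R ext x v y" x] C_scale[of "ext x z" "ext x v" "\<lambda>_. c" x] that
      section_smult[OF Cinf_const, of "ext x v" c]
    by (simp add: ext b_def)
  have alt: "w x \<in> alt_forms (fibre B x) 2" for x
    unfolding w_def
  proof (rule bilinear_alt_forms)
    show "b x v v = 0" if "v \<in> fibre B x" for v using bs[OF that that] by simp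
    show "b x (u + v) z = b x u z + b x v z"
      if "u \<in> fibre B x" "v \<in> fibre B x" "z \<in> fibre B x" for u v z
      using that bs[of "u + v" x z] bs[of u x z] bs[of v x z]
      by (simp add: b_add subspace_add[OF fibre_subspace])
    show "b x (c *\<^sub>R v) z = c * b x v z" if "v \<in> fibre B x" "z \<in> fibre B x" for c v z
      using that bs[of "c *\<^sub>R v" x z] bs[of v x z]
      by (simp add: b_scale subspace_scale[OF fibre_subspace])
  qed (simp_all add: b_add b_scale fibre_subspace)
  have ev: "eval_form w [X, Y] = C X Y" if "X \<in> sections B" "Y \<in> sections B" for X Y
    using that b by (simp add: fun_eq_iff eval_form_def w_def section_fibre)
  have w: "w \<in> forms \<A> B 2"
    unfolding forms_def using alt ev C_Cinf by (auto simp: length_Suc_conv numeral_2_eq_2)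
  have "eval_form w Xs = cartan a br 1 (form1 \<alpha>) Xs"
    if "length Xs = 1 + 1" "set Xs \<subseteq> sections B" for Xs
  proof -
    have "length Xs = Suc (Suc 0)" using that(1) by simp
    then obtain X Y where "Xs = [X, Y]" by (auto simp only: length_Suc_conv length_0_conv)
    then show ?thesis
      using that(2) ev[of X Y]
      by (simp add: fun_eq_iff C_def eval_form_def form1_apply cartan_1[unfolded One_nat_def])
  qed
  then have d: "differential \<A> B a br 1 (form1 \<alpha>) = w"
    using w by (intro differential_eqI) (simp_all add: numeral_2_eq_2)
  then show "differential \<A> B a br 1 (form1 \<alpha>) \<in> forms \<A> B 2" using w by simp
  show "differential \<A> B a br 1 (form1 \<alpha>) x [X x, Y x] =
      act a X (\<lambda>x. \<alpha> x (Y x)) x - act a Y (\<lambda>x. \<alpha> x (X x)) x - \<alpha> x (br X Y x)"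
    if "X \<in> sections B" "Y \<in> sections B"
    using fun_cong[OF ev[OF that], of x] d by (simp add: eval_form_def C_def)
qed

end

end

section \<open>Vector fields and one-jets\<close>

lemma has_real_derivative_along_line:
  assumes "g differentiable (at (q + s *\<^sub>R u))"
  shows "((\<lambda>s. g (q + s *\<^sub>R u)) has_real_derivative frechet_derivative g (at (q + s *\<^sub>R u)) u) (at s)"
proof -
  let ?g' = "frechet_derivative g (at (q + s *\<^sub>R u))"
  have g: "(g has_derivative ?g') (at (q + s *\<^sub>R u))"
    using assms by (simp add: frechet_derivative_works)
  have l: "((\<lambda>s. q + s *\<^sub>R u) has_derivative (\<lambda>h. h *\<^sub>R u)) (at s)"
    by (auto intro!: derivative_eq_intros)
  have "((\<lambda>s. g (q + s *\<^sub>R u)) has_derivative (\<lambda>h. ?g' (h *\<^sub>R u))) (at s)"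
    using has_derivative_compose[OF l g] .
  moreover have "?g' (h *\<^sub>R u) = ?g' u * h" for h
    using linear_cmul[OF linear_frechet_derivative[OF assms], of h u] by simp
  ultimately show ?thesis by (simp add: has_field_derivative_def)
qed

text \<open>The mean value theorem is applied along \<open>u\<close> and then along
  \<open>v\<close>. The second difference is symmetric in \<open>u\<close> and \<open>v\<close>, and
  this is what makes mixed derivatives agree.\<close>

lemma second_difference:
  assumes g: "smooth_on S g" "open S" and S: "ball p \<delta> \<subseteq> S" and t: "t > 0" "t * (norm u + norm v) < \<delta>"
  obtains z where "z \<in> ball p \<delta>"
    "g (p + t *\<^sub>R u + t *\<^sub>R v) - g (p + t *\<^sub>R u) - g (p + t *\<^sub>R v) + g p =
      t * t * frechet_derivative (\<lambda>z. frechet_derivative g (at z) u) (at z) v"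
proof -
  let ?u = "\<lambda>z. frechet_derivative g (at z) u"
  have in_ball: "p + s *\<^sub>R u + r *\<^sub>R v \<in> ball p \<delta>" if "0 \<le> s" "s \<le> t" "0 \<le> r" "r \<le> t" for s r
  proof -
    have "norm (s *\<^sub>R u + r *\<^sub>R v) \<le> s * norm u + r * norm v"
      using norm_triangle_ineq[of "s *\<^sub>R u" "r *\<^sub>R v"] that by simp
    also have "\<dots> \<le> t * norm u + t * norm v"
      using that by (intro add_mono mult_right_mono) auto
    finally have "norm (s *\<^sub>R u + r *\<^sub>R v) < \<delta>" using t(2) by (simp add: distrib_left)
    moreover have "dist p (p + s *\<^sub>R u + r *\<^sub>R v) = norm (s *\<^sub>R u + r *\<^sub>R v)"
      by (subst dist_commute) (simp add: dist_norm add.assoc)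
    ultimately show ?thesis by simp
  qed
  have dg: "g differentiable (at z)" if "z \<in> ball p \<delta>" for z
    using smooth_on_differentiable[OF g(1)] S that by blast
  have du: "?u differentiable (at z)" if "z \<in> ball p \<delta>" for z
    using smooth_on_differentiable[OF smooth_on_frechet_derivative[OF g]] S that by blast
  \<comment> \<open>The increment in direction \<open>v\<close>, as a function of the displacement
    along \<open>u\<close>.\<close>
  let ?h = "\<lambda>s. g ((p + t *\<^sub>R v) + s *\<^sub>R u) - g (p + s *\<^sub>R u)"
  let ?h' = "\<lambda>s. ?u ((p + t *\<^sub>R v) + s *\<^sub>R u) - ?u (p + s *\<^sub>R u)"
  have "\<exists>\<xi>>0. \<xi> < t \<and> ?h t - ?h 0 = (t - 0) * ?h' \<xi>"
  proof (rule MVT2[OF t(1)])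
    fix s assume "0 \<le> s" "s \<le> t"
    then show "DERIV ?h s :> ?h' s"
      using in_ball[of s t] in_ball[of s 0] t(1)
      by (intro DERIV_diff has_real_derivative_along_line dg) (simp_all add: algebra_simps)
  qed
  then obtain \<xi> where xi: "0 < \<xi>" "\<xi> < t" "?h t - ?h 0 = t * ?h' \<xi>" by auto
  let ?k = "\<lambda>r. ?u ((p + \<xi> *\<^sub>R u) + r *\<^sub>R v)"
  let ?k' = "\<lambda>r. frechet_derivative ?u (at ((p + \<xi> *\<^sub>R u) + r *\<^sub>R v)) v"
  have "\<exists>\<eta>>0. \<eta> < t \<and> ?k t - ?k 0 = (t - 0) * ?k' \<eta>"
  proof (rule MVT2[OF t(1)])
    fix r assume "0 \<le> r" "r \<le> t"
    then show "DERIV ?k r :> ?k' r"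
      using in_ball[of \<xi> r] xi by (intro has_real_derivative_along_line du) simp_all
  qed
  then obtain \<eta> where eta: "0 < \<eta>" "\<eta> < t" "?k t - ?k 0 = t * ?k' \<eta>" by auto
  have "?h' \<xi> = ?k t - ?k 0" by (simp add: algebra_simps)
  then have "?h t - ?h 0 = t * t * ?k' \<eta>" using xi eta by simp
  moreover have "?h t - ?h 0 = g (p + t *\<^sub>R u + t *\<^sub>R v) - g (p + t *\<^sub>R u) - g (p + t *\<^sub>R v) + g p"
    by (simp add: algebra_simps)
  ultimately show ?thesis
    using that[of "(p + \<xi> *\<^sub>R u) + \<eta> *\<^sub>R v"] in_ball[of \<xi> \<eta>] xi eta by simp
qed

text \<open>Both mixed derivatives attain a common value, the second difference over t^2, at two
  points close to \<open>p\<close>; by continuity they cannot differ at \<open>p\<close>.\<close>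

lemma symmetric_second_derivative:
  assumes g: "smooth_on S g" "open S" and "p \<in> S"
  shows "frechet_derivative (\<lambda>z. frechet_derivative g (at z) u) (at p) v =
    frechet_derivative (\<lambda>z. frechet_derivative g (at z) v) (at p) u" (is "?uv p = ?vu p")
proof (rule ccontr)
  assume neq: "?uv p \<noteq> ?vu p"
  define e where "e = \<bar>?uv p - ?vu p\<bar> / 2"
  have e: "e > 0" using neq by (simp add: e_def)
  have "continuous (at p) ?uv" "continuous (at p) ?vu"
    using smooth_on_differentiable[OF smooth_on_frechet_derivative[OF smooth_on_frechet_derivative[OF g] g(2)]]
      \<open>p \<in> S\<close> by (auto intro: differentiable_imp_continuous_within)
  then obtain d1 d2 where d: "d1 > 0" "\<And>z. dist z p < d1 \<Longrightarrow> dist (?uv z) (?uv p) < e"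
    "d2 > 0" "\<And>z. dist z p < d2 \<Longrightarrow> dist (?vu z) (?vu p) < e"
    unfolding continuous_at_eps_delta using e by metis
  obtain d3 where d3: "d3 > 0" "ball p d3 \<subseteq> S" using g(2) \<open>p \<in> S\<close> open_contains_ball by blast
  define \<delta> where "\<delta> = min d3 (min d1 d2)"
  have \<delta>: "\<delta> > 0" "ball p \<delta> \<subseteq> S" using d d3 by (auto simp: \<delta>_def)
  \<comment> \<open>The summand 1 keeps the quotient meaningful for \<open>u = v = 0\<close> and
    makes the bound strict.\<close>
  define t where "t = \<delta> / (norm u + norm v + 1)"
  have t: "t > 0" "t * (norm u + norm v) < \<delta>" "t * (norm v + norm u) < \<delta>"
    using \<delta> by (auto simp: t_def field_simps add_pos_nonneg intro!: divide_pos_pos)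
  obtain z where z: "z \<in> ball p \<delta>"
    "g (p + t *\<^sub>R u + t *\<^sub>R v) - g (p + t *\<^sub>R u) - g (p + t *\<^sub>R v) + g p = t * t * ?uv z"
    using second_difference[OF g \<delta>(2) t(1,2)] .
  obtain z' where z': "z' \<in> ball p \<delta>"
    "g (p + t *\<^sub>R v + t *\<^sub>R u) - g (p + t *\<^sub>R v) - g (p + t *\<^sub>R u) + g p = t * t * ?vu z'"
    using second_difference[OF g \<delta>(2) t(1,3)] .
  have "t * t * ?uv z = t * t * ?vu z'"
    using z(2) z'(2) by (simp add: algebra_simps)
  then have "?uv z = ?vu z'" using t(1) by simp
  moreover have "dist (?uv z) (?uv p) < e" "dist (?vu z') (?vu p) < e"
    using d(2)[of z] d(4)[of z'] z(1) z'(1) by (simp_all add: \<delta>_def dist_commute)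
  ultimately have "\<bar>?uv p - ?vu p\<bar> < 2 * e" by (simp add: dist_real_def)
  then show False by (simp add: e_def)
qed

lemma linear_euclidean_sum:
  fixes h :: "'e::euclidean_space \<Rightarrow> 'a::real_vector"
  assumes "linear h"
  shows "h w = (\<Sum>b\<in>Basis. (w \<bullet> b) *\<^sub>R h b)"
  by (subst (1) euclidean_representation[of w, symmetric]) (simp add: linear_sum[OF assms] linear_cmul[OF assms])

section \<open>Tangent vectors in a chart, and the Lie bracket of vector fields\<close>

definition chart_vector ::
    "('m, 'e::euclidean_space) atlas \<Rightarrow> 'm set \<Rightarrow> ('m \<Rightarrow> 'e) \<Rightarrow> 'm \<Rightarrow> 'e \<Rightarrow> ('m \<Rightarrow> real) \<Rightarrow> real" where
  "chart_vector \<A> V \<psi> x w =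
     (\<lambda>f. if f \<in> Cinf \<A> then frechet_derivative (f \<circ> inv_into V \<psi>) (at (\<psi> x)) w else 0)"

context manifold
begin

lemma chart_vector_in_tangent_space:
  "(V, \<psi>) \<in> \<A> \<Longrightarrow> x \<in> V \<Longrightarrow> chart_vector \<A> V \<psi> x w \<in> tangent_space \<A> x"
  unfolding tangent_space_def chart_vector_def by blast

lemma chart_vector_linear:
  assumes "(V, \<psi>) \<in> \<A>" "x \<in> V"
  shows "linear (chart_vector \<A> V \<psi> x)"
proof (rule linearI)
  show "chart_vector \<A> V \<psi> x (u + v) = chart_vector \<A> V \<psi> x u + chart_vector \<A> V \<psi> x v" for u v
    using linear_add[OF linear_frechet_derivative[OF Cinf_differentiable[OF assms]]]
    by (simp add: chart_vector_def fun_eq_iff)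
  show "chart_vector \<A> V \<psi> x (c *\<^sub>R v) = c *\<^sub>R chart_vector \<A> V \<psi> x v" for c v
    using linear_cmul[OF linear_frechet_derivative[OF Cinf_differentiable[OF assms]]]
    by (simp add: chart_vector_def fun_eq_iff)
qed

text \<open>By the chain rule the new direction is the derivative of the transition map applied to
  \<open>w\<close>.\<close>

lemma chart_vector_transition:
  assumes c: "(U, \<eta>) \<in> \<A>" "(V, \<psi>) \<in> \<A>" "x \<in> U" "x \<in> V"
  shows "\<exists>w'. chart_vector \<A> U \<eta> x w = chart_vector \<A> V \<psi> x w'"
proof -
  let ?\<tau> = "\<lambda>y. \<psi> (inv_into U \<eta> y)" and ?S = "\<eta> ` (U \<inter> V)"
  let ?\<tau>' = "\<lambda>v. \<Sum>b\<in>Basis. frechet_derivative (\<lambda>y. ?\<tau> y \<bullet> b) (at (\<eta> x)) v *\<^sub>R b"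
  have S: "open ?S" using chart_image_open[OF c(1) chart(1)[OF c(2)]] by (simp add: Int_commute)
  have "((\<lambda>y. ?\<tau> y \<bullet> b) has_derivative frechet_derivative (\<lambda>y. ?\<tau> y \<bullet> b) (at (\<eta> x))) (at (\<eta> x))"
    if "b \<in> Basis" for b
    using smooth_on_differentiable[OF transition_smooth[OF c(1,2) that], of "\<eta> x"] c(3,4)
    by (auto simp: frechet_derivative_works)
  then have t: "(?\<tau> has_derivative ?\<tau>') (at (\<eta> x))"
    by (subst has_derivative_componentwise_within)
       (simp add: inner_sum_left inner_Basis if_distrib cong: if_cong)
  have "chart_vector \<A> U \<eta> x w f = chart_vector \<A> V \<psi> x (?\<tau>' w) f" for f
  proof (cases "f \<in> Cinf \<A>")
    case True
    let ?F = "f \<circ> inv_into V \<psi>"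
    have tx: "?\<tau> (\<eta> x) = \<psi> x" using chart_inv(1)[OF c(1,3)] by simp
    have "(?F has_derivative frechet_derivative ?F (at (\<psi> x))) (at (?\<tau> (\<eta> x)))"
      unfolding tx by (rule Cinf_has_derivative[OF c(2,4) True])
    from has_derivative_compose[OF t this]
    have "((\<lambda>y. ?F (?\<tau> y)) has_derivative (\<lambda>v. frechet_derivative ?F (at (\<psi> x)) (?\<tau>' v))) (at (\<eta> x))" .
    then have "((f \<circ> inv_into U \<eta>) has_derivative (\<lambda>v. frechet_derivative ?F (at (\<psi> x)) (?\<tau>' v))) (at (\<eta> x))"
      by (rule has_derivative_transform_within_open[OF _ S])
         (use c chart_inv(1)[OF c(1)] chart_inv(1)[OF c(2)] in auto)
    from fun_cong[OF frechet_derivative_at[OF this], of w] True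
    show ?thesis by (simp add: chart_vector_def)
  qed (simp add: chart_vector_def)
  then show ?thesis by blast
qed

lemma tangent_space_chart:
  assumes "(V, \<psi>) \<in> \<A>" "x \<in> V"
  shows "tangent_space \<A> x = range (chart_vector \<A> V \<psi> x)"
proof
  show "tangent_space \<A> x \<subseteq> range (chart_vector \<A> V \<psi> x)"
  proof
    fix v assume "v \<in> tangent_space \<A> x"
    then obtain U \<eta> w where "(U, \<eta>) \<in> \<A>" "x \<in> U" "v = chart_vector \<A> U \<eta> x w"
      unfolding tangent_space_def chart_vector_def by blast
    then show "v \<in> range (chart_vector \<A> V \<psi> x)"
      using chart_vector_transition[OF _ assms(1) _ assms(2), of U \<eta> w] by blast
  qed
  show "range (chart_vector \<A> V \<psi> x) \<subseteq> tangent_space \<A> x"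
    using chart_vector_in_tangent_space[OF assms] by blast
qed

lemma subspace_tangent_space: "subspace (tangent_space \<A> x)"
proof -
  obtain V \<psi> where "(V, \<psi>) \<in> \<A>" "x \<in> V" by (rule chart_at)
  from tangent_space_chart[OF this] chart_vector_linear[OF this] show ?thesis
    by (simp add: linear_subspace_image)
qed

lemma tangent_outside_Cinf: "v \<in> tangent_space \<A> x \<Longrightarrow> f \<notin> Cinf \<A> \<Longrightarrow> v f = 0"
  by (auto simp: tangent_space_def)

text \<open>Where the coordinate equals \<open>k\<close> the second term drops out; at nearby points
  it is needed to recover the components of a vector field.\<close>

lemma cutoff_coordinate:
  assumes c: "(V, \<psi>) \<in> \<A>" and b: "\<beta> \<in> Cinf \<A>" "closed C" "C \<subseteq> V" "\<And>y. y \<notin> C \<Longrightarrow> \<beta> y = 0"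
  shows "(\<lambda>y. \<beta> y * (\<psi> y \<bullet> b - k)) \<in> Cinf \<A>"
    "y \<in> V \<Longrightarrow> chart_vector \<A> V \<psi> y w (\<lambda>y. \<beta> y * (\<psi> y \<bullet> b - k)) =
      \<beta> y * (w \<bullet> b) + chart_vector \<A> V \<psi> y w \<beta> * (\<psi> y \<bullet> b - k)"
proof -
  have "smooth_on (\<psi> ` V) (\<lambda>z. z \<bullet> b + (- k))"
    using Ck_on_linear[OF bounded_linear_inner_left]
    by (intro smooth_on_add chart(2)[OF c]) (auto simp: smooth_on_def)
  then have "smooth_on (\<psi> ` V) ((\<lambda>y. \<psi> y \<bullet> b - k) \<circ> inv_into V \<psi>)"
    by (rule smooth_on_cong[OF chart(2)[OF c]]) (use chart_inv[OF c] in auto)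
  then have "smooth_fun_on \<A> V (\<lambda>y. \<psi> y \<bullet> b - k)"
    by (rule smooth_fun_on_chartI[OF c chart(1)[OF c] order_refl])
  then show f: "(\<lambda>y. \<beta> y * (\<psi> y \<bullet> b - k)) \<in> Cinf \<A>"
    unfolding in_Cinf_iff by (intro smooth_fun_on_cutoff[OF b] chart(1)[OF c]) simp_all
  assume y: "y \<in> V"
  have l: "((\<lambda>z. z \<bullet> b - k) has_derivative (\<lambda>w. w \<bullet> b)) (at (\<psi> y))"
    by (auto intro!: derivative_eq_intros)
  note m = has_derivative_mult[OF Cinf_has_derivative[OF c y b(1)] l]
  have "(((\<lambda>y. \<beta> y * (\<psi> y \<bullet> b - k)) \<circ> inv_into V \<psi>) has_derivative (\<lambda>w.
      (\<beta> \<circ> inv_into V \<psi>) (\<psi> y) * (w \<bullet> b) +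
      frechet_derivative (\<beta> \<circ> inv_into V \<psi>) (at (\<psi> y)) w * (\<psi> y \<bullet> b - k))) (at (\<psi> y))"
    by (rule has_derivative_transform_within_open[OF m chart(2)[OF c]])
       (use y chart_inv[OF c] in auto)
  from fun_cong[OF frechet_derivative_at[OF this], of w]
  show "chart_vector \<A> V \<psi> y w (\<lambda>y. \<beta> y * (\<psi> y \<bullet> b - k)) =
      \<beta> y * (w \<bullet> b) + chart_vector \<A> V \<psi> y w \<beta> * (\<psi> y \<bullet> b - k)"
    using f b(1) chart_inv(1)[OF c y] by (simp add: chart_vector_def)
qed

lemma sections_TM_iff:
  "X \<in> sections (TM \<A>) \<longleftrightarrow> (\<forall>x. X x \<in> tangent_space \<A> x) \<and> (\<forall>f\<in>Cinf \<A>. (\<lambda>x. X x f) \<in> Cinf \<A>)"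
  by (simp add: TM_def)

text \<open>The composite splits into a first order part, with one direction \<open>\<kappa>\<close>
  for all \<open>f\<close>, and the Hessian of \<open>f\<close> contracted with
  \<open>\<zeta>\<close> and \<open>\<xi>\<close>. The Hessian part is symmetric in the two
  directions and hence disappears in commutators.\<close>

lemma second_order_action:
  assumes c: "(V, \<psi>) \<in> \<A>" "x \<in> V" and Y: "Y \<in> sections (TM \<A>)"
    and xi: "v = chart_vector \<A> V \<psi> x \<xi>" and zeta: "Y x = chart_vector \<A> V \<psi> x \<zeta>"
  shows "\<exists>\<kappa>. \<forall>f\<in>Cinf \<A>. v (\<lambda>y. Y y f) = frechet_derivative (f \<circ> inv_into V \<psi>) (at (\<psi> x)) \<kappa> +
    (\<Sum>b\<in>Basis. \<Sum>c\<in>Basis. (\<zeta> \<bullet> b) * (\<xi> \<bullet> c) *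
      frechet_derivative (\<lambda>z. frechet_derivative (f \<circ> inv_into V \<psi>) (at z) b) (at (\<psi> x)) c)"
proof -
  obtain \<beta> C where b: "\<beta> \<in> Cinf \<A>" "\<beta> x = 1" "closed C" "C \<subseteq> V" "\<And>y. y \<notin> C \<Longrightarrow> \<beta> y = 0"
    using bump[OF chart(1)[OF c(1)] c(2)] by metis
  let ?i = "inv_into V \<psi>"
  define u where "u b = (\<lambda>y. \<beta> y * (\<psi> y \<bullet> b - \<psi> x \<bullet> b))" for b
  have u: "u b \<in> Cinf \<A>" for b
    unfolding u_def by (rule cutoff_coordinate[OF c(1) b(1,3,4,5)])
  \<comment> \<open>If w_b is a component of \<open>Y\<close> in the chart, then \<open>Y\<close>
    sends \<open>u b\<close> to \<beta> w_b + (u_b / \<beta>) Y(\<beta>). Solving for w_b expresses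
    the component through globally smooth functions.\<close>
  define q where "q b = (\<lambda>y. inverse (\<beta> y * \<beta> y) * (\<beta> y * Y y (u b) - u b y * Y y \<beta>))" for b
  let ?M = "V \<inter> {y. \<beta> y \<noteq> 0}"
  have M: "open ?M" using chart(1)[OF c(1)] Cinf_nonzero_open[OF b(1)] by blast
  have Yf: "(\<lambda>y. Y y f) \<in> Cinf \<A>" if "f \<in> Cinf \<A>" for f using Y that by (simp add: sections_TM_iff)
  have q_smooth: "smooth_on (\<psi> ` ?M) (q b \<circ> ?i)" for b
  proof -
    have "smooth_fun_on \<A> ?M (q b)"
      unfolding q_def
      by (intro smooth_fun_on_mult smooth_fun_on_inverse M Cinf_smooth_fun_on Cinf_intros Yf u b(1)) auto
    then have "smooth_on (\<psi> ` (?M \<inter> V)) (q b \<circ> ?i)"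
      using c(1) unfolding smooth_fun_on_def by blast
    moreover have "?M \<inter> V = ?M" by blast
    ultimately show ?thesis by simp
  qed
  have q: "q b y = w \<bullet> b" if "y \<in> ?M" "Y y = chart_vector \<A> V \<psi> y w" for y w b
  proof -
    have 1: "chart_vector \<A> V \<psi> y w (u b) =
        \<beta> y * (w \<bullet> b) + chart_vector \<A> V \<psi> y w \<beta> * (\<psi> y \<bullet> b - \<psi> x \<bullet> b)"
      unfolding u_def using that by (intro cutoff_coordinate(2)[OF c(1) b(1,3,4,5)]) auto
    have 2: "u b y = \<beta> y * (\<psi> y \<bullet> b - \<psi> x \<bullet> b)" by (simp only: u_def)
    show ?thesis
      using that(1) unfolding q_def that(2) 1 2 by (simp add: field_simps)
  qed
  have x: "x \<in> ?M" using c b by simp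
  have N: "open (\<psi> ` ?M)" "\<psi> x \<in> \<psi> ` ?M"
    using chart_image_open[OF c(1) M] x by (auto simp: Int_commute Int_left_commute)
  \<comment> \<open>The derivative along \<open>\<xi>\<close> of the components of \<open>Y\<close>,
    the origin of the first order part.\<close>
  define \<kappa> where "\<kappa> = (\<Sum>b\<in>Basis. frechet_derivative (q b \<circ> ?i) (at (\<psi> x)) \<xi> *\<^sub>R b)"
  show ?thesis
  proof (intro exI ballI)
    fix f assume f: "f \<in> Cinf \<A>"
    let ?F = "f \<circ> ?i"
    have F: "smooth_on (\<psi> ` V) ?F" using f c(1) by (auto simp: in_Cinf_iff smooth_fun_on_def)
    have dF: "?F differentiable (at (\<psi> y))" if "y \<in> V" for y
      by (rule Cinf_differentiable[OF c(1) that f])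
    have F1: "(\<lambda>z. frechet_derivative ?F (at z) b) differentiable (at (\<psi> x))" for b
      using smooth_on_differentiable[OF smooth_on_frechet_derivative[OF F chart(2)[OF c(1)]]] c(2) by blast
    have eq: "(\<Sum>b\<in>Basis. (q b \<circ> ?i) z * frechet_derivative ?F (at z) b) = ((\<lambda>y. Y y f) \<circ> ?i) z"
      if z: "z \<in> \<psi> ` ?M" for z
    proof -
      obtain y where y: "y \<in> ?M" "z = \<psi> y" using z by blast
      have "Y y \<in> tangent_space \<A> y" using Y by (simp add: sections_TM_iff)
      then obtain w where w: "Y y = chart_vector \<A> V \<psi> y w"
        using tangent_space_chart[OF c(1), of y] y(1) by blast
      have "frechet_derivative ?F (at (\<psi> y)) w = (\<Sum>b\<in>Basis. (w \<bullet> b) *\<^sub>R frechet_derivative ?F (at (\<psi> y)) b)"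
        using y(1) by (intro linear_euclidean_sum linear_frechet_derivative dF) blast
      then show ?thesis
        using y w f q[OF y(1) w] chart_inv(1)[OF c(1), of y] by (simp add: chart_vector_def)
    qed
    have q': "((q b \<circ> ?i) has_derivative frechet_derivative (q b \<circ> ?i) (at (\<psi> x))) (at (\<psi> x))" for b
      using smooth_on_differentiable[OF q_smooth N(2)] by (simp add: frechet_derivative_works)
    have F1': "((\<lambda>z. frechet_derivative ?F (at z) b) has_derivative
        frechet_derivative (\<lambda>z. frechet_derivative ?F (at z) b) (at (\<psi> x))) (at (\<psi> x))" for b
      using F1 by (simp add: frechet_derivative_works)
    have "((\<lambda>z. \<Sum>b\<in>Basis. (q b \<circ> ?i) z * frechet_derivative ?F (at z) b) has_derivative (\<lambda>v.
        \<Sum>b\<in>Basis. (q b \<circ> ?i) (\<psi> x) * frechet_derivative (\<lambda>z. frechet_derivative ?F (at z) b) (at (\<psi> x)) v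
          + frechet_derivative (q b \<circ> ?i) (at (\<psi> x)) v * frechet_derivative ?F (at (\<psi> x)) b)) (at (\<psi> x))"
      by (intro has_derivative_sum has_derivative_mult q' F1')
    then have D: "(((\<lambda>y. Y y f) \<circ> ?i) has_derivative (\<lambda>v.
        \<Sum>b\<in>Basis. (q b \<circ> ?i) (\<psi> x) * frechet_derivative (\<lambda>z. frechet_derivative ?F (at z) b) (at (\<psi> x)) v
          + frechet_derivative (q b \<circ> ?i) (at (\<psi> x)) v * frechet_derivative ?F (at (\<psi> x)) b)) (at (\<psi> x))"
      by (rule has_derivative_transform_within_open[OF _ N]) (rule eq)
    have qx: "(q b \<circ> ?i) (\<psi> x) = \<zeta> \<bullet> b" for b
      using q[OF x zeta] chart_inv(1)[OF c] by simp
    have "v (\<lambda>y. Y y f) = (\<Sum>b\<in>Basis.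
        (\<zeta> \<bullet> b) * frechet_derivative (\<lambda>z. frechet_derivative ?F (at z) b) (at (\<psi> x)) \<xi>
          + frechet_derivative (q b \<circ> ?i) (at (\<psi> x)) \<xi> * frechet_derivative ?F (at (\<psi> x)) b)"
      using fun_cong[OF frechet_derivative_at[OF D], of \<xi>] Yf[OF f] unfolding qx
      by (simp add: xi chart_vector_def)
    also have "\<dots> = (\<Sum>b\<in>Basis. \<Sum>c\<in>Basis. (\<zeta> \<bullet> b) * (\<xi> \<bullet> c) *
          frechet_derivative (\<lambda>z. frechet_derivative ?F (at z) b) (at (\<psi> x)) c) +
        (\<Sum>b\<in>Basis. frechet_derivative (q b \<circ> ?i) (at (\<psi> x)) \<xi> * frechet_derivative ?F (at (\<psi> x)) b)"
      unfolding sum.distrib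
      by (subst linear_euclidean_sum[OF linear_frechet_derivative[OF F1], of _ \<xi>])
         (simp add: sum_distrib_left mult.assoc)
    also have "(\<Sum>b\<in>Basis. frechet_derivative (q b \<circ> ?i) (at (\<psi> x)) \<xi> * frechet_derivative ?F (at (\<psi> x)) b) =
        frechet_derivative ?F (at (\<psi> x)) \<kappa>"
      using linear_frechet_derivative[OF dF[OF c(2)]]
      by (simp add: \<kappa>_def linear_sum linear_cmul)
    finally show "v (\<lambda>y. Y y f) = frechet_derivative ?F (at (\<psi> x)) \<kappa> +
        (\<Sum>b\<in>Basis. \<Sum>c\<in>Basis. (\<zeta> \<bullet> b) * (\<xi> \<bullet> c) *
          frechet_derivative (\<lambda>z. frechet_derivative ?F (at z) b) (at (\<psi> x)) c)"
      by (simp only: add.commute)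
  qed
qed

text \<open>A tangent vector is by definition a directional derivative in a chart, not merely a
  derivation, so the commutator has to be brought into this form. The Hessians cancel, and the
  direction is the difference of the two first order parts.\<close>

lemma lie_bracket_section:
  assumes X: "X \<in> sections (TM \<A>)" and Y: "Y \<in> sections (TM \<A>)"
  shows "lie_bracket X Y \<in> sections (TM \<A>)"
  unfolding sections_TM_iff
proof (intro conjI allI ballI)
  have Xf: "(\<lambda>y. X y f) \<in> Cinf \<A>" "(\<lambda>y. Y y f) \<in> Cinf \<A>" if "f \<in> Cinf \<A>" for f
    using X Y that by (auto simp: sections_TM_iff)
  show "(\<lambda>x. lie_bracket X Y x f) \<in> Cinf \<A>" if "f \<in> Cinf \<A>" for f
  proof -
    have "(\<lambda>x. X x (\<lambda>y. Y y f)) \<in> Cinf \<A>" "(\<lambda>x. Y x (\<lambda>y. X y f)) \<in> Cinf \<A>"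
      using X Y Xf[OF that] unfolding sections_TM_iff by blast+
    then show ?thesis unfolding lie_bracket_def by (rule Cinf_diff)
  qed
  fix x
  obtain V \<psi> where c: "(V, \<psi>) \<in> \<A>" "x \<in> V" by (rule chart_at)
  have t: "X x \<in> tangent_space \<A> x" "Y x \<in> tangent_space \<A> x" using X Y by (auto simp: sections_TM_iff)
  then obtain \<xi> \<zeta> where xi: "X x = chart_vector \<A> V \<psi> x \<xi>" and zeta: "Y x = chart_vector \<A> V \<psi> x \<zeta>"
    unfolding tangent_space_chart[OF c] by blast
  let ?D = "\<lambda>f. frechet_derivative (f \<circ> inv_into V \<psi>) (at (\<psi> x))"
  let ?H = "\<lambda>f b. frechet_derivative (\<lambda>z. frechet_derivative (f \<circ> inv_into V \<psi>) (at z) b) (at (\<psi> x))"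
  obtain \<kappa> where k: "\<And>f. f \<in> Cinf \<A> \<Longrightarrow> X x (\<lambda>y. Y y f) = ?D f \<kappa> +
      (\<Sum>b\<in>Basis. \<Sum>c\<in>Basis. (\<zeta> \<bullet> b) * (\<xi> \<bullet> c) * ?H f b c)"
    using second_order_action[OF c Y xi zeta] by blast
  obtain \<kappa>' where k': "\<And>f. f \<in> Cinf \<A> \<Longrightarrow> Y x (\<lambda>y. X y f) = ?D f \<kappa>' +
      (\<Sum>b\<in>Basis. \<Sum>c\<in>Basis. (\<xi> \<bullet> b) * (\<zeta> \<bullet> c) * ?H f b c)"
    using second_order_action[OF c X zeta xi] by blast
  have "lie_bracket X Y x f = chart_vector \<A> V \<psi> x (\<kappa> - \<kappa>') f" for f
  proof (cases "f \<in> Cinf \<A>")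
    case True
    have F: "smooth_on (\<psi> ` V) (f \<circ> inv_into V \<psi>)"
      using True c(1) by (auto simp: in_Cinf_iff smooth_fun_on_def)
    have "(\<Sum>b\<in>Basis. \<Sum>c\<in>Basis. (\<xi> \<bullet> b) * (\<zeta> \<bullet> c) * ?H f b c) =
        (\<Sum>c\<in>Basis. \<Sum>b\<in>Basis. (\<xi> \<bullet> b) * (\<zeta> \<bullet> c) * ?H f b c)" by (rule sum.swap)
    also have "\<dots> = (\<Sum>b\<in>Basis. \<Sum>c\<in>Basis. (\<zeta> \<bullet> b) * (\<xi> \<bullet> c) * ?H f b c)"
    proof (intro sum.cong refl)
      fix b c' :: 'e
      show "\<xi> \<bullet> c' * (\<zeta> \<bullet> b) * ?H f c' b = \<zeta> \<bullet> b * (\<xi> \<bullet> c') * ?H f b c'"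
        using symmetric_second_derivative[OF F chart(2)[OF c(1)], of "\<psi> x" b c'] c(2) by simp
    qed
    finally show ?thesis
      using k[OF True] k'[OF True] True
        linear_diff[OF linear_frechet_derivative[OF Cinf_differentiable[OF c True]]]
      by (simp add: lie_bracket_def chart_vector_def)
  next
    \<comment> \<open>Tangent vectors send functions that are not smooth to 0, so the commutator has
      to do so as well.\<close>
    case False
    have "X y f = 0" "Y y f = 0" for y
      using False X Y by (auto simp: sections_TM_iff intro: tangent_outside_Cinf)
    then show ?thesis
      using False tangent_const[OF t(1), of 0] tangent_const[OF t(2), of 0]
      by (simp add: lie_bracket_def chart_vector_def)
  qed
  then have "lie_bracket X Y x = chart_vector \<A> V \<psi> x (\<kappa> - \<kappa>')" by blast
  then show "lie_bracket X Y x \<in> tangent_space \<A> x"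
    using chart_vector_in_tangent_space[OF c] by simp
qed

end

section \<open>One-jets of functions as covectors of TM x R\<close>

definition jet :: "('m, 'e::euclidean_space) atlas \<Rightarrow> ('m \<Rightarrow> real) \<Rightarrow> 'm \<Rightarrow> (('m \<Rightarrow> real) \<Rightarrow> real) \<times> real \<Rightarrow> real" where
  "jet \<A> f x w = (if w \<in> fibre (TMR \<A>) x then fst w f + snd w * f x else 0)"

lemma fibre_TMR [simp]: "fibre (TMR \<A>) = (\<lambda>x. tangent_space \<A> x \<times> UNIV)"
  by (simp add: TMR_def)

context manifold
begin

lemma jet_in_dual_space: "jet \<A> f x \<in> dual_space (fibre (TMR \<A>) x)"
  using subspace_tangent_space[of x]
  by (auto simp: dual_space_def jet_def subspace_add subspace_scale algebra_simps)

lemma covector_is_jet: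
  assumes \<gamma>: "\<gamma> \<in> dual_space (fibre (TMR \<A>) x)"
  obtains f where "f \<in> Cinf \<A>" "jet \<A> f x = \<gamma>"
proof -
  obtain V \<psi> where c: "(V, \<psi>) \<in> \<A>" "x \<in> V" by (rule chart_at)
  obtain \<beta> C where b: "\<beta> \<in> Cinf \<A>" "\<beta> x = 1" "closed C" "C \<subseteq> V" "\<And>y. y \<notin> C \<Longrightarrow> \<beta> y = 0"
    using bump[OF chart(1)[OF c(1)] c(2)] by metis
  define u where "u b = (\<lambda>y. \<beta> y * (\<psi> y \<bullet> b - \<psi> x \<bullet> b))" for b
  have u: "u b \<in> Cinf \<A>" for b
    unfolding u_def by (rule cutoff_coordinate[OF c(1) b(1,3,4,5)])
  have du: "chart_vector \<A> V \<psi> x w (u b) = w \<bullet> b" for w b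
    unfolding u_def using cutoff_coordinate(2)[OF c(1) b(1,3,4,5) c(2)] b(2) by simp
  let ?t = "chart_vector \<A> V \<psi> x"
  note tl = chart_vector_linear[OF c] and tt = chart_vector_in_tangent_space[OF c]
  have fib: "(?t w, s) \<in> fibre (TMR \<A>) x" for w s using tt by simp
  let ?h = "\<lambda>w. \<gamma> (?t w, 0)"
  have h: "linear ?h"
  proof (rule linearI)
    show "?h (w + w') = ?h w + ?h w'" for w w'
      using dual_spaceD(1)[OF \<gamma> fib[of w 0] fib[of w' 0]] by (simp add: linear_add[OF tl])
    show "?h (r *\<^sub>R w) = r *\<^sub>R ?h w" for r w
      using dual_spaceD(2)[OF \<gamma> fib[of w 0], of r] by (simp add: linear_cmul[OF tl])
  qed
  \<comment> \<open>An affine function of the cut-off coordinates: its value at \<open>x\<close> is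
    \<gamma> on (0, 1), its partial derivatives are \<gamma> on the coordinate vectors.
    \<open>?t 0\<close> is the zero tangent vector.\<close>
  define f where "f = (\<lambda>y. \<gamma> (?t 0, 1) + (\<Sum>b\<in>Basis. ?h b * u b y))"
  have f: "f \<in> Cinf \<A>" unfolding f_def by (intro Cinf_intros u)
  have "jet \<A> f x w = \<gamma> w" for w
  proof (cases "w \<in> fibre (TMR \<A>) x")
    case True
    then obtain v s where w: "w = (?t v, s)"
      using tangent_space_chart[OF c] by (cases w) auto
    have t0: "?t 0 = 0" using linear_0[OF tl] .
    have "\<gamma> (?t v, s) = \<gamma> ((?t v, 0) + s *\<^sub>R (?t 0, 1))" by (simp add: t0)
    also have "\<dots> = \<gamma> (?t v, 0) + s * \<gamma> (?t 0, 1)"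
      using dual_spaceD(1)[OF \<gamma> fib[of v 0], of "s *\<^sub>R (?t 0, 1)"] dual_spaceD(2)[OF \<gamma> fib[of 0 1], of s]
        fib[of 0 s] t0 by simp
    also have "\<gamma> (?t v, 0) = (\<Sum>b\<in>Basis. (v \<bullet> b) *\<^sub>R ?h b)" by (rule linear_euclidean_sum[OF h])
    finally have g: "\<gamma> w = (\<Sum>b\<in>Basis. (v \<bullet> b) * ?h b) + s * \<gamma> (?t 0, 1)"
      by (simp add: w)
    have "?t v f = (\<Sum>b\<in>Basis. ?h b * ?t v (u b))"
    proof -
      have "?t v f = ?t v (\<lambda>y. \<gamma> (?t 0, 1)) + ?t v (\<lambda>y. \<Sum>b\<in>Basis. ?h b * u b y)"
        unfolding f_def by (intro tangent_add[OF tt] Cinf_intros u)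
      also have "?t v (\<lambda>y. \<Sum>b\<in>Basis. ?h b * u b y) = (\<Sum>b\<in>Basis. ?t v (\<lambda>y. ?h b * u b y))"
        by (intro tangent_sum[OF tt] Cinf_intros u)
      finally show ?thesis by (simp only: tangent_const[OF tt] tangent_cmult[OF tt u] add_0)
    qed
    moreover have "f x = \<gamma> (?t 0, 1)" by (simp add: f_def u_def)
    ultimately show ?thesis using True g by (simp add: jet_def w du mult.commute)
  next
    case False
    then show ?thesis using dual_spaceD(3)[OF \<gamma>] by (simp add: jet_def)
  qed
  with f that show ?thesis by blast
qed

end

section \<open>Wedge products and Schouten brackets\<close>

context manifold
begin

lemma zero_in_forms: "0 \<in> forms \<A> B k"
  by (auto simp: forms_def alt_forms_def eval_form_def)

lemma forms_add:
  assumes "w \<in> forms \<A> B k" "w' \<in> forms \<A> B k"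
  shows "w + w' \<in> forms \<A> B k"
proof -
  have "(\<lambda>vs. w x vs + w' x vs) \<in> alt_forms (fibre B x) k" for x
    using forms_alt[OF assms(1), of x] forms_alt[OF assms(2), of x]
    by (auto simp: alt_forms_def algebra_simps)
  moreover have "(\<lambda>x. eval_form w Xs x + eval_form w' Xs x) \<in> Cinf \<A>"
    if "length Xs = k" "set Xs \<subseteq> sections B" for Xs
    using assms that by (intro Cinf_add forms_eval)
  ultimately show ?thesis by (simp add: forms_def eval_form_def plus_fun_def)
qed

lemma forms_mult:
  assumes "f \<in> Cinf \<A>" "w \<in> forms \<A> B k"
  shows "(\<lambda>x vs. f x * w x vs) \<in> forms \<A> B k"
proof -
  have "(\<lambda>vs. f x * w x vs) \<in> alt_forms (fibre B x) k" for x
    using forms_alt[OF assms(2), of x] by (auto simp: alt_forms_def algebra_simps)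
  moreover have "(\<lambda>x. f x * eval_form w Xs x) \<in> Cinf \<A>"
    if "length Xs = k" "set Xs \<subseteq> sections B" for Xs
    using assms that by (intro Cinf_mult forms_eval)
  ultimately show ?thesis by (simp add: forms_def eval_form_def)
qed

lemma forms_scaleR: "w \<in> forms \<A> B k \<Longrightarrow> c *\<^sub>R w \<in> forms \<A> B k"
  using forms_mult[OF Cinf_const, of w B k c] by (simp add: scaleR_fun_def)

lemma forms_sum: "(\<And>i. i \<in> I \<Longrightarrow> w i \<in> forms \<A> B k) \<Longrightarrow> (\<Sum>i\<in>I. w i) \<in> forms \<A> B k"
  by (induction I rule: infinite_finite_induct) (auto intro: forms_add zero_in_forms)

end

section \<open>Wedge products in low degrees\<close>

lemma sum_permutes_2:
  fixes F :: "nat \<Rightarrow> nat \<Rightarrow> real"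
  shows "(\<Sum>\<sigma> | \<sigma> permutes {..<2}. of_int (sign \<sigma>) * F (\<sigma> 0) (\<sigma> 1)) = F 0 1 - F 1 0"
proof -
  have "{..<2} = insert 1 {0::nat}" by auto
  then show ?thesis
    by (simp add: sum_over_permutations_insert sign_swap_id transpose_def)
qed

lemma sum_permutes_3:
  fixes F :: "nat \<Rightarrow> nat \<Rightarrow> nat \<Rightarrow> real"
  shows "(\<Sum>\<sigma> | \<sigma> permutes {..<3}. of_int (sign \<sigma>) * F (\<sigma> 0) (\<sigma> 1) (\<sigma> 2)) =
    F 0 1 2 - F 1 0 2 - F 0 2 1 + F 2 0 1 + F 1 2 0 - F 2 1 0"
proof -
  have s: "{..<3} = insert 2 (insert 1 {0::nat})" by auto
  show ?thesis
    unfolding s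
    by (simp add: sum_over_permutations_insert sign_swap_id sign_compose permutation_swap_id
        transpose_def[of 2] transpose_def[of 1] )
qed

lemma wedge_1_1:
  "wedge 1 1 P Q x vs =
     (if length vs = 2 then P x [vs ! 0] * Q x [vs ! 1] - P x [vs ! 1] * Q x [vs ! 0] else 0)"
  using sum_permutes_2[of "\<lambda>i j. P x [vs ! i] * Q x [vs ! j]"]
  by (simp add: wedge_def numeral_2_eq_2 mult.assoc)

lemma wedge_0_0: "wedge 0 0 (form0 f) (form0 g) = form0 (\<lambda>x. f x * g x)"
proof -
  have "{\<sigma>. \<sigma> permutes {..<0 + 0::nat}} = {id}" by simp
  then show ?thesis
    unfolding wedge_def by (auto simp: form0_def fun_eq_iff split: list.split)
qed

lemma wedge_1_0: "wedge 1 0 P (form0 f) x [v] = P x [v] * f x"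
proof -
  have "{..<Suc 0} = {0}" by auto
  then show ?thesis by (simp add: wedge_def form0_def)
qed

text \<open>The factors are not assumed to be alternating, so every order of the arguments remains
  and the division by \<open>fact 2\<close> stays visible. The same applies to the degrees (2, 1)
  and (1, 2) below.\<close>

lemma wedge_0_2: "wedge 0 2 (form0 f) Q x [u, v] = f x * (Q x [u, v] - Q x [v, u]) / 2"
  using sum_permutes_2[of "\<lambda>i j. f x * Q x [[u, v] ! i, [u, v] ! j]"]
  by (simp add: wedge_def form0_def numeral_2_eq_2 mult.assoc algebra_simps)

lemma wedge_2_1:
  "wedge 2 1 P Q x [u, v, w] = (P x [u, v] * Q x [w] - P x [v, u] * Q x [w] - P x [u, w] * Q x [v] +
     P x [w, u] * Q x [v] + P x [v, w] * Q x [u] - P x [w, v] * Q x [u]) / 2"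
  using sum_permutes_3[of "\<lambda>i j k. P x [[u, v, w] ! i, [u, v, w] ! j] * Q x [[u, v, w] ! k]"]
  by (simp add: wedge_def numeral_2_eq_2 numeral_3_eq_3 mult.assoc upt_rec)

lemma wedge_1_2:
  "wedge 1 2 P Q x [u, v, w] = (P x [u] * Q x [v, w] - P x [v] * Q x [u, w] - P x [u] * Q x [w, v] +
     P x [w] * Q x [u, v] + P x [v] * Q x [w, u] - P x [w] * Q x [v, u]) / 2"
  using sum_permutes_3[of "\<lambda>i j k. P x [[u, v, w] ! i] * Q x [[u, v, w] ! j, [u, v, w] ! k]"]
  by (simp add: wedge_def numeral_2_eq_2 numeral_3_eq_3 mult.assoc upt_rec)

lemma wedge_length: "length vs \<noteq> p + q \<Longrightarrow> wedge p q P Q x vs = 0"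
  by (simp add: wedge_def)

lemma wedge_vanish_left: "P x = (\<lambda>_. 0) \<Longrightarrow> wedge p q P Q x vs = 0"
  and wedge_vanish_right: "Q x = (\<lambda>_. 0) \<Longrightarrow> wedge p q P Q x vs = 0"
  by (auto simp: wedge_def)

lemma form0_zero_at: "f x = 0 \<Longrightarrow> form0 f x = (\<lambda>_. 0)"
  by (auto simp: form0_def fun_eq_iff split: list.split)

lemma wedge_minus_left: "wedge p q (- P) Q = - wedge p q P Q"
  by (simp add: wedge_def fun_eq_iff sum_negf)

lemma wedge_minus_right: "wedge p q P (- Q) = - wedge p q P Q"
  by (simp add: wedge_def fun_eq_iff sum_negf)

lemma (in manifold) wedge_1_1_in_forms:
  assumes "\<And>x. subspace (fibre B x)" "P \<in> forms \<A> B 1" "Q \<in> forms \<A> B 1"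
  shows "wedge 1 1 P Q \<in> forms \<A> B 2"
proof -
  have out: "R x [v] = 0" if "R \<in> forms \<A> B 1" "v \<notin> fibre B x" for R x v
    using alt_formsD(1)[OF forms_alt[OF that(1)], of "[v]" x] that(2) by simp
  have add: "R x [u + v] = R x [u] + R x [v]"
    if "R \<in> forms \<A> B 1" "u \<in> fibre B x" "v \<in> fibre B x" for R x u v
    using alt_formsD(2)[OF forms_alt[OF that(1)] that(2,3), of "[]" "[]"] by simp
  have scale: "R x [c *\<^sub>R v] = c * R x [v]" if "R \<in> forms \<A> B 1" "v \<in> fibre B x" for R x c v
    using alt_formsD(3)[OF forms_alt[OF that(1)] that(2), of "[]" "[]"] by simp
  have "wedge 1 1 P Q x = (\<lambda>vs. if length vs = 2 \<and> set vs \<subseteq> fibre B x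
      then P x [vs ! 0] * Q x [vs ! 1] - P x [vs ! 1] * Q x [vs ! 0] else 0)" for x
  proof
    fix vs
    show "wedge 1 1 P Q x vs = (if length vs = 2 \<and> set vs \<subseteq> fibre B x
      then P x [vs ! 0] * Q x [vs ! 1] - P x [vs ! 1] * Q x [vs ! 0] else 0)"
    proof (cases "length vs = 2")
      case True
      then obtain u v where "vs = [u, v]" by (auto simp: numeral_2_eq_2 length_Suc_conv)
      then show ?thesis
        using out[OF assms(2), of _ x] out[OF assms(3), of _ x] by (auto simp: wedge_1_1[unfolded One_nat_def])
    qed (simp add: wedge_length)
  qed
  note eq = this
  have "wedge 1 1 P Q x \<in> alt_forms (fibre B x) 2" for x
    unfolding eq
    by (rule bilinear_alt_forms[where b = "\<lambda>u v. P x [u] * Q x [v] - P x [v] * Q x [u]"])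
       (use assms(1) in \<open>simp_all add: add[OF assms(2)] add[OF assms(3)] scale[OF assms(2)]
          scale[OF assms(3)] algebra_simps\<close>)
  moreover have "eval_form (wedge 1 1 P Q) Xs \<in> Cinf \<A>"
    if l: "length Xs = 2" and "set Xs \<subseteq> sections B" for Xs
  proof -
    obtain X Y where X: "Xs = [X, Y]" using l by (auto simp: numeral_2_eq_2 length_Suc_conv)
    have "(\<lambda>x. R x [Z x]) \<in> Cinf \<A>" if "R \<in> forms \<A> B 1" "Z \<in> sections B" for R Z
      using forms_eval[OF that(1), of "[Z]"] that(2) by (simp add: eval_form_def)
    then show ?thesis
      using that(2) assms(2,3) unfolding X by (simp add: eval_form_def wedge_1_1[unfolded One_nat_def] Cinf_diff Cinf_mult)
  qed
  ultimately show ?thesis by (simp add: forms_def)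
qed

text \<open>For alternating \<open>Q\<close> the two orders differ by a sign, which absorbs the 1/2.
  Through this lemma the Leibniz rule of a Schouten bracket applies to multiples by
  functions.\<close>

lemma wedge_0_2_mult:
  assumes "\<And>x. subspace (fibre B x)" "Q \<in> forms \<A> B 2"
  shows "wedge 0 2 (form0 f) Q = (\<lambda>x vs. f x * Q x vs)"
proof (intro ext)
  fix x vs
  note Q = forms_alt[OF assms(2), of x]
  show "wedge 0 2 (form0 f) Q x vs = f x * Q x vs"
  proof (cases "length vs = 2")
    case True
    then obtain u v where vs: "vs = [u, v]" by (auto simp: numeral_2_eq_2 length_Suc_conv)
    have "Q x [u, v] = - Q x [v, u]"
    proof (cases "u \<in> fibre B x \<and> v \<in> fibre B x")
      case True
      then show ?thesis using alt_forms_swap[OF Q assms(1), of u v "[]" "[]"] by simp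
    next
      case False
      then show ?thesis using alt_formsD(1)[OF Q, of "[u, v]"] alt_formsD(1)[OF Q, of "[v, u]"] by auto
    qed
    then show ?thesis unfolding vs wedge_0_2 by simp
  next
    case False
    then show ?thesis using alt_formsD(1)[OF Q, of vs] by (simp add: wedge_length)
  qed
qed

section \<open>The defining rules of a Schouten bracket, one by one\<close>

context
  fixes \<A> :: "('m::{t2_space, second_countable_topology}, 'e::euclidean_space) atlas"
    and B :: "('m, 'v::real_vector) vbundle" and a br S
  assumes S: "schouten_bracket \<A> B a br S"
begin

private lemma S': "(\<forall>p q. \<forall>P\<in>multisections \<A> B p. \<forall>Q\<in>multisections \<A> B q.
       S p P q Q \<in> multisections \<A> B (p + q - 1) \<and>
       S p P q Q = - ((-1) ^ ((p + 1) * (q + 1)) *\<^sub>R S q Q p P) \<and>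
       (\<forall>Q'\<in>multisections \<A> B q. S p P q (Q + Q') = S p P q Q + S p P q Q') \<and>
       (\<forall>c. S p P q (c *\<^sub>R Q) = c *\<^sub>R S p P q Q) \<and>
       (\<forall>r. \<forall>R\<in>multisections \<A> B r.
         S p P (q + r) (wedge q r Q R) =
           wedge (p + q - 1) r (S p P q Q) R +
           (-1) ^ ((p + 1) * q) *\<^sub>R wedge q (p + r - 1) Q (S p P r R)))"
  using S unfolding schouten_bracket_def by (rule conjunct1)

lemma schouten_closed:
  "P \<in> multisections \<A> B p \<Longrightarrow> Q \<in> multisections \<A> B q \<Longrightarrow> S p P q Q \<in> multisections \<A> B (p + q - 1)"
  using S' by blast

lemma schouten_sym:
  "P \<in> multisections \<A> B p \<Longrightarrow> Q \<in> multisections \<A> B q \<Longrightarrow>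
     S p P q Q = - ((-1) ^ ((p + 1) * (q + 1)) *\<^sub>R S q Q p P)"
  using S' by blast

lemma schouten_add:
  "P \<in> multisections \<A> B p \<Longrightarrow> Q \<in> multisections \<A> B q \<Longrightarrow> Q' \<in> multisections \<A> B q \<Longrightarrow>
     S p P q (Q + Q') = S p P q Q + S p P q Q'"
  using S' by blast

lemma schouten_scaleR:
  "P \<in> multisections \<A> B p \<Longrightarrow> Q \<in> multisections \<A> B q \<Longrightarrow> S p P q (c *\<^sub>R Q) = c *\<^sub>R S p P q Q"
  using S' by blast

lemma schouten_wedge:
  "P \<in> multisections \<A> B p \<Longrightarrow> Q \<in> multisections \<A> B q \<Longrightarrow> R \<in> multisections \<A> B r \<Longrightarrow>
     S p P (q + r) (wedge q r Q R) = wedge (p + q - 1) r (S p P q Q) R +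
       (-1) ^ ((p + 1) * q) *\<^sub>R wedge q (p + r - 1) Q (S p P r R)"
  using S' by blast

lemma schouten_functions: "f \<in> Cinf \<A> \<Longrightarrow> g \<in> Cinf \<A> \<Longrightarrow> S 0 (form0 f) 0 (form0 g) = 0"
  using S unfolding schouten_bracket_def by blast

lemma schouten_section_function:
  "X \<in> sections B \<Longrightarrow> f \<in> Cinf \<A> \<Longrightarrow> S 1 (vec1 B X) 0 (form0 f) = form0 (act a X f)"
  using S unfolding schouten_bracket_def by blast

lemma schouten_sections:
  "X \<in> sections B \<Longrightarrow> Y \<in> sections B \<Longrightarrow> S 1 (vec1 B X) 1 (vec1 B Y) = vec1 B (br X Y)"
  using S unfolding schouten_bracket_def by blast

lemma schouten_sum:
  assumes "manifold \<A>" "P \<in> multisections \<A> B p" "\<And>i. i \<in> I \<Longrightarrow> Q i \<in> multisections \<A> B q"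
    "finite I"
  shows "S p P q (\<Sum>i\<in>I. Q i) = (\<Sum>i\<in>I. S p P q (Q i))"
  using assms(4,3)
proof (induction I rule: finite_induct)
  case empty
  have "0 \<in> multisections \<A> B q"
    by (rule manifold.zero_in_forms[OF assms(1)])
  from schouten_scaleR[OF assms(2) this, of 0] show ?case by (simp only: sum.empty scaleR_zero_left)
next
  case (insert i I)
  have "(\<Sum>i\<in>I. Q i) \<in> multisections \<A> B q"
    using insert.prems by (intro manifold.forms_sum[OF assms(1)]) simp
  with insert.prems have "S p P q (Q i + (\<Sum>i\<in>I. Q i)) = S p P q (Q i) + S p P q (\<Sum>i\<in>I. Q i)"
    by (intro schouten_add assms(2)) auto
  moreover have "S p P q (\<Sum>i\<in>I. Q i) = (\<Sum>i\<in>I. S p P q (Q i))"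
    using insert.prems by (intro insert.IH) auto
  ultimately show ?case by (simp only: sum.insert[OF insert.hyps])
qed

end

section \<open>The Schouten bracket of $TM \times \mathbb{R}$ on one-jets\<close>

text \<open>The pairing of a section with the jet of \<open>f\<close>: sections of TM x R act on
  functions as first order operators, with second component the value on 1.\<close>

definition first_order :: "('m \<Rightarrow> (('m \<Rightarrow> real) \<Rightarrow> real) \<times> real) \<Rightarrow> ('m \<Rightarrow> real) \<Rightarrow> 'm \<Rightarrow> real" where
  "first_order X f = (\<lambda>y. fst (X y) f + snd (X y) * f y)"

definition first_order_wedge ::
    "('m \<Rightarrow> (('m \<Rightarrow> real) \<Rightarrow> real) \<times> real) \<Rightarrow> ('m \<Rightarrow> (('m \<Rightarrow> real) \<Rightarrow> real) \<times> real)
      \<Rightarrow> ('m \<Rightarrow> real) \<Rightarrow> ('m \<Rightarrow> real) \<Rightarrow> 'm \<Rightarrow> real" where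
  "first_order_wedge X Y f g = (\<lambda>y. first_order X f y * first_order Y g y - first_order X g y * first_order Y f y)"

context manifold
begin

lemma sections_TMR_iff:
  "X \<in> sections (TMR \<A>) \<longleftrightarrow> (\<lambda>x. fst (X x)) \<in> sections (TM \<A>) \<and> (\<lambda>x. snd (X x)) \<in> Cinf \<A>"
  by (simp add: TMR_def)

lemma section_TMR:
  assumes "X \<in> sections (TMR \<A>)"
  shows "fst (X x) \<in> tangent_space \<A> x" "X x \<in> fibre (TMR \<A>) x" "(\<lambda>x. snd (X x)) \<in> Cinf \<A>"
    "f \<in> Cinf \<A> \<Longrightarrow> (\<lambda>x. fst (X x) f) \<in> Cinf \<A>"
  using assms by (auto simp: sections_TMR_iff sections_TM_iff mem_Times_iff)

lemma TMR_bracket_section: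
  assumes "X \<in> sections (TMR \<A>)" "Y \<in> sections (TMR \<A>)"
  shows "TMR_bracket X Y \<in> sections (TMR \<A>)"
proof -
  note X = section_TMR[OF assms(1)] and Y = section_TMR[OF assms(2)]
  have "(\<lambda>x. fst (X x) (\<lambda>y. snd (Y y)) - fst (Y x) (\<lambda>y. snd (X y))) \<in> Cinf \<A>"
    by (intro Cinf_diff X(4) Y(4) X(3) Y(3))
  then show ?thesis
    using assms lie_bracket_section[of "\<lambda>x. fst (X x)" "\<lambda>x. fst (Y x)"]
    by (simp add: sections_TMR_iff TMR_bracket_def)
qed

lemma first_order_Cinf: "X \<in> sections (TMR \<A>) \<Longrightarrow> f \<in> Cinf \<A> \<Longrightarrow> first_order X f \<in> Cinf \<A>"
  unfolding first_order_def by (intro Cinf_intros section_TMR)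

lemma first_order_wedge_Cinf:
  "X \<in> sections (TMR \<A>) \<Longrightarrow> Y \<in> sections (TMR \<A>) \<Longrightarrow> f \<in> Cinf \<A> \<Longrightarrow> g \<in> Cinf \<A> \<Longrightarrow>
    first_order_wedge X Y f g \<in> Cinf \<A>"
  unfolding first_order_wedge_def by (intro Cinf_intros first_order_Cinf)

text \<open>The defect from the Leibniz rule is the value on 1 times the product. It is the source
  of the terms with \<open>\<lambda>_. 1\<close> in the formulas for \<open>T\<close> on
  jets.\<close>

lemma first_order_mult:
  "X \<in> sections (TMR \<A>) \<Longrightarrow> f \<in> Cinf \<A> \<Longrightarrow> g \<in> Cinf \<A> \<Longrightarrow>
    first_order X (\<lambda>y. f y * g y) x =
      first_order X f x * g x + f x * first_order X g x - snd (X x) * f x * g x"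
  using tangent_mult[OF section_TMR(1)] by (simp add: first_order_def algebra_simps)

lemma first_order_one: "X \<in> sections (TMR \<A>) \<Longrightarrow> first_order X (\<lambda>y. 1) = (\<lambda>x. snd (X x))"
  using tangent_const[OF section_TMR(1)] by (simp add: first_order_def)

lemma first_order_diff:
  "X \<in> sections (TMR \<A>) \<Longrightarrow> f \<in> Cinf \<A> \<Longrightarrow> g \<in> Cinf \<A> \<Longrightarrow>
    first_order X (\<lambda>y. f y - g y) x = first_order X f x - first_order X g x"
  using tangent_diff[OF section_TMR(1)] by (simp add: first_order_def algebra_simps)

lemma first_order_cmult:
  "X \<in> sections (TMR \<A>) \<Longrightarrow> f \<in> Cinf \<A> \<Longrightarrow> first_order X (\<lambda>y. c * f y) x = c * first_order X f x"
  using tangent_cmult[OF section_TMR(1)] by (simp add: first_order_def algebra_simps)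

lemma first_order_sum:
  "X \<in> sections (TMR \<A>) \<Longrightarrow> (\<And>i. i \<in> I \<Longrightarrow> f i \<in> Cinf \<A>) \<Longrightarrow>
    first_order X (\<lambda>y. \<Sum>i\<in>I. f i y) x = (\<Sum>i\<in>I. first_order X (f i) x)"
  using tangent_sum[OF section_TMR(1), of X I f x]
  by (simp add: first_order_def sum.distrib sum_distrib_left)

lemma jet_apply_section: "X \<in> sections (TMR \<A>) \<Longrightarrow> jet \<A> f x (X x) = first_order X f x"
  using section_TMR(2)[of X x] by (simp add: jet_def first_order_def)

lemma vec1_jet:
  "X \<in> sections (TMR \<A>) \<Longrightarrow> vec1 (TMR \<A>) X x [jet \<A> f x] = first_order X f x"
  by (simp add: vec1_apply[OF jet_in_dual_space] jet_apply_section)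

lemma jet_section: "f \<in> Cinf \<A> \<Longrightarrow> jet \<A> f \<in> sections (dual \<A> (TMR \<A>))"
proof (rule sections_dualI[OF jet_in_dual_space])
  fix X assume "f \<in> Cinf \<A>" "X \<in> sections (TMR \<A>)"
  then show "(\<lambda>x. jet \<A> f x (X x)) \<in> Cinf \<A>"
    using first_order_Cinf[of X f] by (simp add: jet_apply_section)
qed

text \<open>Because of this, contracting with the cocycle amounts to inserting the constant function
  1.\<close>

lemma cocycle_is_jet: "TMR_cocycle \<A> = jet \<A> (\<lambda>y. 1)"
  using tangent_const by (auto simp: fun_eq_iff TMR_cocycle_def jet_def)

text \<open>Sections of TM x R bracket like the operators they define. This reduces the Schouten
  calculus to identities between iterated operators.\<close>

lemma first_order_bracket:
  assumes X: "X \<in> sections (TMR \<A>)" and Y: "Y \<in> sections (TMR \<A>)" and f: "f \<in> Cinf \<A>"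
  shows "first_order (TMR_bracket X Y) f x =
    first_order X (first_order Y f) x - first_order Y (first_order X f) x"
proof -
  have "fst (Z x) (first_order Z' f) =
      fst (Z x) (\<lambda>y. fst (Z' y) f) + snd (Z' x) * fst (Z x) f + fst (Z x) (\<lambda>y. snd (Z' y)) * f x"
    if "Z \<in> sections (TMR \<A>)" "Z' \<in> sections (TMR \<A>)" for Z Z'
  proof -
    note Z = section_TMR[OF that(1)] and Z' = section_TMR[OF that(2)]
    have "fst (Z x) (first_order Z' f) =
        fst (Z x) (\<lambda>y. fst (Z' y) f) + fst (Z x) (\<lambda>y. snd (Z' y) * f y)"
      unfolding first_order_def by (intro tangent_add[OF Z(1)] Z'(4) Cinf_mult Z'(3) f)
    also have "fst (Z x) (\<lambda>y. snd (Z' y) * f y) =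
        snd (Z' x) * fst (Z x) f + fst (Z x) (\<lambda>y. snd (Z' y)) * f x"
      by (intro tangent_mult[OF Z(1)] Z'(3) f)
    finally show ?thesis by simp
  qed
  note * = this[OF X Y] this[OF Y X]
  show ?thesis
    unfolding first_order_def[of "TMR_bracket X Y"] first_order_def[of X "first_order Y f"]
      first_order_def[of Y "first_order X f"] *
    by (simp add: first_order_def TMR_bracket_def lie_bracket_def algebra_simps)
qed

abbreviation bivector where
  "bivector X Y \<equiv> wedge 1 1 (vec1 (TMR \<A>) X) (vec1 (TMR \<A>) Y)"

lemma bivector_multisection:
  "X \<in> sections (TMR \<A>) \<Longrightarrow> Y \<in> sections (TMR \<A>) \<Longrightarrow> bivector X Y \<in> multisections \<A> (TMR \<A>) 2"
  using wedge_1_1_in_forms[OF _ vec1_in_multisections vec1_in_multisections]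
  by (simp add: subspace_dual_space)

lemma bivector_jets:
  "X \<in> sections (TMR \<A>) \<Longrightarrow> Y \<in> sections (TMR \<A>) \<Longrightarrow>
    bivector X Y x [jet \<A> f x, jet \<A> g x] = first_order_wedge X Y f g x"
  unfolding wedge_1_1 by (simp add: vec1_jet first_order_wedge_def)

end

locale TMR_schouten = manifold \<A>
  for \<A> :: "('m::{t2_space, second_countable_topology}, 'e::euclidean_space) atlas" +
  fixes T
  assumes T: "schouten_bracket \<A> (TMR \<A>) TMR_anchor TMR_bracket T"
begin

lemma T_section_bivector:
  assumes X: "X \<in> sections (TMR \<A>)" and Y: "Y \<in> sections (TMR \<A>)" and Z: "Z \<in> sections (TMR \<A>)"
  shows "T 1 (vec1 (TMR \<A>) Z) 2 (bivector X Y) =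
    bivector (TMR_bracket Z X) Y + bivector X (TMR_bracket Z Y)"
proof -
  note v = vec1_in_multisections[OF X] vec1_in_multisections[OF Y] vec1_in_multisections[OF Z]
  \<comment> \<open>The degrees are left unevaluated so that they match the shape of
    \<open>schouten_wedge\<close>.\<close>
  have "T 1 (vec1 (TMR \<A>) Z) (1 + 1) (bivector X Y) =
    wedge (1 + 1 - 1) 1 (vec1 (TMR \<A>) (TMR_bracket Z X)) (vec1 (TMR \<A>) Y) +
      (-1) ^ ((1 + 1) * 1) *\<^sub>R wedge 1 (1 + 1 - 1) (vec1 (TMR \<A>) X) (vec1 (TMR \<A>) (TMR_bracket Z Y))"
    using schouten_wedge[OF T v(3,1,2)] schouten_sections[OF T Z X] schouten_sections[OF T Z Y]
    by (simp only:)
  moreover have "1 + 1 = (2::nat)" "1 + 1 - 1 = (1::nat)" "(-1::real) ^ ((1 + 1) * 1) = 1" by simp_all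
  ultimately show ?thesis by (simp only: scaleR_one)
qed

text \<open>The Leibniz rule splits the second bivector into its factors; the bracket of a bivector
  with a section is minus the one in the opposite order, which has been computed.\<close>

lemma T_bivectors:
  assumes X: "X \<in> sections (TMR \<A>)" and Y: "Y \<in> sections (TMR \<A>)"
    and Z: "Z \<in> sections (TMR \<A>)" and U: "U \<in> sections (TMR \<A>)"
  shows "T 2 (bivector X Y) 2 (bivector Z U) x vs =
    wedge 1 2 (vec1 (TMR \<A>) Z) (bivector (TMR_bracket U X) Y + bivector X (TMR_bracket U Y)) x vs -
    wedge 2 1 (bivector (TMR_bracket Z X) Y + bivector X (TMR_bracket Z Y)) (vec1 (TMR \<A>) U) x vs"
proof -
  note b = bivector_multisection[OF X Y]
  have m: "T 2 (bivector X Y) 1 (vec1 (TMR \<A>) V) =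
      - (bivector (TMR_bracket V X) Y + bivector X (TMR_bracket V Y))"
    if V: "V \<in> sections (TMR \<A>)" for V
  proof -
    have "T 2 (bivector X Y) 1 (vec1 (TMR \<A>) V) =
        - ((-1) ^ ((2 + 1) * (1 + 1)) *\<^sub>R T 1 (vec1 (TMR \<A>) V) 2 (bivector X Y))"
      by (rule schouten_sym[OF T b vec1_in_multisections[OF V]])
    moreover have "(-1::real) ^ ((2 + 1) * (1 + 1)) = 1" by simp
    ultimately show ?thesis
      by (simp only: T_section_bivector[OF X Y V] scaleR_one)
  qed
  have "T 2 (bivector X Y) (1 + 1) (bivector Z U) =
    wedge (2 + 1 - 1) 1 (- (bivector (TMR_bracket Z X) Y + bivector X (TMR_bracket Z Y))) (vec1 (TMR \<A>) U) +
    (-1) ^ ((2 + 1) * 1) *\<^sub>R wedge 1 (2 + 1 - 1) (vec1 (TMR \<A>) Z)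
      (- (bivector (TMR_bracket U X) Y + bivector X (TMR_bracket U Y)))"
    using schouten_wedge[OF T b vec1_in_multisections[OF Z] vec1_in_multisections[OF U]]
    by (simp only: m[OF Z] m[OF U])
  moreover have "1 + 1 = (2::nat)" "2 + 1 - 1 = (2::nat)" "(-1::real) ^ ((2 + 1) * 1) = -1" by simp_all
  ultimately have "T 2 (bivector X Y) 2 (bivector Z U) =
    wedge 2 1 (- (bivector (TMR_bracket Z X) Y + bivector X (TMR_bracket Z Y))) (vec1 (TMR \<A>) U) +
    (-1) *\<^sub>R wedge 1 2 (vec1 (TMR \<A>) Z)
      (- (bivector (TMR_bracket U X) Y + bivector X (TMR_bracket U Y)))"
    by (simp only:)
  then show ?thesis by (simp only: wedge_minus_left wedge_minus_right) simp
qed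

text \<open>The polarisation of \<open>\<onehalf>[J, J]\<^sup>(\<^sup>0\<^sup>,\<^sup>1\<^sup>)(f, g, h) = - (J(J(f, g), h) + c.p.)\<close> on decomposable
  bivectors, where both sides are explicit in the operators \<^term>\<open>first_order\<close>.\<close>

lemma T_bivectors_jets:
  assumes X: "X \<in> sections (TMR \<A>)" and Y: "Y \<in> sections (TMR \<A>)"
    and Z: "Z \<in> sections (TMR \<A>)" and U: "U \<in> sections (TMR \<A>)"
    and f: "f \<in> Cinf \<A>" and g: "g \<in> Cinf \<A>" and h: "h \<in> Cinf \<A>"
  defines "P \<equiv> first_order_wedge X Y" and "Q \<equiv> first_order_wedge Z U"
  shows "T 2 (bivector X Y) 2 (bivector Z U) x [jet \<A> f x, jet \<A> g x, jet \<A> h x] =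
    - (P (Q f g) h x + P (Q g h) f x + P (Q h f) g x + Q (P f g) h x + Q (P g h) f x + Q (P h f) g x +
       P f g x * Q (\<lambda>_. 1) h x + P g h x * Q (\<lambda>_. 1) f x + P h f x * Q (\<lambda>_. 1) g x +
       Q f g x * P (\<lambda>_. 1) h x + Q g h x * P (\<lambda>_. 1) f x + Q h f x * P (\<lambda>_. 1) g x)"
proof -
  note ops = X Y Z U
  \<comment> \<open>The product rule, used twice. Its \<open>snd\<close> terms are the defects; they
    cancel against those that \<open>O\<close> brings in.\<close>
  have D: "first_order V (first_order_wedge R S u v) x =
      first_order V (first_order R u) x * first_order S v x + first_order R u x * first_order V (first_order S v) x
      - snd (V x) * first_order R u x * first_order S v x
      - first_order V (first_order R v) x * first_order S u x - first_order R v x * first_order V (first_order S u) x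
      + snd (V x) * first_order R v x * first_order S u x"
    if "V \<in> sections (TMR \<A>)" "R \<in> sections (TMR \<A>)" "S \<in> sections (TMR \<A>)" "u \<in> Cinf \<A>" "v \<in> Cinf \<A>"
    for V R S u v
    unfolding first_order_wedge_def using that
    by (simp add: first_order_diff first_order_mult first_order_Cinf Cinf_mult)
  have E: "first_order_wedge V V' (first_order_wedge R S u v) w x =
      first_order V (first_order_wedge R S u v) x * first_order V' w x -
      first_order V w x * first_order V' (first_order_wedge R S u v) x" for V V' R S u v w
    by (simp add: first_order_wedge_def)
  have O: "first_order_wedge V V' (\<lambda>_. 1) w x = snd (V x) * first_order V' w x - first_order V w x * snd (V' x)"
    if "V \<in> sections (TMR \<A>)" "V' \<in> sections (TMR \<A>)" for V V' w
    using that by (simp add: first_order_wedge_def first_order_one)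
  have B: "(bivector (TMR_bracket V X) Y + bivector X (TMR_bracket V Y)) x [jet \<A> u x, jet \<A> v x] =
      (first_order V (first_order X u) x - first_order X (first_order V u) x) * first_order Y v x -
      (first_order V (first_order X v) x - first_order X (first_order V v) x) * first_order Y u x +
      first_order X u x * (first_order V (first_order Y v) x - first_order Y (first_order V v) x) -
      first_order X v x * (first_order V (first_order Y u) x - first_order Y (first_order V u) x)"
    if V: "V \<in> sections (TMR \<A>)" and u: "u \<in> Cinf \<A>" "v \<in> Cinf \<A>" for V u v
    using bivector_jets[OF TMR_bracket_section[OF V X] Y] bivector_jets[OF X TMR_bracket_section[OF V Y]]
      first_order_bracket[OF V X] first_order_bracket[OF V Y] u
    by (simp add: first_order_wedge_def)
  show ?thesis
    unfolding P_def Q_def T_bivectors[OF ops] wedge_1_2 wedge_2_1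
    unfolding B[OF U f g] B[OF U g f] B[OF U f h] B[OF U h f] B[OF U g h] B[OF U h g]
      B[OF Z f g] B[OF Z g f] B[OF Z f h] B[OF Z h f] B[OF Z g h] B[OF Z h g]
      vec1_jet[OF Z] vec1_jet[OF U] O[OF X Y] O[OF Z U]
    unfolding E
    unfolding D[OF X Z U f g] D[OF X Z U g h] D[OF X Z U h f] D[OF Y Z U f g] D[OF Y Z U g h] D[OF Y Z U h f]
      D[OF Z X Y f g] D[OF Z X Y g h] D[OF Z X Y h f] D[OF U X Y f g] D[OF U X Y g h] D[OF U X Y h f]
    unfolding first_order_wedge_def
    \<comment> \<open>What remains is a polynomial identity in the values at \<open>x\<close> of
      operators applied once or twice and of second components.\<close>
    by (simp add: field_simps)
qed

end

section \<open>Localising the bracket at a point, and its value on three jets\<close>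

context TMR_schouten
begin

abbreviation MS :: "nat \<Rightarrow> ('m, (('m \<Rightarrow> real) \<Rightarrow> real) \<times> real \<Rightarrow> real) form set" where
  "MS k \<equiv> multisections \<A> (TMR \<A>) k"

text \<open>A Schouten bracket is of first order in each coefficient, so it does not see one that
  vanishes to second order. The Leibniz rule alone gives this: the bracket with \<rho>^2 is a sum of
  multiples of \<rho>, and the bracket with \<rho>^2 Q consists of a multiple of that and a multiple
  of \<rho>^2.\<close>

lemma T_vanishing_coefficient:
  assumes P: "P \<in> MS 2" and Q: "Q \<in> MS 2" and r: "\<rho> \<in> Cinf \<A>" "\<rho> x = 0"
  shows "T 2 P 2 (\<lambda>y vs. (\<rho> y)\<^sup>2 * Q y vs) x = (\<lambda>_. 0)"
proof -
  let ?r2 = "\<lambda>y. (\<rho> y)\<^sup>2"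
  have r2: "?r2 \<in> Cinf \<A>" using Cinf_mult[OF r(1) r(1)] by (simp add: power2_eq_square)
  note fr = form0_in_forms[OF r(1), of "dual \<A> (TMR \<A>)"] form0_in_forms[OF r2, of "dual \<A> (TMR \<A>)"]
  have r0: "form0 \<rho> x = (\<lambda>_. 0)" "form0 ?r2 x = (\<lambda>_. 0)"
    using r(2) by (auto intro!: form0_zero_at)
  have "T 2 P (0 + 0) (form0 ?r2) = wedge (2 + 0 - 1) 0 (T 2 P 0 (form0 \<rho>)) (form0 \<rho>) +
      (-1) ^ ((2 + 1) * 0) *\<^sub>R wedge 0 (2 + 0 - 1) (form0 \<rho>) (T 2 P 0 (form0 \<rho>))"
    using schouten_wedge[OF T P fr(1) fr(1)] by (simp only: wedge_0_0 power2_eq_square)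
  then have 1: "T 2 P 0 (form0 ?r2) x = (\<lambda>_. 0)"
    by (simp add: fun_eq_iff wedge_vanish_left[where P = "form0 \<rho>", OF r0(1)]
        wedge_vanish_right[where Q = "form0 \<rho>", OF r0(1)])
  have "wedge 0 2 (form0 ?r2) Q = (\<lambda>y vs. (\<rho> y)\<^sup>2 * Q y vs)"
    using Q by (intro wedge_0_2_mult) (simp_all add: subspace_dual_space)
  then have "T 2 P 2 (\<lambda>y vs. (\<rho> y)\<^sup>2 * Q y vs) = wedge (2 + 0 - 1) 2 (T 2 P 0 (form0 ?r2)) Q +
      (-1) ^ ((2 + 1) * 0) *\<^sub>R wedge 0 (2 + 2 - 1) (form0 ?r2) (T 2 P 2 Q)"
    using schouten_wedge[OF T P fr(2) Q] by (simp only: add_0)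
  then show ?thesis
    by (simp add: fun_eq_iff wedge_vanish_left[where P = "form0 ?r2", OF r0(2)]
        wedge_vanish_left[where P = "T 2 P 0 (form0 ?r2)", OF 1])
qed

lemma T_sym:
  assumes "P \<in> MS 2" "Q \<in> MS 2"
  shows "T 2 P 2 Q = T 2 Q 2 P"
proof -
  have "(-1::real) ^ ((2 + 1) * (2 + 1)) = -1" by simp
  with schouten_sym[OF T assms] show ?thesis by (simp only: scaleR_minus1_left minus_minus)
qed

text \<open>\<open>J\<close> and \<open>K\<close> differ by \<rho>^2 J, which is invisible at
  \<open>x\<close> as second argument; exchanging the arguments by symmetry deals with the first
  one.\<close>

lemma T_cutoff:
  assumes J: "J \<in> MS 2" and r: "\<rho> \<in> Cinf \<A>" "\<rho> x = 0"
  defines "K \<equiv> (\<lambda>y vs. (1 - (\<rho> y)\<^sup>2) * J y vs)"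
  shows "K \<in> MS 2" "T 2 J 2 J x = T 2 K 2 K x"
proof -
  let ?R = "\<lambda>y vs. (\<rho> y)\<^sup>2 * J y vs"
  have "(\<lambda>y. (\<rho> y)\<^sup>2) \<in> Cinf \<A>" "(\<lambda>y. 1 - (\<rho> y)\<^sup>2) \<in> Cinf \<A>"
    using r(1) unfolding power2_eq_square by (auto intro: Cinf_intros)
  then have K: "K \<in> MS 2" and R: "?R \<in> MS 2"
    unfolding K_def using forms_mult[OF _ J] by auto
  have split: "T 2 P 2 J x = T 2 P 2 K x" if P: "P \<in> MS 2" for P
  proof -
    have "J = K + ?R" by (simp add: K_def fun_eq_iff algebra_simps)
    then have "T 2 P 2 J = T 2 P 2 K + T 2 P 2 ?R"
      using schouten_add[OF T P K R] by simp
    then show ?thesis using T_vanishing_coefficient[OF P J r] by (simp add: fun_eq_iff)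
  qed
  show "K \<in> MS 2" by (rule K)
  show "T 2 J 2 J x = T 2 K 2 K x"
    using split[OF J] split[OF K] T_sym[OF J K] by simp
qed

text \<open>Linearity is postulated in the second argument; the first one is reached through
  \<open>T_sym\<close>.\<close>

lemma T_half_sum:
  fixes n :: nat
  assumes "\<And>i. i < n \<Longrightarrow> P i \<in> MS 2"
  defines "K \<equiv> (1 / 2) *\<^sub>R (\<Sum>i<n. P i)"
  shows "T 2 K 2 K x vs = (\<Sum>i<n. \<Sum>j<n. T 2 (P i) 2 (P j) x vs) / 4"
proof -
  have sum: "(\<Sum>i<n. P i) \<in> MS 2"
    using assms(1) by (intro forms_sum) (simp_all add: subspace_dual_space)
  have K: "K \<in> MS 2" unfolding K_def by (rule forms_scaleR[OF sum])
  have half: "T 2 R 2 K x vs = (\<Sum>i<n. T 2 R 2 (P i) x vs) / 2" if R: "R \<in> MS 2" for R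
  proof -
    have "T 2 R 2 K = (1 / 2) *\<^sub>R (\<Sum>i<n. T 2 R 2 (P i))"
    proof -
      have "T 2 R 2 (\<Sum>i<n. P i) = (\<Sum>i<n. T 2 R 2 (P i))"
        using assms(1) by (intro schouten_sum[OF T manifold_axioms R]) auto
      with schouten_scaleR[OF T R sum, of "1 / 2"] show ?thesis unfolding K_def by (simp only:)
    qed
    then show ?thesis by (simp add: sum_fun_apply)
  qed
  have "T 2 K 2 K x vs = (\<Sum>i<n. T 2 K 2 (P i) x vs) / 2" by (rule half[OF K])
  also have "(\<Sum>i<n. T 2 K 2 (P i) x vs) = (\<Sum>i<n. (\<Sum>j<n. T 2 (P i) 2 (P j) x vs) / 2)"
    using half[OF assms(1)] T_sym[OF K assms(1)] by (intro sum.cong) auto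
  finally show ?thesis by (simp add: sum_divide_distrib)
qed

text \<open>1 - \<rho>^2 has the same one-jet at \<open>x\<close> as the constant 1, so a first
  order operator cannot tell them apart there. The factors 2 are those of the decomposition in
  \<open>T_jets\<close>.\<close>

lemma first_order_cutoff:
  assumes "X \<in> sections (TMR \<A>)" "\<rho> \<in> Cinf \<A>" "\<rho> x = 0" "w \<in> Cinf \<A>"
  shows "first_order X (\<lambda>y. 2 * ((1 - (\<rho> y)\<^sup>2) * w y)) x = 2 * first_order X w x"
proof -
  let ?c = "\<lambda>y. 1 - \<rho> y * \<rho> y"
  have c: "?c \<in> Cinf \<A>" using assms(2) by (intro Cinf_intros)
  have "first_order X ?c x = snd (X x)"
    using assms
    by (simp add: first_order_diff first_order_mult Cinf_mult first_order_one[OF assms(1)])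
  moreover have "first_order X (\<lambda>y. 2 * (?c y * w y)) x = 2 * first_order X (\<lambda>y. ?c y * w y) x"
    using assms c by (intro first_order_cmult Cinf_mult)
  moreover have "first_order X (\<lambda>y. ?c y * w y) x =
      first_order X ?c x * w x + ?c x * first_order X w x - snd (X x) * ?c x * w x"
    using assms c by (intro first_order_mult)
  ultimately show ?thesis using assms(3) by (simp add: power2_eq_square)
qed

text \<open>Jets exhaust the covectors at each point, and off the fibre both sides are 0.\<close>

lemma multisection2_eqI:
  assumes "P \<in> MS 2" "Q \<in> MS 2"
    "\<And>x f g. f \<in> Cinf \<A> \<Longrightarrow> g \<in> Cinf \<A> \<Longrightarrow>
       P x [jet \<A> f x, jet \<A> g x] = Q x [jet \<A> f x, jet \<A> g x]"
  shows "P = Q"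
proof (intro ext)
  fix x vs
  show "P x vs = Q x vs"
  proof (cases "length vs = 2 \<and> set vs \<subseteq> dual_space (fibre (TMR \<A>) x)")
    case True
    then obtain u v where "vs = [u, v]" by (auto simp: numeral_2_eq_2 length_Suc_conv)
    moreover from this True obtain f g where "f \<in> Cinf \<A>" "jet \<A> f x = u" "g \<in> Cinf \<A>" "jet \<A> g x = v"
      using covector_is_jet[of u x] covector_is_jet[of v x] by (metis insert_subset list.simps(15))
    ultimately show ?thesis using assms(3) by blast
  next
    case False
    then show ?thesis
      using alt_formsD(1)[OF forms_alt[OF assms(1)], of vs x] alt_formsD(1)[OF forms_alt[OF assms(2)], of vs x]
      by simp
  qed
qed

lemma jets_Cinf:
  assumes "J \<in> MS 2" "f \<in> Cinf \<A>" "g \<in> Cinf \<A>"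
  shows "(\<lambda>y. J y [jet \<A> f y, jet \<A> g y]) \<in> Cinf \<A>"
  using forms_eval[OF assms(1), of "[jet \<A> f, jet \<A> g]"] assms(2,3)
  by (simp add: jet_section eval_form_def)

text \<open>Globally, the cut-off of \<open>J\<close> is half a sum of decomposable bivectors, so
  the polarised identity can be summed over pairs of indices. Each inner sum is 2 (1 - \<rho>^2) j,
  and at \<open>x\<close> it is differentiated as if the cut-off were absent.\<close>

lemma T_jets:
  fixes n :: nat
  assumes J: "J \<in> MS 2" and r: "\<rho> \<in> Cinf \<A>" "\<rho> x = 0"
    and xs: "\<And>i. i < n \<Longrightarrow> xs i \<in> sections (TMR \<A>)" and ys: "\<And>i. i < n \<Longrightarrow> ys i \<in> sections (TMR \<A>)"
    and j: "\<And>f g. f \<in> Cinf \<A> \<Longrightarrow> g \<in> Cinf \<A> \<Longrightarrow> j f g = (\<lambda>y. J y [jet \<A> f y, jet \<A> g y])"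
    and decomp: "\<And>y f g. f \<in> Cinf \<A> \<Longrightarrow> g \<in> Cinf \<A> \<Longrightarrow>
       (\<Sum>i<n. first_order_wedge (xs i) (ys i) f g y) = 2 * ((1 - (\<rho> y)\<^sup>2) * j f g y)"
    and f: "f \<in> Cinf \<A>" and g: "g \<in> Cinf \<A>" and h: "h \<in> Cinf \<A>"
  shows "T 2 J 2 J x [jet \<A> f x, jet \<A> g x, jet \<A> h x] =
    - 2 * (j (j f g) h x + j (j g h) f x + j (j h f) g x +
      j f g x * j (\<lambda>_. 1) h x + j g h x * j (\<lambda>_. 1) f x + j h f x * j (\<lambda>_. 1) g x)"
proof -
  let ?B = "\<lambda>i. bivector (xs i) (ys i)" and ?p = "\<lambda>i. first_order_wedge (xs i) (ys i)"
  let ?K = "\<lambda>y vs. (1 - (\<rho> y)\<^sup>2) * J y vs"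
  note K = T_cutoff[where J = J and \<rho> = \<rho> and x = x, OF J r]
  have B: "?B i \<in> MS 2" if "i < n" for i using bivector_multisection xs ys that by blast
  have sum: "(\<Sum>i<n. ?B i) \<in> MS 2"
    using B by (intro forms_sum) (simp_all add: subspace_dual_space)
  have "?K = (1 / 2) *\<^sub>R (\<Sum>i<n. ?B i)"
  proof (rule multisection2_eqI[OF K(1) forms_scaleR[OF sum]])
    fix x f g assume "f \<in> Cinf \<A>" "g \<in> Cinf \<A>"
    moreover have "(\<Sum>i<n. ?B i x [jet \<A> f x, jet \<A> g x]) = (\<Sum>i<n. ?p i f g x)"
      using xs ys by (intro sum.cong bivector_jets) auto
    ultimately show "(1 - (\<rho> x)\<^sup>2) * J x [jet \<A> f x, jet \<A> g x] =
        ((1 / 2) *\<^sub>R (\<Sum>i<n. ?B i)) x [jet \<A> f x, jet \<A> g x]"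
      using decomp[of f g x] by (simp add: sum_fun_apply j)
  qed
  then have "T 2 J 2 J x = T 2 ((1 / 2) *\<^sub>R (\<Sum>i<n. ?B i)) 2 ((1 / 2) *\<^sub>R (\<Sum>i<n. ?B i)) x"
    using K(2) by simp
  \<comment> \<open>The 4 is the square of the factor 2 between the sum of bivectors and the cut-off
    of \<open>J\<close>.\<close>
  then have T: "4 * T 2 J 2 J x [jet \<A> f x, jet \<A> g x, jet \<A> h x] =
      (\<Sum>i<n. \<Sum>j<n. T 2 (?B i) 2 (?B j) x [jet \<A> f x, jet \<A> g x, jet \<A> h x])"
    using T_half_sum[of n ?B x "[jet \<A> f x, jet \<A> g x, jet \<A> h x]"] B by simp
  have jC: "j u v \<in> Cinf \<A>" if "u \<in> Cinf \<A>" "v \<in> Cinf \<A>" for u v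
    using jets_Cinf[OF J that] that by (simp add: j)
  \<comment> \<open>The inner and the outer sum contribute a factor 2 each.\<close>
  have nested: "(\<Sum>i<n. \<Sum>k<n. ?p i (?p k u v) w x) = 4 * j (j u v) w x"
    if u: "u \<in> Cinf \<A>" and v: "v \<in> Cinf \<A>" and w: "w \<in> Cinf \<A>" for u v w
  proof -
    have pC: "?p k u v \<in> Cinf \<A>" if "k < n" for k
      using xs ys that u v by (intro first_order_wedge_Cinf)
    have lin: "(\<Sum>k<n. first_order X (?p k u v) x) = 2 * first_order X (j u v) x"
      if X: "X \<in> sections (TMR \<A>)" for X
    proof -
      have "(\<Sum>k<n. first_order X (?p k u v) x) = first_order X (\<lambda>y. \<Sum>k<n. ?p k u v y) x"
        using pC by (intro first_order_sum[symmetric] X) auto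
      also have "(\<lambda>y. \<Sum>k<n. ?p k u v y) = (\<lambda>y. 2 * ((1 - (\<rho> y)\<^sup>2) * j u v y))"
        using decomp[OF u v] by (rule ext)
      also have "first_order X \<dots> x = 2 * first_order X (j u v) x"
        by (rule first_order_cutoff[OF X r jC[OF u v]])
      finally show ?thesis .
    qed
    have "(\<Sum>k<n. ?p i (?p k u v) w x) = 2 * ?p i (j u v) w x" if i: "i < n" for i
    proof -
      have "(\<Sum>k<n. ?p i (?p k u v) w x) =
          (\<Sum>k<n. first_order (xs i) (?p k u v) x) * first_order (ys i) w x -
          first_order (xs i) w x * (\<Sum>k<n. first_order (ys i) (?p k u v) x)"
        by (subst (1) first_order_wedge_def) (simp add: sum_subtractf sum_distrib_right sum_distrib_left)
      then show ?thesis
        using lin[OF xs[OF i]] lin[OF ys[OF i]]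
        by (simp add: first_order_wedge_def[of "xs i" "ys i" "j u v"] algebra_simps)
    qed
    then have "(\<Sum>i<n. \<Sum>k<n. ?p i (?p k u v) w x) = 2 * (\<Sum>i<n. ?p i (j u v) w x)"
      by (simp add: sum_distrib_left)
    then show ?thesis using decomp[OF jC[OF u v] w, of x] r(2) by simp
  qed
  have nested': "(\<Sum>i<n. \<Sum>k<n. ?p k (?p i u v) w x) = 4 * j (j u v) w x"
    if "u \<in> Cinf \<A>" "v \<in> Cinf \<A>" "w \<in> Cinf \<A>" for u v w
    using nested[OF that] by (subst sum.swap) simp
  have prod: "(\<Sum>i<n. \<Sum>k<n. ?p i u v x * ?p k (\<lambda>_. 1) w x) = 4 * (j u v x * j (\<lambda>_. 1) w x)"
    if "u \<in> Cinf \<A>" "v \<in> Cinf \<A>" "w \<in> Cinf \<A>" for u v w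
    using decomp[OF that(1,2), of x] decomp[OF Cinf_const that(3), of 1 x] r(2)
    by (simp add: sum_product[symmetric])
  have prod': "(\<Sum>i<n. \<Sum>k<n. ?p k u v x * ?p i (\<lambda>_. 1) w x) = 4 * (j u v x * j (\<lambda>_. 1) w x)"
    if "u \<in> Cinf \<A>" "v \<in> Cinf \<A>" "w \<in> Cinf \<A>" for u v w
    using prod[OF that] by (subst sum.swap) simp
  have "(\<Sum>i<n. \<Sum>k<n. T 2 (?B i) 2 (?B k) x [jet \<A> f x, jet \<A> g x, jet \<A> h x]) =
    (\<Sum>i<n. \<Sum>k<n. - (?p i (?p k f g) h x + ?p i (?p k g h) f x + ?p i (?p k h f) g x +
      ?p k (?p i f g) h x + ?p k (?p i g h) f x + ?p k (?p i h f) g x +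
      ?p i f g x * ?p k (\<lambda>_. 1) h x + ?p i g h x * ?p k (\<lambda>_. 1) f x + ?p i h f x * ?p k (\<lambda>_. 1) g x +
      ?p k f g x * ?p i (\<lambda>_. 1) h x + ?p k g h x * ?p i (\<lambda>_. 1) f x + ?p k h f x * ?p i (\<lambda>_. 1) g x))"
    using xs ys f g h by (intro sum.cong refl T_bivectors_jets) auto
  \<comment> \<open>The polarised identity is symmetric in the two bivectors, so every term arises
    twice, each time with weight 4.\<close>
  also have "\<dots> = - 8 * (j (j f g) h x + j (j g h) f x + j (j h f) g x +
      j f g x * j (\<lambda>_. 1) h x + j g h x * j (\<lambda>_. 1) f x + j h f x * j (\<lambda>_. 1) g x)"
    unfolding sum_negf sum.distrib
    unfolding nested[OF f g h] nested[OF g h f] nested[OF h f g] nested'[OF f g h] nested'[OF g h f]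
      nested'[OF h f g] prod[OF f g h] prod[OF g h f] prod[OF h f g] prod'[OF f g h] prod'[OF g h f]
      prod'[OF h f g] by simp
  finally show ?thesis using T by simp
qed

end

section \<open>Contractions in low degree, and multivector fields inside TM x R\<close>

lemma wedge_zero_left [simp]: "wedge p q 0 Q = 0" and wedge_zero_right [simp]: "wedge p q P 0 = 0"
  by (simp_all add: wedge_def fun_eq_iff)

lemma contr_form0 [simp]: "contr X (form0 f) = 0"
  by (simp add: contr_def form0_def fun_eq_iff)

lemma contr_zero [simp]: "contr X 0 = 0"
  by (simp add: contr_def fun_eq_iff)

lemma contr_vec1:
  assumes "\<And>x. \<phi> x \<in> dual_space (fibre B x)"
  shows "contr \<phi> (vec1 B X) = form0 (\<lambda>x. \<phi> x (X x))"
  using assms by (auto simp: contr_def vec1_def form1_def form0_def fun_eq_iff split: list.split)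

context manifold
begin

text \<open>The covector is extended by zero to the second component and realised as a jet; its
  value on (0, 1) forces \<open>f x = 0\<close>. Such functions isolate \<Lambda> in the bracket,
  since the terms with \<open>E\<close> vanish at \<open>x\<close>.\<close>

lemma covector_TM:
  assumes "\<mu> \<in> dual_space (tangent_space \<A> x)"
  obtains f where "f \<in> Cinf \<A>" "f x = 0" "deRham \<A> f x = \<mu>"
proof -
  let ?\<gamma> = "\<lambda>w. \<mu> (fst w)"
  have "?\<gamma> \<in> dual_space (fibre (TMR \<A>) x)"
    using assms by (auto simp: dual_space_def)
  then obtain f where f: "f \<in> Cinf \<A>" "jet \<A> f x = ?\<gamma>" by (rule covector_is_jet)
  have z: "0 \<in> tangent_space \<A> x" by (rule subspace_0[OF subspace_tangent_space])
  have "\<mu> 0 = 0" using dual_spaceD(2)[OF assms z, of 0] by simp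
  moreover have "jet \<A> f x (0, 1) = f x" using z by (simp add: jet_def)
  ultimately have "f x = 0" using f(2) by simp
  moreover have "deRham \<A> f x v = \<mu> v" for v
    using fun_cong[OF f(2), of "(v, 0)"] dual_spaceD(3)[OF assms, of v]
    by (cases "v \<in> tangent_space \<A> x") (simp_all add: jet_def deRham_def)
  ultimately show ?thesis using that f(1) by blast
qed

lemma jet_restrict: "(\<lambda>v. jet \<A> f x (v, 0)) = deRham \<A> f x"
  by (simp add: jet_def deRham_def fun_eq_iff)

lemma TM_section_inclusion:
  "X \<in> sections (TM \<A>) \<Longrightarrow> (\<lambda>x. (X x, 0)) \<in> sections (TMR \<A>)"
  by (simp add: sections_TMR_iff)

lemma restrict_covector:
  assumes "\<gamma> \<in> dual_space (tangent_space \<A> x \<times> UNIV)"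
  shows "(\<lambda>v. \<gamma> (v, 0)) \<in> dual_space (tangent_space \<A> x)"
proof -
  have "\<gamma> (u + v, 0) = \<gamma> (u, 0) + \<gamma> (v, 0)" if "u \<in> tangent_space \<A> x" "v \<in> tangent_space \<A> x" for u v
    using dual_spaceD(1)[OF assms, of "(u, 0)" "(v, 0)"] that by simp
  moreover have "\<gamma> (c *\<^sub>R v, 0) = c * \<gamma> (v, 0)" if "v \<in> tangent_space \<A> x" for c v
    using dual_spaceD(2)[OF assms, of "(v, 0)" c] that by simp
  moreover have "\<gamma> (v, 0) = 0" if "v \<notin> tangent_space \<A> x" for v
    using dual_spaceD(3)[OF assms, of "(v, 0)"] that by simp
  ultimately show ?thesis unfolding dual_space_def by blast
qed

lemma TMR_incl_vec1: "TMR_incl \<A> (vec1 (TM \<A>) X) = vec1 (TMR \<A>) (\<lambda>x. (X x, 0))"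
  using restrict_covector
  by (auto simp: TMR_incl_def vec1_def form1_def fun_eq_iff split: list.split)

lemma TMR_incl_multisection:
  assumes P: "P \<in> multisections \<A> (TM \<A>) k"
  shows "TMR_incl \<A> P \<in> multisections \<A> (TMR \<A>) k"
proof -
  let ?r = "\<lambda>\<gamma> v. \<gamma> (v, 0::real)"
  have r_add: "?r (\<gamma> + \<delta>) = ?r \<gamma> + ?r \<delta>" and r_scale: "?r (c *\<^sub>R \<gamma>) = c *\<^sub>R ?r \<gamma>"
    for \<gamma> \<delta> :: "(('m \<Rightarrow> real) \<Rightarrow> real) \<times> real \<Rightarrow> real" and c
    by (simp_all add: fun_eq_iff)
  have "TMR_incl \<A> P x \<in> alt_forms (dual_space (tangent_space \<A> x \<times> UNIV)) k" for x
  proof -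
    let ?D = "dual_space (tangent_space \<A> x \<times> (UNIV :: real set))"
    have P': "P x \<in> alt_forms (dual_space (tangent_space \<A> x)) k"
      using forms_alt[OF P, of x] by simp
    have r: "set (map ?r \<gamma>s) \<subseteq> dual_space (tangent_space \<A> x)" if "set \<gamma>s \<subseteq> ?D" for \<gamma>s
      using that restrict_covector by auto
    have w: "TMR_incl \<A> P x \<gamma>s = (if set \<gamma>s \<subseteq> ?D then P x (map ?r \<gamma>s) else 0)" for \<gamma>s
      by (simp add: TMR_incl_def)
    note sub = subspace_add[OF subspace_dual_space] subspace_scale[OF subspace_dual_space]
    show ?thesis
      unfolding alt_forms_def
    proof (intro CollectI conjI allI impI ballI)
      fix \<gamma>s assume "\<not> (length \<gamma>s = k \<and> set \<gamma>s \<subseteq> ?D)"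
      then show "TMR_incl \<A> P x \<gamma>s = 0"
        using alt_formsD(1)[OF P', of "map ?r \<gamma>s"] by (auto simp: w)
    next
      fix us vs \<gamma> \<delta> assume g: "\<gamma> \<in> ?D" "\<delta> \<in> ?D" "set us \<subseteq> ?D \<and> set vs \<subseteq> ?D"
      then show "TMR_incl \<A> P x (us @ (\<gamma> + \<delta>) # vs) =
          TMR_incl \<A> P x (us @ \<gamma> # vs) + TMR_incl \<A> P x (us @ \<delta> # vs)"
        using alt_formsD(2)[OF P' restrict_covector[OF g(1)] restrict_covector[OF g(2)] r r, of us vs]
          sub(1)[OF g(1,2)]
        by (simp add: w r_add del: plus_fun_apply)
    next
      fix us vs c \<gamma> assume g: "\<gamma> \<in> ?D" "set us \<subseteq> ?D \<and> set vs \<subseteq> ?D"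
      then show "TMR_incl \<A> P x (us @ c *\<^sub>R \<gamma> # vs) = c * TMR_incl \<A> P x (us @ \<gamma> # vs)"
        using alt_formsD(3)[OF P' restrict_covector[OF g(1)] r r, of us vs c] sub(2)[OF g(1), of c]
        by (simp add: w r_scale del: scaleR_fun_apply)
    next
      fix us vs ws \<gamma>
      show "TMR_incl \<A> P x (us @ \<gamma> # vs @ \<gamma> # ws) = 0"
        using alt_formsD(4)[OF P', of "map ?r us" "?r \<gamma>" "map ?r vs" "map ?r ws"] by (simp add: w)
    qed
  qed
  moreover have "eval_form (TMR_incl \<A> P) Xs \<in> Cinf \<A>"
    if l: "length Xs = k" and Xs: "set Xs \<subseteq> sections (dual \<A> (TMR \<A>))" for Xs
  proof -
    let ?R = "\<lambda>\<gamma> x. ?r (\<gamma> x)"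
    have "?R \<gamma> \<in> sections (dual \<A> (TM \<A>))" if g: "\<gamma> \<in> sections (dual \<A> (TMR \<A>))" for \<gamma>
    proof (rule sections_dualI)
      show "?R \<gamma> x \<in> dual_space (fibre (TM \<A>) x)" for x
        using restrict_covector[of "\<gamma> x" x] sections_dualD(1)[OF g, of x] by simp
      show "(\<lambda>x. ?R \<gamma> x (X x)) \<in> Cinf \<A>" if "X \<in> sections (TM \<A>)" for X
        using sections_dualD(2)[OF g TM_section_inclusion[OF that]] .
    qed
    then have "eval_form P (map ?R Xs) \<in> Cinf \<A>"
      using Xs l by (intro forms_eval[OF P]) auto
    moreover have "eval_form (TMR_incl \<A> P) Xs = eval_form P (map ?R Xs)"
    proof -
      have "(\<lambda>\<gamma>. \<gamma> x) ` set Xs \<subseteq> dual_space (tangent_space \<A> x \<times> UNIV)" for x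
        using Xs sections_dualD(1)[of _ \<A> "TMR \<A>" x] by auto
      then show ?thesis by (simp add: fun_eq_iff eval_form_def TMR_incl_def comp_def)
    qed
    ultimately show ?thesis by simp
  qed
  ultimately show ?thesis by (simp add: forms_def)
qed

end

section \<open>The bracket of a quasi-Jacobi bialgebroid\<close>

lemma vec1_inject:
  assumes "dual_bases \<A> B" "X \<in> sections B" "Y \<in> sections B" "vec1 B X = vec1 B Y"
  shows "X = Y"
proof
  interpret dual_bases \<A> B by fact
  fix x
  show "X x = Y x"
  proof (rule dual_space_separates[of _ x])
    show "l (X x) = l (Y x)" if "l \<in> dual_space (fibre B x)" for l
      using fun_cong[OF fun_cong[OF assms(4), of x], of "[l]"] by (simp add: vec1_apply[OF that])
  qed (use assms(2,3) section_fibre in auto)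
qed

locale quasi_Jacobi = framed_bundle \<A> A \<Phi>
  for \<A> :: "('m::{t2_space, second_countable_topology}, 'e::euclidean_space) atlas"
    and A :: "('m, 'v::real_vector) vbundle" and \<Phi> +
  fixes a :: "('m, 'v) anchor" and br :: "('m, 'v) bracket" and S
    and as :: "('m, 'v \<Rightarrow> real) anchor" and brs :: "('m, 'v \<Rightarrow> real) bracket"
    and \<phi> :: "'m \<Rightarrow> 'v \<Rightarrow> real" and W :: "'m \<Rightarrow> 'v" and \<Psi> :: "('m, 'v) form"
  assumes qJ: "quasi_Jacobi_bialgebroid \<A> A a br S as brs \<phi> W \<Psi>"
begin

abbreviation dW where "dW \<equiv> twisted_differential \<A> (dual \<A> A) as brs (vec1 A W)"

lemma bialgebroid:
  shows \<phi>: "\<phi> \<in> sections (dual \<A> A)" and W: "W \<in> sections A" and \<Psi>: "\<Psi> \<in> forms \<A> A 3"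
    and lie: "lie_algebroid \<A> (dual \<A> A) as brs"
    and cocycle: "differential \<A> (dual \<A> A) as brs 1 (vec1 A W) = 0"
    and anch: "anchored_bracket \<A> A a br"
    and schouten: "schouten_bracket \<A> A a br S"
  using qJ unfolding quasi_Jacobi_bialgebroid_def Let_def by blast+

lemma anchor_of_bracket:
  assumes "X \<in> sections A" "Y \<in> sections A"
  shows "(\<lambda>x. a x (br X Y x)) =
    lie_bracket (\<lambda>x. a x (X x)) (\<lambda>x. a x (Y x)) - (\<lambda>x. as x (\<lambda>v. \<Psi> x [X x, Y x, v]))"
  using qJ assms unfolding quasi_Jacobi_bialgebroid_def Let_def by blast

lemma differential_\<phi>: "differential \<A> A a br 1 (form1 \<phi>) = contr W \<Psi>"
  using qJ unfolding quasi_Jacobi_bialgebroid_def Let_def by (simp only: right_minus_eq)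

lemma derivation:
  assumes "P \<in> multisections \<A> A p" "Q \<in> multisections \<A> A q"
  shows "dW (p + q - 1) (modified_bracket S \<phi> p P q Q) =
    modified_bracket S \<phi> (p + 1) (dW p P) q Q + (-1) ^ (p + 1) *\<^sub>R modified_bracket S \<phi> p P (q + 1) (dW q Q)"
  using qJ assms unfolding quasi_Jacobi_bialgebroid_def Let_def by blast

sublocale A: anchored_bundle \<A> A a br
  by unfold_locales (rule anch)

sublocale As: anchored_bundle \<A> "dual \<A> A" as brs
proof -
  interpret dual_bases \<A> "dual \<A> A" by (rule dual_bases_dual)
  show "anchored_bundle \<A> (dual \<A> A) as brs"
    using lie by unfold_locales (simp add: lie_algebroid_def)
qed

text \<open>\<open>dW 0 (form0 f)\<close> is a form on the dual bundle; the choice picks the section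
  representing it, which exists by \<open>multisection1_is_vec1\<close>.\<close>

definition ham :: "('m \<Rightarrow> real) \<Rightarrow> 'm \<Rightarrow> 'v" where
  "ham f = (SOME X. X \<in> sections A \<and> vec1 A X = dW 0 (form0 f))"

lemma \<phi>_dual: "\<phi> x \<in> dual_space (fibre A x)"
  by (rule sections_dualD(1)[OF \<phi>])

lemma W_fibre: "W x \<in> fibre A x"
  by (rule section_fibre[OF W])

lemma dW_0:
  assumes "f \<in> Cinf \<A>"
  shows "dW 0 (form0 f) = form1 (\<lambda>x l. if l \<in> dual_space (fibre A x) then as x l f else 0) +
    vec1 A (\<lambda>x. f x *\<^sub>R W x)"
proof -
  have "wedge 1 0 (vec1 A W) (form0 f) x vs = vec1 A (\<lambda>x. f x *\<^sub>R W x) x vs" for x vs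
  proof (cases "length vs = 1")
    case True
    then obtain l where "vs = [l]" by (auto simp: length_Suc_conv)
    then show ?thesis
      using dual_spaceD(2)[OF _ W_fibre[of x], of l "f x"]
      unfolding wedge_1_0 by (simp only: wedge_1_0) (simp add: vec1_def form1_def)
  next
    case False
    then show ?thesis by (auto simp: wedge_length vec1_def form1_def split: list.split)
  qed
  then have "wedge 1 0 (vec1 A W) (form0 f) = vec1 A (\<lambda>x. f x *\<^sub>R W x)" by blast
  then show ?thesis
    using As.differential_0[OF assms] by (simp only: twisted_differential_def fibre_dual)
qed

lemma dW_0_multisection:
  assumes "f \<in> Cinf \<A>"
  shows "dW 0 (form0 f) \<in> multisections \<A> A 1"
proof -
  have "form1 (\<lambda>x l. if l \<in> dual_space (fibre A x) then as x l f else 0) \<in> multisections \<A> A 1"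
    using form1_in_forms[OF As.anchor_covector[OF assms]] by simp
  moreover have "vec1 A (\<lambda>x. f x *\<^sub>R W x) \<in> multisections \<A> A 1"
    by (intro vec1_in_multisections section_smult assms W)
  ultimately show ?thesis
    unfolding dW_0[OF assms] by (intro forms_add) (simp_all add: subspace_dual_space)
qed

lemma ham:
  assumes "f \<in> Cinf \<A>"
  shows "ham f \<in> sections A" "vec1 A (ham f) = dW 0 (form0 f)"
    "l \<in> dual_space (fibre A x) \<Longrightarrow> l (ham f x) = as x l f + l (W x) * f x"
proof -
  obtain X where "X \<in> sections A \<and> vec1 A X = dW 0 (form0 f)"
    using multisection1_is_vec1[OF dW_0_multisection[OF assms]] by metis
  then have *: "ham f \<in> sections A \<and> vec1 A (ham f) = dW 0 (form0 f)"
    unfolding ham_def by (rule someI[of "\<lambda>X. X \<in> sections A \<and> vec1 A X = dW 0 (form0 f)"])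
  then show "ham f \<in> sections A" "vec1 A (ham f) = dW 0 (form0 f)" by auto
  assume l: "l \<in> dual_space (fibre A x)"
  have "vec1 A (ham f) x [l] = as x l f + l (f x *\<^sub>R W x)"
    unfolding conjunct2[OF *] dW_0[OF assms] using l by (simp add: form1_apply vec1_apply)
  then show "l (ham f x) = as x l f + l (W x) * f x"
    by (simp add: vec1_apply[OF l] dual_spaceD(2)[OF l W_fibre])
qed

definition D :: "('m \<Rightarrow> 'v) \<Rightarrow> ('m \<Rightarrow> real) \<Rightarrow> 'm \<Rightarrow> real" where
  "D X f x = a x (X x) f + \<phi> x (X x) * f x"

lemma D_Cinf:
  assumes "X \<in> sections A" "f \<in> Cinf \<A>"
  shows "D X f \<in> Cinf \<A>"
proof -
  have "D X f = (\<lambda>x. act a X f x + \<phi> x (X x) * f x)" by (simp add: D_def act_def fun_eq_iff)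
  then show ?thesis
    using assms A.act_Cinf[OF assms] sections_dualD(2)[OF \<phi>] by (auto intro!: Cinf_add Cinf_mult)
qed

definition bracket where "bracket f g = D (ham g) f"

lemma bracket_Cinf: "f \<in> Cinf \<A> \<Longrightarrow> g \<in> Cinf \<A> \<Longrightarrow> bracket f g \<in> Cinf \<A>"
  by (simp add: bracket_def D_Cinf ham)

lemma bracket_is_pairing:
  assumes "f \<in> Cinf \<A>" "g \<in> Cinf \<A>"
  shows "pairing (twisted_differential \<A> A a br (form1 \<phi>) 0 (form0 f)) (dW 0 (form0 g)) = bracket f g"
proof
  fix x
  let ?l = "\<lambda>v. (if v \<in> fibre A x then a x v f else 0) + \<phi> x v * f x"
  have l: "covector (twisted_differential \<A> A a br (form1 \<phi>) 0 (form0 f)) x = ?l"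
    by (simp add: covector_def twisted_differential_def A.differential_0[OF assms(1)] wedge_1_0[unfolded One_nat_def]
        form1_apply fun_eq_iff)
  have "?l = (\<lambda>v. if v \<in> fibre A x then a x v f else 0) + f x *\<^sub>R \<phi> x"
    by (simp add: fun_eq_iff mult.commute)
  then have "?l \<in> dual_space (fibre A x)"
    using sections_dualD(1)[OF A.anchor_covector[OF assms(1)], of x] \<phi>_dual[of x]
    by (simp only:) (intro subspace_add[OF subspace_dual_space] subspace_scale[OF subspace_dual_space])
  then show "pairing (twisted_differential \<A> A a br (form1 \<phi>) 0 (form0 f)) (dW 0 (form0 g)) x = bracket f g x"
    using section_fibre[OF ham(1)[OF assms(2)], of x]
    by (simp add: pairing_def l ham(2)[OF assms(2), symmetric] vec1_apply bracket_def D_def)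
qed

text \<open>In degrees 1 and 0 the first correction has coefficient 0 and the second has coefficient
  1, so the modification adds \<phi>(X) f to the action of the anchor.\<close>

lemma modified_section_function:
  assumes "X \<in> sections A" "f \<in> Cinf \<A>"
  shows "modified_bracket S \<phi> 1 (vec1 A X) 0 (form0 f) = form0 (D X f)"
proof -
  have "modified_bracket S \<phi> 1 (vec1 A X) 0 (form0 f) =
      form0 (act a X f) + wedge 0 0 (form0 (\<lambda>x. \<phi> x (X x))) (form0 f)"
    using schouten_section_function[OF schouten assms]
    by (simp add: modified_bracket_def contr_vec1[OF \<phi>_dual])
  also have "\<dots> = form0 (D X f)"
    unfolding wedge_0_0 by (auto simp: form0_def fun_eq_iff D_def act_def split: list.split)
  finally show ?thesis .
qed

lemma modified_function_section:
  assumes "X \<in> sections A" "f \<in> Cinf \<A>"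
  shows "modified_bracket S \<phi> 0 (form0 f) 1 (vec1 A X) = - form0 (D X f)"
proof -
  have "S 0 (form0 f) 1 (vec1 A X) = - form0 (act a X f)"
    using schouten_sym[OF schouten form0_in_forms[OF assms(2)] vec1_in_multisections[OF assms(1)]]
      schouten_section_function[OF schouten assms] by simp
  then have "modified_bracket S \<phi> 0 (form0 f) 1 (vec1 A X) =
      - form0 (act a X f) - wedge 0 0 (form0 f) (form0 (\<lambda>x. \<phi> x (X x)))"
    by (simp add: modified_bracket_def contr_vec1[OF \<phi>_dual])
  also have "\<dots> = - form0 (D X f)"
    unfolding wedge_0_0 by (auto simp: form0_def fun_eq_iff D_def act_def split: list.split)
  finally show ?thesis .
qed

lemma bracket_skew:
  assumes f: "f \<in> Cinf \<A>" and g: "g \<in> Cinf \<A>"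
  shows "bracket g f x = - bracket f g x"
proof -
  have "modified_bracket S \<phi> 0 (form0 f) 0 (form0 g) = 0"
    using schouten_functions[OF schouten f g] by (simp add: modified_bracket_def)
  moreover have "(0 :: ('m, 'v \<Rightarrow> real) form) = form0 (\<lambda>_. 0)"
    by (auto simp: form0_def fun_eq_iff split: list.split)
  ultimately have z: "modified_bracket S \<phi> 0 (form0 f) 0 (form0 g) = form0 (\<lambda>_. 0)" by simp
  \<comment> \<open>The truncated degree \<open>0 + 0 - 1\<close> is 0, so axiom 6 treats the
    vanishing bracket of two functions as the zero function.\<close>
  have "dW 0 (form0 (\<lambda>_. 0)) = modified_bracket S \<phi> 1 (vec1 A (ham f)) 0 (form0 g) +
      (-1) *\<^sub>R modified_bracket S \<phi> 0 (form0 f) 1 (vec1 A (ham g))"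
    using derivation[OF form0_in_forms[OF f] form0_in_forms[OF g]]
    by (simp add: z ham(2)[OF f] ham(2)[OF g])
  moreover have "dW 0 (form0 (\<lambda>_. 0)) x [] = 0"
    using alt_formsD(1)[OF forms_alt[OF dW_0_multisection[OF Cinf_const[of 0]]], of "[]" x] by simp
  ultimately show ?thesis
    unfolding modified_section_function[OF ham(1)[OF f] g] modified_function_section[OF ham(1)[OF g] f]
    by (simp add: bracket_def form0_def)
qed

lemma as_bracket:
  assumes "\<alpha> \<in> sections (dual \<A> A)" "\<beta> \<in> sections (dual \<A> A)"
  shows "as x (brs \<alpha> \<beta> x) f =
    as x (\<alpha> x) (\<lambda>y. as y (\<beta> y) f) - as x (\<beta> x) (\<lambda>y. as y (\<alpha> y) f)"
proof -
  have "(\<lambda>x. as x (brs \<alpha> \<beta> x)) = lie_bracket (\<lambda>x. as x (\<alpha> x)) (\<lambda>x. as x (\<beta> x))"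
    using lie assms unfolding lie_algebroid_def by blast
  from fun_cong[OF fun_cong[OF this, of x], of f] show ?thesis by (simp add: lie_bracket_def)
qed

lemma differential_dual_1:
  assumes X: "X \<in> sections A" and \<alpha>: "\<alpha> \<in> sections (dual \<A> A)" and \<beta>: "\<beta> \<in> sections (dual \<A> A)"
  shows "differential \<A> (dual \<A> A) as brs 1 (vec1 A X) x [\<alpha> x, \<beta> x] =
    as x (\<alpha> x) (\<lambda>x. \<beta> x (X x)) - as x (\<beta> x) (\<lambda>x. \<alpha> x (X x)) - brs \<alpha> \<beta> x (X x)"
  unfolding vec1_def
  using As.differential_1(2)[OF evaluation_in_bidual[OF X] \<alpha> \<beta>, of x] As.bracket(1)[OF \<alpha> \<beta>] \<alpha> \<beta>
  by (simp add: act_def sections_dualD(1))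

text \<open>The anchor of the dual bundle respects brackets, whence
  \<open>d\<^sub>* d\<^sub>* f = 0\<close>. Closedness of \<open>W\<close> reduces the differential
  of f W to the wedge of \<open>d\<^sub>* f\<close> with \<open>W\<close>, and this cancels against
  the twist, the wedge of \<open>W\<close> with \<open>d\<^sub>* f\<close>.\<close>

lemma dW_dW:
  assumes f: "f \<in> Cinf \<A>"
  shows "dW 1 (vec1 A (ham f)) = 0"
proof (rule As.forms_eqI)
  have "differential \<A> (dual \<A> A) as brs 1 (vec1 A (ham f)) \<in> multisections \<A> A 2"
    unfolding vec1_def by (rule As.differential_1(1)[OF evaluation_in_bidual[OF ham(1)[OF f]]])
  moreover have "wedge 1 1 (vec1 A W) (vec1 A (ham f)) \<in> multisections \<A> A 2"
    by (intro wedge_1_1_in_forms vec1_in_multisections W ham f)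
       (simp add: subspace_dual_space)
  ultimately show "dW 1 (vec1 A (ham f)) \<in> multisections \<A> A 2"
    unfolding twisted_differential_def
    by (intro forms_add) (simp_all add: subspace_dual_space)
  show "0 \<in> multisections \<A> A 2" by (rule zero_in_forms)
  fix Xs assume "length Xs = 2" and Xs: "set Xs \<subseteq> sections (dual \<A> A)"
  then obtain \<alpha> \<beta> where ab: "Xs = [\<alpha>, \<beta>]" "\<alpha> \<in> sections (dual \<A> A)" "\<beta> \<in> sections (dual \<A> A)"
    by (auto simp: numeral_2_eq_2 length_Suc_conv)
  have "dW 1 (vec1 A (ham f)) x [\<alpha> x, \<beta> x] = 0" for x
  proof -
    have W0: "as x (\<alpha> x) (\<lambda>x. \<beta> x (W x)) - as x (\<beta> x) (\<lambda>x. \<alpha> x (W x)) - brs \<alpha> \<beta> x (W x) = 0"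
      using differential_dual_1[OF W ab(2,3), of x] cocycle by simp
    have act: "as x (\<gamma> x) (\<lambda>x. \<delta> x (ham f x)) = as x (\<gamma> x) (\<lambda>y. as y (\<delta> y) f) +
        (\<delta> x (W x) * as x (\<gamma> x) f + as x (\<gamma> x) (\<lambda>y. \<delta> y (W y)) * f x)"
      if g: "\<gamma> \<in> sections (dual \<A> A)" and d: "\<delta> \<in> sections (dual \<A> A)" for \<gamma> \<delta>
    proof -
      note t = As.act_tangent[OF g]
      have c: "(\<lambda>y. as y (\<delta> y) f) \<in> Cinf \<A>" using As.act_Cinf[OF d f] by (simp add: act_def)
      have w: "(\<lambda>y. \<delta> y (W y)) \<in> Cinf \<A>" by (rule sections_dualD(2)[OF d W])
      have "(\<lambda>x. \<delta> x (ham f x)) = (\<lambda>y. as y (\<delta> y) f + \<delta> y (W y) * f y)"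
        using ham(3)[OF f sections_dualD(1)[OF d]] by blast
      then show ?thesis
        using tangent_add[OF t c Cinf_mult[OF w f]] tangent_mult[OF t w f] by simp
    qed
    have "brs \<alpha> \<beta> x (ham f x) = as x (brs \<alpha> \<beta> x) f + brs \<alpha> \<beta> x (W x) * f x"
      by (rule ham(3)[OF f sections_dualD(1)[OF As.bracket(1)[OF ab(2,3)]]])
    also have "brs \<alpha> \<beta> x (W x) = as x (\<alpha> x) (\<lambda>x. \<beta> x (W x)) - as x (\<beta> x) (\<lambda>x. \<alpha> x (W x))"
      using W0 by simp
    finally have "differential \<A> (dual \<A> A) as brs 1 (vec1 A (ham f)) x [\<alpha> x, \<beta> x] =
        \<beta> x (W x) * as x (\<alpha> x) f - \<alpha> x (W x) * as x (\<beta> x) f"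
      using differential_dual_1[OF ham(1)[OF f] ab(2,3), of x]
      by (simp add: act ab as_bracket algebra_simps)
    moreover have "wedge 1 1 (vec1 A W) (vec1 A (ham f)) x [\<alpha> x, \<beta> x] =
        \<alpha> x (W x) * as x (\<beta> x) f - \<beta> x (W x) * as x (\<alpha> x) f"
      using sections_dualD(1)[OF ab(2), of x] sections_dualD(1)[OF ab(3), of x]
      unfolding wedge_1_1 by (simp add: vec1_apply ham(3)[OF f] algebra_simps)
    ultimately show ?thesis unfolding twisted_differential_def by simp
  qed
  then show "eval_form (dW 1 (vec1 A (ham f))) Xs = eval_form 0 Xs"
    by (simp add: eval_form_def ab fun_eq_iff)
qed

lemma ham_bracket:
  assumes f: "f \<in> Cinf \<A>" and g: "g \<in> Cinf \<A>"
  shows "br (ham f) (ham g) = ham (bracket g f)"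
proof (rule vec1_inject[OF dual_bases_axioms])
  note X = ham(1)[OF f] and Y = ham(1)[OF g]
  have z: "0 \<in> multisections \<A> A 2" by (rule zero_in_forms)
  \<comment> \<open>Homogeneity is postulated in the second argument, so the zero multisection is
    put there and then moved to the front by symmetry.\<close>
  have "S 0 (form0 g) 2 0 = 0"
    using schouten_scaleR[OF schouten form0_in_forms[OF g] z, of 0] by (simp only: scaleR_zero_left)
  then have "S 2 0 0 (form0 g) = 0"
    using schouten_sym[OF schouten z form0_in_forms[OF g]] by (simp only: scaleR_zero_right minus_zero)
  then have z2: "modified_bracket S \<phi> 2 0 0 (form0 g) = 0"
    by (simp add: modified_bracket_def)
  have "dW (1 + 0 - 1) (modified_bracket S \<phi> 1 (vec1 A (ham f)) 0 (form0 g)) =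
      modified_bracket S \<phi> (1 + 1) (dW 1 (vec1 A (ham f))) 0 (form0 g) +
      (-1) ^ (1 + 1) *\<^sub>R modified_bracket S \<phi> 1 (vec1 A (ham f)) (0 + 1) (dW 0 (form0 g))"
    by (rule derivation[OF vec1_in_multisections[OF X] form0_in_forms[OF g]])
  moreover have "modified_bracket S \<phi> 1 (vec1 A (ham f)) 0 (form0 g) = form0 (bracket g f)"
    using modified_section_function[OF X g] by (simp add: bracket_def)
  moreover have "modified_bracket S \<phi> 1 (vec1 A (ham f)) 1 (vec1 A (ham g)) = vec1 A (br (ham f) (ham g))"
    using schouten_sections[OF schouten X Y] by (simp add: modified_bracket_def)
  moreover have "1 + 0 - 1 = (0::nat)" "1 + 1 = (2::nat)" "0 + 1 = (1::nat)" "(-1::real) ^ (1 + 1) = 1"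
    by simp_all
  ultimately have "dW 0 (form0 (bracket g f)) = 0 + vec1 A (br (ham f) (ham g))"
    by (simp only: dW_dW[OF f] z2 ham(2)[OF g, symmetric] scaleR_one)
  then show "vec1 A (br (ham f) (ham g)) = vec1 A (ham (bracket g f))"
    using ham(2)[OF bracket_Cinf[OF g f]] by simp
  show "br (ham f) (ham g) \<in> sections A" by (rule A.bracket(1)[OF X Y])
  show "ham (bracket g f) \<in> sections A" by (rule ham(1)[OF bracket_Cinf[OF g f]])
qed

lemma \<Psi>_swap:
  assumes "u \<in> fibre A x" "v \<in> fibre A x" "w \<in> fibre A x"
  shows "\<Psi> x [u, v, w] = \<Psi> x [w, u, v]"
  using alt_forms_swap[OF forms_alt[OF \<Psi>] fibre_subspace assms(2,3), of "[u]" "[]"]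
    alt_forms_swap[OF forms_alt[OF \<Psi>] fibre_subspace assms(1,3), of "[]" "[v]"] assms by simp

lemma \<Psi>_covector:
  assumes "u \<in> fibre A x" "v \<in> fibre A x"
  shows "(\<lambda>w. \<Psi> x [u, v, w]) \<in> dual_space (fibre A x)"
proof -
  note D = alt_formsD[OF forms_alt[OF \<Psi>, where x = x]]
  have "\<Psi> x [u, v, w + z] = \<Psi> x [u, v, w] + \<Psi> x [u, v, z]" if "w \<in> fibre A x" "z \<in> fibre A x" for w z
    using D(2)[of w z "[u, v]" "[]"] that assms by simp
  moreover have "\<Psi> x [u, v, c *\<^sub>R w] = c * \<Psi> x [u, v, w]" if "w \<in> fibre A x" for c w
    using D(3)[of w "[u, v]" "[]" c] that assms by simp
  moreover have "\<Psi> x [u, v, w] = 0" if "w \<notin> fibre A x" for w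
    using D(1)[of "[u, v, w]"] that by simp
  ultimately show ?thesis unfolding dual_space_def by blast
qed

lemma D_D:
  assumes X: "X \<in> sections A" and Y: "Y \<in> sections A" and f: "f \<in> Cinf \<A>"
  shows "D X (D Y f) x = a x (X x) (\<lambda>y. a y (Y y) f) +
    (\<phi> x (Y x) * a x (X x) f + a x (X x) (\<lambda>y. \<phi> y (Y y)) * f x) + \<phi> x (X x) * D Y f x"
proof -
  note t = A.act_tangent[OF X]
  have c: "(\<lambda>y. a y (Y y) f) \<in> Cinf \<A>" using A.act_Cinf[OF Y f] by (simp add: act_def)
  have w: "(\<lambda>y. \<phi> y (Y y)) \<in> Cinf \<A>" by (rule sections_dualD(2)[OF \<phi> Y])
  have "D Y f = (\<lambda>y. a y (Y y) f + \<phi> y (Y y) * f y)" by (simp add: D_def fun_eq_iff)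
  then have "a x (X x) (D Y f) = a x (X x) (\<lambda>y. a y (Y y) f) +
      (\<phi> x (Y x) * a x (X x) f + a x (X x) (\<lambda>y. \<phi> y (Y y)) * f x)"
    using tangent_add[OF t c Cinf_mult[OF w f]] tangent_mult[OF t w f] by simp
  then show ?thesis by (simp add: D_def[of X "D Y f"])
qed

text \<open>The curvature of the operators \<^term>\<open>D X\<close>: the terms of axioms 2 and 4 that contain
  \<^term>\<open>\<Psi>\<close> combine to the pairing of \<open>\<Psi>(X, Y, \<cdot>)\<close> with \<^term>\<open>ham f\<close>.\<close>

lemma D_bracket:
  assumes X: "X \<in> sections A" and Y: "Y \<in> sections A" and f: "f \<in> Cinf \<A>"
  shows "D (br X Y) f x = D X (D Y f) x - D Y (D X f) x - \<Psi> x [X x, Y x, ham f x]"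
proof -
  note fib = section_fibre[OF X, of x] section_fibre[OF Y, of x]
  have "a x (br X Y x) f = a x (X x) (\<lambda>y. a y (Y y) f) - a x (Y x) (\<lambda>y. a y (X y) f) -
      as x (\<lambda>v. \<Psi> x [X x, Y x, v]) f"
    using fun_cong[OF fun_cong[OF anchor_of_bracket[OF X Y], of x], of f] by (simp add: lie_bracket_def)
  moreover have "a x (X x) (\<lambda>y. \<phi> y (Y y)) - a x (Y x) (\<lambda>y. \<phi> y (X y)) - \<phi> x (br X Y x) =
      \<Psi> x [W x, X x, Y x]"
    using A.differential_1(2)[OF \<phi> X Y, of x] unfolding differential_\<phi> by (simp add: contr_def act_def)
  moreover have "\<Psi> x [X x, Y x, ham f x] = as x (\<lambda>v. \<Psi> x [X x, Y x, v]) f + \<Psi> x [W x, X x, Y x] * f x"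
    using ham(3)[OF f \<Psi>_covector[OF fib]] \<Psi>_swap[OF fib W_fibre] by simp
  ultimately show ?thesis
    using D_D[OF X Y f, of x] D_D[OF Y X f, of x]
    by (simp add: D_def[of _ f] algebra_simps)
qed

lemma bracket_cong_minus:
  assumes "u \<in> Cinf \<A>" "v \<in> Cinf \<A>" "w \<in> Cinf \<A>"
  shows "bracket (bracket v u) w x = - bracket (bracket u v) w x"
proof -
  have "bracket v u = (\<lambda>y. - bracket u v y)" using bracket_skew[OF assms(1,2)] by blast
  then show ?thesis
    using tangent_minus[OF A.act_tangent[OF ham(1)[OF assms(3)]] bracket_Cinf[OF assms(1,2)]]
    by (simp add: bracket_def[of "bracket v u"] bracket_def[of "bracket u v"] D_def
        bracket_def[of "\<lambda>y. - bracket u v y"])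
qed

text \<open>The curvature formula for \<open>ham f\<close> and \<open>ham g\<close> is applied to
  \<open>h\<close>; its left-hand side is an iterated bracket because the bracket of the two
  sections is again some \<open>ham\<close>. Skew symmetry then gives the cyclic order.\<close>

lemma jacobiator:
  assumes f: "f \<in> Cinf \<A>" and g: "g \<in> Cinf \<A>" and h: "h \<in> Cinf \<A>"
  shows "bracket (bracket f g) h x + bracket (bracket g h) f x + bracket (bracket h f) g x =
    - \<Psi> x [ham f x, ham g x, ham h x]"
proof -
  have "bracket h (bracket g f) x = D (br (ham f) (ham g)) h x"
    by (simp add: ham_bracket[OF f g] bracket_def)
  also have "\<dots> = bracket (bracket h g) f x - bracket (bracket h f) g x -
      \<Psi> x [ham f x, ham g x, ham h x]"
    using D_bracket[OF ham(1)[OF f] ham(1)[OF g] h] by (simp add: bracket_def)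
  finally show ?thesis
    using bracket_skew[OF bracket_Cinf[OF g f] h, of x] bracket_cong_minus[OF g h f, of x]
      bracket_cong_minus[OF f g h, of x] by simp
qed

end

section \<open>The bivector field, the vector field and the quasi-Jacobi equation\<close>

context quasi_Jacobi
begin

definition transpose_as :: "'m \<Rightarrow> ((('m \<Rightarrow> real) \<Rightarrow> real) \<Rightarrow> real) \<Rightarrow> 'v" where
  "transpose_as x \<mu> = (THE v. v \<in> fibre A x \<and> (\<forall>l\<in>dual_space (fibre A x). l v = \<mu> (as x l)))"

lemma transpose_as:
  assumes \<mu>: "\<mu> \<in> dual_space (tangent_space \<A> x)"
  shows "transpose_as x \<mu> \<in> fibre A x"
    "l \<in> dual_space (fibre A x) \<Longrightarrow> l (transpose_as x \<mu>) = \<mu> (as x l)"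
proof -
  let ?P = "\<lambda>l. if l \<in> dual_space (fibre A x) then \<mu> (as x l) else 0"
  note as = As.anchor(1-3)[where x = x, unfolded fibre_dual]
  have "?P \<in> dual_space (dual_space (fibre A x))"
    using subspace_dual_space[of "fibre A x"]
    by (auto simp: dual_space_def[of "dual_space _"] subspace_add subspace_scale as dual_spaceD[OF \<mu>])
  note rep = bidual_representative[OF this]
  have "(\<forall>l\<in>dual_space (fibre A x). l v = ?P l) \<longleftrightarrow> (\<forall>l\<in>dual_space (fibre A x). l v = \<mu> (as x l))" for v
    by simp
  with rep have "\<exists>!v. v \<in> fibre A x \<and> (\<forall>l\<in>dual_space (fibre A x). l v = \<mu> (as x l))"
    by (simp only:)
  then have "transpose_as x \<mu> \<in> fibre A x \<and> (\<forall>l\<in>dual_space (fibre A x). l (transpose_as x \<mu>) = \<mu> (as x l))"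
    unfolding transpose_as_def by (rule theI')
  then show "transpose_as x \<mu> \<in> fibre A x"
    "l \<in> dual_space (fibre A x) \<Longrightarrow> l (transpose_as x \<mu>) = \<mu> (as x l)" by auto
qed

lemma deRham_dual: "deRham \<A> f x \<in> dual_space (tangent_space \<A> x)"
  using subspace_tangent_space[of x]
  by (auto simp: deRham_def dual_space_def subspace_add subspace_scale)

text \<open>\<open>ham f\<close> is the untwisted differential of \<open>f\<close> plus f W, and the
  transpose of \<open>as\<close> turns the de Rham differential into the untwisted one.\<close>

lemma transpose_as_deRham:
  assumes f: "f \<in> Cinf \<A>"
  shows "transpose_as x (deRham \<A> f x) = ham f x - f x *\<^sub>R W x"
proof (rule dual_space_separates[of _ x])
  note h = section_fibre[OF ham(1)[OF f], of x] and W' = subspace_scale[OF fibre_subspace W_fibre, of "f x" x]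
  show "transpose_as x (deRham \<A> f x) \<in> fibre A x" by (rule transpose_as[OF deRham_dual])
  show "ham f x - f x *\<^sub>R W x \<in> fibre A x" by (rule subspace_diff[OF fibre_subspace h W'])
  fix l assume l: "l \<in> dual_space (fibre A x)"
  have "l (ham f x) = l (ham f x - f x *\<^sub>R W x) + l (f x *\<^sub>R W x)"
    using dual_spaceD(1)[OF l subspace_diff[OF fibre_subspace h W'] W'] by simp
  moreover have "deRham \<A> f x (as x l) = as x l f"
    using As.anchor(1)[of l x] l by (simp add: deRham_def)
  ultimately show "l (transpose_as x (deRham \<A> f x)) = l (ham f x - f x *\<^sub>R W x)"
    using transpose_as(2)[OF deRham_dual l] ham(3)[OF f l] dual_spaceD(2)[OF l W_fibre, of "f x"] by simp
qed

definition E :: "'m \<Rightarrow> ('m \<Rightarrow> real) \<Rightarrow> real" where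
  "E x = as x (\<phi> x)"

lemma E_section: "E \<in> sections (TM \<A>)"
  using As.anchor(4)[OF \<phi>] by (simp add: E_def[abs_def])

lemma bracket_one_one: "bracket (\<lambda>_. 1) (\<lambda>_. 1) x = 0"
  using bracket_skew[OF Cinf_const[of 1] Cinf_const[of 1], of x] by simp

text \<open>Anchors kill constants, so only the twist survives. Skew symmetry of the bracket against
  the function 1 then yields \<open>\<phi>_W\<close> and \<open>anchor_W\<close>.\<close>

lemma ham_one: "ham (\<lambda>_. 1) x = W x"
proof (rule dual_space_separates[of _ x])
  show "l (ham (\<lambda>_. 1) x) = l (W x)" if l: "l \<in> dual_space (fibre A x)" for l
    using ham(3)[OF Cinf_const l, of 1] tangent_const[of "as x l" x 1] As.anchor(1)[of l x] l by simp
qed (use W_fibre section_fibre[OF ham(1)[OF Cinf_const]] in auto)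

lemma \<phi>_W: "\<phi> x (W x) = 0"
  using bracket_one_one[of x] tangent_const[OF A.act_tangent[OF W], of x 1]
  by (simp add: bracket_def D_def ham_one)

lemma \<phi>_ham: "f \<in> Cinf \<A> \<Longrightarrow> \<phi> x (ham f x) = E x f"
  using ham(3)[OF _ \<phi>_dual, of f x] by (simp add: \<phi>_W E_def)

text \<open>{1, f} is E(f), while {f, 1} is the action of \<open>W\<close> on \<open>f\<close>; skew
  symmetry thus identifies the two descriptions of \<open>E\<close>.\<close>

lemma anchor_W: "f \<in> Cinf \<A> \<Longrightarrow> a x (W x) f = - E x f"
  using bracket_skew[OF Cinf_const[of 1], of f x] tangent_const[OF A.act_tangent[OF ham(1)], of f x 1]
  by (simp add: bracket_def D_def ham_one \<phi>_W \<phi>_ham)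

text \<open>The anchor of \<open>A\<close> composed with the transpose of the anchor of its dual, so
  that on de Rham differentials it pairs the untwisted differentials of two functions. Being defined
  on covectors, it is tensorial by construction.\<close>

definition \<Lambda> :: "('m, (('m \<Rightarrow> real) \<Rightarrow> real) \<Rightarrow> real) form" where
  "\<Lambda> x \<mu>s = (if length \<mu>s = 2 \<and> set \<mu>s \<subseteq> dual_space (tangent_space \<A> x)
     then (\<mu>s ! 0) (a x (transpose_as x (\<mu>s ! 1))) else 0)"

lemma bracket_decomposition:
  assumes f: "f \<in> Cinf \<A>" and g: "g \<in> Cinf \<A>"
  shows "bracket f g x = \<Lambda> x [deRham \<A> f x, deRham \<A> g x] + f x * E x g - g x * E x f"
proof -
  note h = section_fibre[OF ham(1)[OF g], of x] and W' = subspace_scale[OF fibre_subspace W_fibre, of "- g x" x]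
  have "a x (ham g x - g x *\<^sub>R W x) = a x (ham g x) + (- g x) *\<^sub>R a x (W x)"
    using A.anchor(2)[OF h W'] A.anchor(3)[OF W_fibre, of x "- g x"] by simp
  moreover have "a x (ham g x - g x *\<^sub>R W x) \<in> tangent_space \<A> x"
    using A.anchor(1)[OF subspace_add[OF fibre_subspace h W']] by simp
  ultimately have "\<Lambda> x [deRham \<A> f x, deRham \<A> g x] = a x (ham g x) f - g x * a x (W x) f"
  proof -
    assume t: "a x (ham g x - g x *\<^sub>R W x) = a x (ham g x) + (- g x) *\<^sub>R a x (W x)"
      "a x (ham g x - g x *\<^sub>R W x) \<in> tangent_space \<A> x"
    have "\<Lambda> x [deRham \<A> f x, deRham \<A> g x] = deRham \<A> f x (a x (ham g x - g x *\<^sub>R W x))"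
      by (simp add: \<Lambda>_def deRham_dual transpose_as_deRham[OF g])
    also have "\<dots> = a x (ham g x - g x *\<^sub>R W x) f" using t(2) by (simp add: deRham_def)
    finally show ?thesis by (simp add: t(1))
  qed
  then show ?thesis
    using anchor_W[OF f] \<phi>_ham[OF g] by (simp add: bracket_def D_def)
qed

lemma \<Lambda>_multisection: "\<Lambda> \<in> multisections \<A> (TM \<A>) 2"
proof -
  let ?b = "\<lambda>x \<mu> \<nu>. \<mu> (a x (transpose_as x \<nu>))"
  let ?V = "\<lambda>x. dual_space (tangent_space \<A> x)"
  \<comment> \<open>Skew symmetry is imported from the bracket, evaluated on functions that vanish
    at \<open>x\<close>.\<close>
  have skew: "?b x \<mu> \<nu> = - ?b x \<nu> \<mu>" if \<mu>: "\<mu> \<in> ?V x" and \<nu>: "\<nu> \<in> ?V x" for x \<mu> \<nu>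
  proof -
    obtain f where f: "f \<in> Cinf \<A>" "f x = 0" "deRham \<A> f x = \<mu>" using covector_TM[OF \<mu>] .
    obtain g where g: "g \<in> Cinf \<A>" "g x = 0" "deRham \<A> g x = \<nu>" using covector_TM[OF \<nu>] .
    show ?thesis
      using bracket_skew[OF f(1) g(1), of x] bracket_decomposition[OF f(1) g(1), of x]
        bracket_decomposition[OF g(1) f(1), of x] f g \<mu> \<nu> by (simp add: \<Lambda>_def)
  qed
  have "\<Lambda> x \<in> alt_forms (?V x) 2" for x
    unfolding \<Lambda>_def
  proof (rule bilinear_alt_forms[where b = "?b x"])
    show "?b x (u + v) z = ?b x u z + ?b x v z" for u v z by simp
    show "?b x (c *\<^sub>R v) z = c * ?b x v z" for c v z by simp
    \<comment> \<open>Linearity in the transposed slot is also read off from skew symmetry.\<close>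
    show "?b x z (u + v) = ?b x z u + ?b x z v" if "u \<in> ?V x" "v \<in> ?V x" "z \<in> ?V x" for u v z
      using skew[OF that(3,1)] skew[OF that(3,2)] skew[OF that(3) subspace_add[OF subspace_dual_space that(1,2)]]
      by simp
    show "?b x z (c *\<^sub>R v) = c * ?b x z v" if "v \<in> ?V x" "z \<in> ?V x" for c v z
      using skew[OF that(2,1)] skew[OF that(2) subspace_scale[OF subspace_dual_space that(1), of c]] by simp
    show "?b x v v = 0" if "v \<in> ?V x" for v using skew[OF that that] by simp
  qed (rule subspace_dual_space)
  moreover have "eval_form \<Lambda> Xs \<in> Cinf \<A>"
    if l: "length Xs = 2" and Xs: "set Xs \<subseteq> sections (dual \<A> (TM \<A>))" for Xs
  proof -
    obtain \<mu> \<nu> where X: "Xs = [\<mu>, \<nu>]" using l by (auto simp: numeral_2_eq_2 length_Suc_conv)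
    then have s: "\<mu> \<in> sections (dual \<A> (TM \<A>))" "\<nu> \<in> sections (dual \<A> (TM \<A>))" using Xs by auto
    have d: "\<mu> x \<in> ?V x" "\<nu> x \<in> ?V x" for x
      using sections_dualD(1)[OF s(1), of x] sections_dualD(1)[OF s(2), of x] by auto
    have "(\<lambda>x. transpose_as x (\<nu> x)) \<in> sections A"
    proof (rule section_if_pairings_smooth)
      show "transpose_as x (\<nu> x) \<in> fibre A x" for x by (rule transpose_as[OF d(2)])
      show "(\<lambda>x. \<alpha> x (transpose_as x (\<nu> x))) \<in> Cinf \<A>" if "\<alpha> \<in> sections (dual \<A> A)" for \<alpha>
        using sections_dualD(2)[OF s(2) As.anchor(4)[OF that]]
        by (simp add: transpose_as(2)[OF d(2) sections_dualD(1)[OF that]])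
    qed
    from sections_dualD(2)[OF s(1) A.anchor(4)[OF this]]
    show ?thesis using d by (simp add: X eval_form_def \<Lambda>_def)
  qed
  ultimately show ?thesis by (simp add: forms_def)
qed

definition J :: "('m, (('m \<Rightarrow> real) \<Rightarrow> real) \<times> real \<Rightarrow> real) form" where
  "J = TMR_pair \<A> 2 \<Lambda> (vec1 (TM \<A>) E)"

lemma unit_section: "TMR_unit \<in> sections (TMR \<A>)"
proof -
  have "(\<lambda>x. 0) \<in> sections (TM \<A>)"
    using subspace_0[OF subspace_tangent_space] by (simp add: sections_TM_iff)
  then show ?thesis by (simp add: sections_TMR_iff TMR_unit_def)
qed

lemma J_eq: "J = TMR_incl \<A> \<Lambda> + bivector TMR_unit (\<lambda>x. (E x, 0))"
  unfolding J_def TMR_pair_def TMR_incl_vec1 by simp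

lemma J_multisection: "J \<in> multisections \<A> (TMR \<A>) 2"
  unfolding J_eq
  using TMR_incl_multisection[OF \<Lambda>_multisection]
    bivector_multisection[OF unit_section TM_section_inclusion[OF E_section]]
  by (intro forms_add) (simp_all add: subspace_dual_space)

lemma J_jets:
  assumes f: "f \<in> Cinf \<A>" and g: "g \<in> Cinf \<A>"
  shows "J x [jet \<A> f x, jet \<A> g x] = bracket f g x"
proof -
  have "TMR_incl \<A> \<Lambda> x [jet \<A> f x, jet \<A> g x] = \<Lambda> x [deRham \<A> f x, deRham \<A> g x]"
    using jet_in_dual_space[of f x] jet_in_dual_space[of g x] by (simp add: TMR_incl_def jet_restrict)
  then show ?thesis
    using bivector_jets[OF unit_section TM_section_inclusion[OF E_section], of x f g]
    unfolding J_eq bracket_decomposition[OF f g]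
    by (simp add: first_order_wedge_def first_order_def TMR_unit_def)
qed

text \<open>The two components of \<open>anchor_W as W\<close> meet the derivative and the value of
  \<open>f\<close> in the jet, and their sum is the formula for \<open>ham f\<close>. This turns
  \<open>exterior_map\<close> on jets into \<Psi> on sections \<open>ham\<close>.\<close>

lemma transpose_map_jet:
  assumes f: "f \<in> Cinf \<A>"
  shows "transpose_map A (anchor_W as W) x (jet \<A> f x) = ham f x"
  unfolding transpose_map_def
proof (rule the_equality)
  have j: "jet \<A> f x (anchor_W as W x l) = l (ham f x)" if l: "l \<in> dual_space (fibre A x)" for l
    using As.anchor(1)[of l x] l ham(3)[OF f l] by (simp add: jet_def anchor_W_def)
  show "ham f x \<in> fibre A x \<and> (\<forall>\<alpha>\<in>dual_space (fibre A x). \<alpha> (ham f x) = jet \<A> f x (anchor_W as W x \<alpha>))"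
    using section_fibre[OF ham(1)[OF f]] j by simp
  show "v = ham f x" if "v \<in> fibre A x \<and> (\<forall>\<alpha>\<in>dual_space (fibre A x). \<alpha> v = jet \<A> f x (anchor_W as W x \<alpha>))" for v
    by (rule dual_space_separates[of _ x]) (use that j section_fibre[OF ham(1)[OF f]] in auto)
qed

lemma quasi_Jacobi_identity:
  assumes T: "schouten_bracket \<A> (TMR \<A>) TMR_anchor TMR_bracket T"
    and f: "f \<in> Cinf \<A>" and g: "g \<in> Cinf \<A>" and h: "h \<in> Cinf \<A>"
  shows "((1 / 2) *\<^sub>R modified_bracket T (TMR_cocycle \<A>) 2 J 2 J) x [jet \<A> f x, jet \<A> g x, jet \<A> h x] =
    \<Psi> x [ham f x, ham g x, ham h x]"
proof -
  interpret T: TMR_schouten \<A> T by unfold_locales (rule T)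
  obtain n e \<epsilon> \<rho> where fr: "cutoff_dual_frames \<A> A x n e \<epsilon> \<rho>" using dual_frames by blast
  note fr = cutoff_dual_framesD[OF fr]
  let ?x = "\<lambda>i y. (a y (e i y), \<phi> y (e i y))" and ?y = "\<lambda>i y. (as y (\<epsilon> i y), \<epsilon> i y (W y))"
  have xs: "?x i \<in> sections (TMR \<A>)" if "i < n" for i
    using A.anchor(4)[OF fr(1)[OF that]] sections_dualD(2)[OF \<phi> fr(1)[OF that]] by (simp add: sections_TMR_iff)
  have ys: "?y i \<in> sections (TMR \<A>)" if "i < n" for i
    using As.anchor(4)[OF fr(2)[OF that]] sections_dualD(2)[OF fr(2)[OF that] W] by (simp add: sections_TMR_iff)
  \<comment> \<open>The covector of the twisted differential of \<open>u\<close> is applied to the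
    expansion of \<open>ham v\<close> in the cut-off frame.\<close>
  have half: "(\<Sum>i<n. first_order (?x i) u y * first_order (?y i) v y) = (1 - (\<rho> y)\<^sup>2) * bracket u v y"
    if u: "u \<in> Cinf \<A>" and v: "v \<in> Cinf \<A>" for u v y
  proof -
    have eu: "(\<lambda>w. if w \<in> fibre A y then a y w u + u y * \<phi> y w else 0) \<in> dual_space (fibre A y)" (is "?l \<in> _")
      using subspace_add[OF fibre_subspace] subspace_scale[OF fibre_subspace]
      by (auto simp: dual_space_def A.anchor dual_spaceD[OF \<phi>_dual] algebra_simps)
    have ef: "e i y \<in> fibre A y" if "i < n" for i by (rule section_fibre[OF fr(1)[OF that]])
    note hv = section_fibre[OF ham(1)[OF v], of y]
    have "(\<Sum>i<n. first_order (?x i) u y * first_order (?y i) v y) = (\<Sum>i<n. \<epsilon> i y (ham v y) * ?l (e i y))"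
      using ef ham(3)[OF v sections_dualD(1)[OF fr(2)]]
      by (intro sum.cong refl) (simp add: first_order_def mult.commute)
    also have "\<dots> = ?l (\<Sum>i<n. \<epsilon> i y (ham v y) *\<^sub>R e i y)"
      using ef by (intro dual_space_sum[OF eu fibre_subspace, symmetric]) simp
    also have "\<dots> = (1 - (\<rho> y)\<^sup>2) * ?l (ham v y)"
      unfolding fr(5)[OF hv] by (rule dual_spaceD(2)[OF eu hv])
    also have "?l (ham v y) = bracket u v y" using hv by (simp add: bracket_def D_def mult.commute)
    finally show ?thesis .
  qed
  \<comment> \<open>Antisymmetrising doubles the sum, as the bracket is skew symmetric.\<close>
  have decomp: "(\<Sum>i<n. first_order_wedge (?x i) (?y i) u v y) = 2 * ((1 - (\<rho> y)\<^sup>2) * bracket u v y)"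
    if "u \<in> Cinf \<A>" "v \<in> Cinf \<A>" for u v y
    using half[OF that, of y] half[OF that(2,1), of y] bracket_skew[OF that, of y]
    by (simp add: first_order_wedge_def sum_subtractf mult.commute algebra_simps)
  have j: "bracket u v = (\<lambda>y. J y [jet \<A> u y, jet \<A> v y])" if "u \<in> Cinf \<A>" "v \<in> Cinf \<A>" for u v
    using J_jets[OF that] by simp
  have T: "T 2 J 2 J x [jet \<A> f x, jet \<A> g x, jet \<A> h x] =
      - 2 * (- \<Psi> x [ham f x, ham g x, ham h x] +
        bracket f g x * bracket (\<lambda>_. 1) h x + bracket g h x * bracket (\<lambda>_. 1) f x +
        bracket h f x * bracket (\<lambda>_. 1) g x)"
    using T.T_jets[where J = J and \<rho> = \<rho> and x = x and n = n and xs = ?x and ys = ?y and j = bracket,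
        OF J_multisection fr(3,4) xs ys j decomp f g h] jacobiator[OF f g h, of x] by simp
  have c: "contr (TMR_cocycle \<A>) J x [jet \<A> u x] = bracket (\<lambda>_. 1) u x" if "u \<in> Cinf \<A>" for u
    using J_jets[OF Cinf_const that] by (simp add: contr_def cocycle_is_jet)
  \<comment> \<open>In degrees 2 and 2 both corrections have coefficient 1. Each contributes the
    cyclic sum once, and together they cancel the products with {1, .} in \<open>T\<close>.\<close>
  have w: "wedge 2 1 J (contr (TMR_cocycle \<A>) J) x [jet \<A> f x, jet \<A> g x, jet \<A> h x] =
      bracket f g x * bracket (\<lambda>_. 1) h x + bracket g h x * bracket (\<lambda>_. 1) f x + bracket h f x * bracket (\<lambda>_. 1) g x"
    "wedge 1 2 (contr (TMR_cocycle \<A>) J) J x [jet \<A> f x, jet \<A> g x, jet \<A> h x] =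
      bracket f g x * bracket (\<lambda>_. 1) h x + bracket g h x * bracket (\<lambda>_. 1) f x + bracket h f x * bracket (\<lambda>_. 1) g x"
    unfolding wedge_2_1 wedge_1_2
    using bracket_skew[OF f g, of x] bracket_skew[OF g h, of x] bracket_skew[OF h f, of x]
    by (simp_all add: J_jets c f g h algebra_simps)
  have "modified_bracket T (TMR_cocycle \<A>) 2 J 2 J =
      T 2 J 2 J + wedge 2 1 J (contr (TMR_cocycle \<A>) J) + wedge 1 2 (contr (TMR_cocycle \<A>) J) J"
    by (simp add: modified_bracket_def)
  then show ?thesis using T w by simp
qed

text \<open>Every covector of TM x R is a jet, so the identity on jets covers all arguments in the
  fibre; elsewhere both sides take the default 0.\<close>

lemma quasi_Jacobi_equation:
  assumes T: "schouten_bracket \<A> (TMR \<A>) TMR_anchor TMR_bracket T"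
  shows "(1 / 2) *\<^sub>R modified_bracket T (TMR_cocycle \<A>) 2 J 2 J = exterior_map A (TMR \<A>) (anchor_W as W) \<Psi>"
proof (intro ext)
  fix x \<gamma>s
  let ?V = "dual_space (fibre (TMR \<A>) x)"
  let ?L = "(1 / 2) *\<^sub>R modified_bracket T (TMR_cocycle \<A>) 2 J 2 J"
  show "?L x \<gamma>s = exterior_map A (TMR \<A>) (anchor_W as W) \<Psi> x \<gamma>s"
  proof (cases "length \<gamma>s = 3 \<and> set \<gamma>s \<subseteq> ?V")
    case True
    then obtain \<alpha> \<beta> \<gamma> where g: "\<gamma>s = [\<alpha>, \<beta>, \<gamma>]" by (auto simp: numeral_3_eq_3 length_Suc_conv)
    then have "\<alpha> \<in> ?V" "\<beta> \<in> ?V" "\<gamma> \<in> ?V" using True by auto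
    then obtain f1 f2 f3 where "f1 \<in> Cinf \<A>" "jet \<A> f1 x = \<alpha>" "f2 \<in> Cinf \<A>" "jet \<A> f2 x = \<beta>"
      "f3 \<in> Cinf \<A>" "jet \<A> f3 x = \<gamma>"
      using covector_is_jet by metis
    then show ?thesis
      using quasi_Jacobi_identity[OF T, of f1 f2 f3 x] True
      by (simp add: g exterior_map_def transpose_map_jet[symmetric])
  next
    case False
    have "T 2 J 2 J \<in> multisections \<A> (TMR \<A>) 3"
      using schouten_closed[OF T J_multisection J_multisection] by simp
    then have 1: "T 2 J 2 J x \<gamma>s = 0"
      using alt_formsD(1)[OF forms_alt, of _ _ _ 3 \<gamma>s x] False by fastforce
    have out: "J x \<delta>s = 0" if "\<not> set \<delta>s \<subseteq> ?V" for \<delta>s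
      using alt_formsD(1)[OF forms_alt[OF J_multisection], of \<delta>s x] that by simp
    have 2: "wedge 2 1 J (contr (TMR_cocycle \<A>) J) x \<gamma>s = 0 \<and> wedge 1 2 (contr (TMR_cocycle \<A>) J) J x \<gamma>s = 0"
    proof (cases "length \<gamma>s = 3")
      case True
      then obtain \<alpha> \<beta> \<gamma> where g: "\<gamma>s = [\<alpha>, \<beta>, \<gamma>]" by (auto simp: numeral_3_eq_3 length_Suc_conv)
      then have "\<alpha> \<notin> ?V \<or> \<beta> \<notin> ?V \<or> \<gamma> \<notin> ?V" using True False by auto
      then show ?thesis
        unfolding g wedge_2_1 wedge_1_2 contr_def by (elim disjE) (simp_all add: out)
    qed (simp add: wedge_length)
    have "?L x \<gamma>s = 0" using 1 2 by (simp add: modified_bracket_def)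
    moreover have "exterior_map A (TMR \<A>) (anchor_W as W) \<Psi> x \<gamma>s = 0"
      using False alt_formsD(1)[OF forms_alt[OF \<Psi>], of "map _ \<gamma>s" x] by (auto simp: exterior_map_def)
    ultimately show ?thesis by simp
  qed
qed

end

theorem theorem3p2:
  fixes \<A> :: "('m::{t2_space, second_countable_topology}, 'e::euclidean_space) atlas"
    and A :: "('m, 'v::real_vector) vbundle"
    and a :: "('m, 'v) anchor" and br :: "('m, 'v) bracket"
    and as :: "('m, 'v \<Rightarrow> real) anchor" and brs :: "('m, 'v \<Rightarrow> real) bracket"
    and \<phi> :: "'m \<Rightarrow> 'v \<Rightarrow> real" and W :: "'m \<Rightarrow> 'v" and \<Psi> :: "('m, 'v) form"
  assumes "smooth_manifold \<A>"
    and "quasi_Jacobi_bialgebroid \<A> A a br S as brs \<phi> W \<Psi>"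
    and "schouten_bracket \<A> (TMR \<A>) TMR_anchor TMR_bracket T"
  shows "quasi_Jacobi_structure \<A> T A as W \<Psi>
    (\<lambda>f g. pairing (twisted_differential \<A> A a br (form1 \<phi>) 0 (form0 f))
                   (twisted_differential \<A> (dual \<A> A) as brs (vec1 A W) 0 (form0 g)))"
proof -
  have "vector_bundle \<A> A"
    using assms(2) unfolding quasi_Jacobi_bialgebroid_def Let_def by (rule conjunct1)
  then obtain \<Phi> where "framed_bundle \<A> A \<Phi>" using vector_bundle_framed[OF assms(1)] by blast
  then interpret quasi_Jacobi \<A> A \<Phi> a br S as brs \<phi> W \<Psi>
    using assms(2) by (simp add: quasi_Jacobi_def quasi_Jacobi_axioms_def)
  show ?thesis
    unfolding quasi_Jacobi_structure_def Let_def
  proof (intro bexI conjI ballI)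
    show "(1 / 2) *\<^sub>R modified_bracket T (TMR_cocycle \<A>) 2 (TMR_pair \<A> 2 \<Lambda> (vec1 (TM \<A>) E)) 2
        (TMR_pair \<A> 2 \<Lambda> (vec1 (TM \<A>) E)) = exterior_map A (TMR \<A>) (anchor_W as W) \<Psi>"
      using quasi_Jacobi_equation[OF assms(3)] unfolding J_def .
    fix f g assume f: "f \<in> Cinf \<A>" and g: "g \<in> Cinf \<A>"
    show "pairing (twisted_differential \<A> A a br (form1 \<phi>) 0 (form0 f)) (dW 0 (form0 g)) =
        (\<lambda>x. \<Lambda> x [deRham \<A> f x, deRham \<A> g x] + f x * E x g - g x * E x f)"
      unfolding bracket_is_pairing[OF f g] using bracket_decomposition[OF f g] by blast
  qed (rule E_section \<Lambda>_multisection)+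
qed

end
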